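(* Let $C = \{f(x,y,z) =0\} \subset \mathbb{P}^{2}_{\mathbb{C}}$ be an arrangement of $k$ smooth conics and $d$ lines with only ordinary quasi-homogeneous singularities. Assume that $C$ is free. Consider the surface $$X = \{F(x,y,z,w) = f(x,y,z)+w^{2k+d} = 0\} \subset \mathbb{P}^{3}_{\mathbb{C}}.$$ Then $X$ has only isolated singularities and $$\tau(X) \geq (2k+d-1)\cdot\bigg(3k(k-1) + 3kd + \frac{3(d-1)^2}{4}\bigg).$$
   Context: We work over $\mathbb{C}$. An arrangement of $k$ smooth conics and $d$ lines is the reduced plane curve $C=\{f=0\}\subset\mathbb{P}^2$ which is the union of $k$ distinct smooth conics and $d$ distinct lines; $f\in S=\mathbb{C}[x,y,z]$ is its homogeneous defining polynomial, of degree $2k+d$. A singular point $p$ of $C$ is ordinary of multiplicity $r\ge 2$ if exactly $r$ of the component curves pass through $p$ and they meet pairwise transversally there. It is quasi-homogeneous if, in suitable local analytic coordinates centered at $p$, the germ of $C$ at $p$ is defined by a weighted-homogeneous polynomial (with positive weights). Let $AR(f)=\{(a,b,c)\in S^3: af_x+bf_y+cf_z=0\}$, a graded $S$-module. The curve $C$ is free if $AR(f)$ is a free graded $S$-module of rank $2$. For a surface $X\subset\mathbb{P}^3$ with only isolated singularities, $\tau(X)=\sum_{p\in\mathrm{Sing}(X)}\tau_p(X)$, where, if $g\in\mathbb{C}\{u_1,u_2,u_3\}$ is a local equation of $X$ at $p$ (moved to the origin), $\tau_p(X)=\dim_{\mathbb{C}}\mathbb{C}\{u_1,u_2,u_3\}/\langle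 g,g_{u_1},g_{u_2},g_{u_3}\rangle$. *)

theory Defs
  imports "HOL-Analysis.Analysis" "HOL-Library.Poly_Mapping"
begin

section \<open>Complex polynomials in variables indexed by a finite type\<close>

type_synonym 'v mpoly = "('v \<Rightarrow>\<^sub>0 nat) \<Rightarrow>\<^sub>0 complex"

definition Const :: "complex \<Rightarrow> 'v mpoly" where
  "Const c = Poly_Mapping.single 0 c"

definition Var :: "'v \<Rightarrow> 'v mpoly" where
  "Var i = Poly_Mapping.single (Poly_Mapping.single i 1) 1"

definition mdeg :: "('v::finite \<Rightarrow>\<^sub>0 nat) \<Rightarrow> nat" where
  "mdeg m = (\<Sum>i\<in>UNIV. Poly_Mapping.lookup m i)"

definition homogeneous :: "nat \<Rightarrow> 'v::finite mpoly \<Rightarrow> bool" where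
  "homogeneous n p \<longleftrightarrow> (\<forall>m\<in>Poly_Mapping.keys p. mdeg m = n)"

definition mp_deriv :: "'v \<Rightarrow> 'v mpoly \<Rightarrow> 'v mpoly" where
  "mp_deriv i p = (\<Sum>m\<in>Poly_Mapping.keys p.
     Poly_Mapping.single (m - Poly_Mapping.single i 1)
       (of_nat (Poly_Mapping.lookup m i) * Poly_Mapping.lookup p m))"

text \<open>
  The value of \<open>p\<close> at the tuple \<open>x\<close> in a commutative complex algebra whose structure map is \<open>e\<close>.
  It is evaluation at a point for \<open>e = id\<close>, and substitution of polynomials for \<open>e = Const\<close>.
\<close>

definition mp_eval :: "(complex \<Rightarrow> 'a::comm_ring_1) \<Rightarrow> 'a ^ 'v \<Rightarrow> 'v::finite mpoly \<Rightarrow> 'a" where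
  "mp_eval e x p = (\<Sum>m\<in>Poly_Mapping.keys p.
     e (Poly_Mapping.lookup p m) * (\<Prod>i\<in>UNIV. (x $ i) ^ Poly_Mapping.lookup m i))"


section \<open>Convergent power series\<close>

definition convergent_coeffs :: "(('v::finite \<Rightarrow>\<^sub>0 nat) \<Rightarrow> complex) \<Rightarrow> bool" where
  "convergent_coeffs a \<longleftrightarrow> (\<exists>r>0. (\<lambda>m. norm (a m) * r ^ mdeg m) summable_on UNIV)"

definition splits :: "('v::finite \<Rightarrow>\<^sub>0 nat) \<Rightarrow> (('v \<Rightarrow>\<^sub>0 nat) \<times> ('v \<Rightarrow>\<^sub>0 nat)) set" where
  "splits m = {(s, t). s + t = m}"

lemma mdeg_0 [simp]: "mdeg 0 = 0"
  by (simp add: mdeg_def)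

lemma mdeg_add: "mdeg (s + t) = mdeg s + mdeg t"
  by (simp add: mdeg_def lookup_add sum.distrib)

lemma finite_splits [simp]: "finite (splits m)"
proof -
  let ?B = "{s :: 'a \<Rightarrow>\<^sub>0 nat. \<forall>i. Poly_Mapping.lookup s i \<le> Poly_Mapping.lookup m i}"
  have "Poly_Mapping.lookup ` ?B \<subseteq> (\<Pi>\<^sub>E i\<in>UNIV. {..Poly_Mapping.lookup m i})"
    by auto
  moreover have "finite (\<Pi>\<^sub>E i\<in>(UNIV :: 'a set). {..Poly_Mapping.lookup m i})"
    by (intro finite_PiE) auto
  ultimately have "finite (Poly_Mapping.lookup ` ?B)"
    by (rule finite_subset)
  then have "finite ?B"
    by (rule finite_imageD) (auto simp: inj_on_def intro: poly_mapping_eqI)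
  moreover have "splits m \<subseteq> ?B \<times> ?B"
    by (auto simp: splits_def lookup_add)
  ultimately show ?thesis
    by (meson finite_SigmaI finite_subset)
qed

lemma splits_0 [simp]: "splits 0 = {(0, 0)}"
proof -
  have *: "s = 0 \<and> t = 0" if "s + t = 0" for s t :: "'a \<Rightarrow>\<^sub>0 nat"
  proof -
    have "Poly_Mapping.lookup s i + Poly_Mapping.lookup t i = 0" for i
      by (metis that lookup_add lookup_zero)
    then show ?thesis
      by (auto intro!: poly_mapping_eqI)
  qed
  show ?thesis
  proof (rule equalityI)
    show "splits (0 :: 'a \<Rightarrow>\<^sub>0 nat) \<subseteq> {(0, 0)}"
      unfolding splits_def using * by blast
  qed (simp add: splits_def)
qed

lemma convergent_coeffs_shrink:
  assumes "(\<lambda>m. norm (a m) * r ^ mdeg m) summable_on UNIV" "0 < q" "q \<le> r"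
  shows "(\<lambda>m. norm (a m) * q ^ mdeg m) summable_on UNIV"
  by (rule summable_on_comparison_test[OF assms(1)])
     (use assms in \<open>auto intro!: mult_left_mono power_mono\<close>)

lemma convergent_coeffs_common:
  assumes "convergent_coeffs a" "convergent_coeffs b"
  obtains r where "r > 0" "(\<lambda>m. norm (a m) * r ^ mdeg m) summable_on UNIV"
    "(\<lambda>m. norm (b m) * r ^ mdeg m) summable_on UNIV"
proof -
  obtain q r where "q > 0" "r > 0"
    "(\<lambda>m. norm (a m) * q ^ mdeg m) summable_on UNIV"
    "(\<lambda>m. norm (b m) * r ^ mdeg m) summable_on UNIV"
    using assms unfolding convergent_coeffs_def by blast
  then show thesis
    using convergent_coeffs_shrink[of a q "min q r"] convergent_coeffs_shrink[of b r "min q r"]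
    by (intro that[of "min q r"]) auto
qed

lemma convergent_coeffs_finite_support:
  assumes "finite {m. a m \<noteq> 0}"
  shows "convergent_coeffs a"
proof -
  have "(\<lambda>m. norm (a m) * 1 ^ mdeg m) summable_on {m. a m \<noteq> 0}"
    using assms by (rule summable_on_finite)
  then have "(\<lambda>m. norm (a m) * 1 ^ mdeg m) summable_on UNIV"
    by (subst summable_on_cong_neutral[where T = "{m. a m \<noteq> 0}"]) auto
  then show ?thesis
    unfolding convergent_coeffs_def by (intro exI[of _ 1]) auto
qed

lemma convergent_coeffs_add:
  assumes "convergent_coeffs a" "convergent_coeffs b"
  shows "convergent_coeffs (\<lambda>m. a m + b m)"
proof -
  obtain r where r: "r > 0" "(\<lambda>m. norm (a m) * r ^ mdeg m) summable_on UNIV"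
    "(\<lambda>m. norm (b m) * r ^ mdeg m) summable_on UNIV"
    using convergent_coeffs_common[OF assms] .
  have "(\<lambda>m. norm (a m) * r ^ mdeg m + norm (b m) * r ^ mdeg m) summable_on UNIV"
    using r by (intro summable_on_add)
  then have "(\<lambda>m. norm (a m + b m) * r ^ mdeg m) summable_on UNIV"
  proof (rule summable_on_comparison_test)
    show "norm (a m + b m) * r ^ mdeg m \<le> norm (a m) * r ^ mdeg m + norm (b m) * r ^ mdeg m" for m
      using r mult_right_mono[OF norm_triangle_ineq[of "a m" "b m"], of "r ^ mdeg m"]
      by (simp add: distrib_right)
  qed (use r in auto)
  then show ?thesis
    using r unfolding convergent_coeffs_def by blast
qed

lemma convergent_coeffs_uminus:
  "convergent_coeffs a \<Longrightarrow> convergent_coeffs (\<lambda>m. - a m)"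
  by (simp add: convergent_coeffs_def)

lemma convergent_coeffs_mult:
  fixes a b :: "('v::finite \<Rightarrow>\<^sub>0 nat) \<Rightarrow> complex"
  assumes "convergent_coeffs a" "convergent_coeffs b"
  shows "convergent_coeffs (\<lambda>m. \<Sum>(s, t)\<in>splits m. a s * b t)"
proof -
  obtain r where r: "r > 0" "(\<lambda>m. norm (a m) * r ^ mdeg m) summable_on UNIV"
    "(\<lambda>m. norm (b m) * r ^ mdeg m) summable_on UNIV"
    using convergent_coeffs_common[OF assms] .
  define A where "A = (\<lambda>m. norm (a m) * r ^ mdeg m)"
  define B where "B = (\<lambda>m. norm (b m) * r ^ mdeg m)"
  have nonneg: "A m \<ge> 0" "B m \<ge> 0" for m
    using r by (auto simp: A_def B_def)
  have "(\<lambda>(s, t). A s * B t) summable_on (UNIV \<times> UNIV)"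
  proof (rule summable_on_SigmaI)
    show "((\<lambda>t. case (s, t) of (s, t) \<Rightarrow> A s * B t) has_sum A s * infsum B UNIV) UNIV" for s
      using r by (auto intro!: has_sum_cmult_right has_sum_infsum simp: B_def)
    show "(\<lambda>s. A s * infsum B UNIV) summable_on UNIV"
      using r by (intro summable_on_cmult_left) (simp add: A_def)
  qed (use nonneg in auto)
  also have "?this \<longleftrightarrow> (\<lambda>(m, s, t). A s * B t) summable_on (SIGMA m:UNIV. splits m)"
    by (rule summable_on_reindex_bij_witness[where i = snd and j = "\<lambda>(s, t). (s + t, s, t)"])
       (auto simp: splits_def)
  finally have "(\<lambda>m. \<Sum>\<^sub>\<infinity>(s, t)\<in>splits m. A s * B t) summable_on UNIV"
    using summable_on_SigmaD[of "\<lambda>(m, s, t). A s * B t" UNIV splits]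
    by (simp add: summable_on_finite case_prod_unfold)
  then have "(\<lambda>m. \<Sum>(s, t)\<in>splits m. A s * B t) summable_on UNIV"
    by simp
  then have "(\<lambda>m. norm (\<Sum>(s, t)\<in>splits m. a s * b t) * r ^ mdeg m) summable_on UNIV"
  proof (rule summable_on_comparison_test)
    fix m :: "'v \<Rightarrow>\<^sub>0 nat"
    have "norm (\<Sum>(s, t)\<in>splits m. a s * b t) * r ^ mdeg m
        \<le> (\<Sum>(s, t)\<in>splits m. norm (a s) * norm (b t)) * r ^ mdeg m"
      using r by (intro mult_right_mono order.trans[OF norm_sum] sum_mono) (auto simp: norm_mult)
    also have "\<dots> = (\<Sum>(s, t)\<in>splits m. A s * B t)"
      unfolding sum_distrib_right
      by (intro sum.cong) (auto simp: splits_def A_def B_def mdeg_add power_add)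
    finally show "norm (\<Sum>(s, t)\<in>splits m. a s * b t) * r ^ mdeg m
        \<le> (\<Sum>(s, t)\<in>splits m. A s * B t)" .
  qed (use r in auto)
  then show ?thesis
    using r unfolding convergent_coeffs_def by blast
qed

typedef 'v cps = "{a :: ('v::finite \<Rightarrow>\<^sub>0 nat) \<Rightarrow> complex. convergent_coeffs a}"
  morphisms cps_coeff Abs_cps
  by (rule exI[of _ "\<lambda>_. 0"]) (simp add: convergent_coeffs_finite_support)

setup_lifting type_definition_cps

lemma splits_commute: "(\<Sum>(s, t)\<in>splits m. f s t) = (\<Sum>(s, t)\<in>splits m. f t s)"
  by (rule sum.reindex_bij_witness[where i = prod.swap and j = prod.swap])
     (auto simp: splits_def add.commute)

lemma splits_single:
  fixes m :: "'v::finite \<Rightarrow>\<^sub>0 nat"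
  shows "(\<Sum>(s, t)\<in>splits m. (if s = 0 then c else 0) * b t) = c * (b m :: complex)"
proof -
  have "(\<Sum>(s, t)\<in>splits m. (if s = 0 then c else 0) * b t)
      = (\<Sum>(s, t)\<in>{(0 :: 'v \<Rightarrow>\<^sub>0 nat, m)}. (if s = 0 then c else 0) * b t)"
  proof (rule sum.mono_neutral_right)
    show "{(0, m)} \<subseteq> splits m"
      by (simp add: splits_def)
    show "\<forall>x\<in>splits m - {(0, m)}. (case x of (s, t) \<Rightarrow> (if s = 0 then c else 0) * b t) = 0"
      by (auto simp: splits_def split: if_splits)
  qed simp
  then show ?thesis
    by simp
qed

lemma splits_assoc:
  fixes a b c :: "('v::finite \<Rightarrow>\<^sub>0 nat) \<Rightarrow> complex"
  shows "(\<Sum>(s, t)\<in>splits m. (\<Sum>(p, q)\<in>splits s. a p * b q) * c t)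
       = (\<Sum>(s, t)\<in>splits m. a s * (\<Sum>(p, q)\<in>splits t. b p * c q))"
proof -
  have "(\<Sum>(s, t)\<in>splits m. (\<Sum>(p, q)\<in>splits s. a p * b q) * c t)
      = (\<Sum>x\<in>splits m. \<Sum>y\<in>splits (fst x). a (fst y) * b (snd y) * c (snd x))"
    by (simp add: case_prod_unfold sum_distrib_right)
  also have "\<dots> = (\<Sum>(x, y)\<in>(SIGMA x:splits m. splits (fst x)). a (fst y) * b (snd y) * c (snd x))"
    by (rule sum.Sigma) auto
  also have "\<dots> = (\<Sum>(x, y)\<in>(SIGMA x:splits m. splits (snd x)). a (fst x) * (b (fst y) * c (snd y)))"
    by (rule sum.reindex_bij_witness[where
          i = "\<lambda>((s, t), (p, q)). ((s + p, q), (s, p))" and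
          j = "\<lambda>((s, t), (p, q)). ((p, q + t), (q, t))"])
       (auto simp: splits_def add.assoc)
  also have "\<dots> = (\<Sum>x\<in>splits m. \<Sum>y\<in>splits (snd x). a (fst x) * (b (fst y) * c (snd y)))"
    by (rule sum.Sigma[symmetric]) auto
  also have "\<dots> = (\<Sum>(s, t)\<in>splits m. a s * (\<Sum>(p, q)\<in>splits t. b p * c q))"
    by (simp add: case_prod_unfold sum_distrib_left)
  finally show ?thesis .
qed

lift_definition cps_const :: "complex \<Rightarrow> 'v::finite cps" is "\<lambda>c m. if m = 0 then c else 0"
  by (rule convergent_coeffs_finite_support) (rule finite_subset[of _ "{0}"], auto)

definition cps_of_mpoly :: "'v::finite mpoly \<Rightarrow> 'v cps" where
  "cps_of_mpoly p = Abs_cps (Poly_Mapping.lookup p)"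

lemma cps_coeff_of_mpoly [simp]: "cps_coeff (cps_of_mpoly p) = Poly_Mapping.lookup p"
  by (simp add: cps_of_mpoly_def Abs_cps_inverse convergent_coeffs_finite_support)

instantiation cps :: (finite) comm_ring_1
begin

lift_definition zero_cps :: "'a cps" is "\<lambda>_. 0"
  by (rule convergent_coeffs_finite_support) simp

definition one_cps :: "'a cps" where
  "one_cps = cps_const 1"

lift_definition plus_cps :: "'a cps \<Rightarrow> 'a cps \<Rightarrow> 'a cps" is "\<lambda>a b m. a m + b m"
  by (rule convergent_coeffs_add)

lift_definition uminus_cps :: "'a cps \<Rightarrow> 'a cps" is "\<lambda>a m. - a m"
  by (rule convergent_coeffs_uminus)

definition minus_cps :: "'a cps \<Rightarrow> 'a cps \<Rightarrow> 'a cps" where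
  "minus_cps a b = a + - b"

lift_definition times_cps :: "'a cps \<Rightarrow> 'a cps \<Rightarrow> 'a cps" is
  "\<lambda>a b m. \<Sum>(s, t)\<in>splits m. a s * b t"
  by (rule convergent_coeffs_mult)

instance
proof
  fix a b c :: "'a cps"
  show "a + b + c = a + (b + c)" by transfer (simp add: add.assoc)
  show "a + b = b + a" by transfer (simp add: add.commute)
  show "0 + a = a" by transfer simp
  show "- a + a = 0" by transfer simp
  show "a - b = a + - b" by (rule minus_cps_def)
  show "a * b * c = a * (b * c)" by transfer (simp only: splits_assoc)
  show "a * b = b * a"
  proof transfer
    fix a b :: "('a \<Rightarrow>\<^sub>0 nat) \<Rightarrow> complex"
    show "(\<lambda>m. \<Sum>(s, t)\<in>splits m. a s * b t) = (\<lambda>m. \<Sum>(s, t)\<in>splits m. b s * a t)"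
      by (subst splits_commute) (simp add: mult.commute)
  qed
  show "1 * a = a" unfolding one_cps_def by transfer (simp only: splits_single mult_1_left)
  show "(a + b) * c = a * c + b * c"
    by transfer (simp add: case_prod_unfold distrib_right sum.distrib)
  have "cps_coeff (0 :: 'a cps) 0 \<noteq> cps_coeff (1 :: 'a cps) 0"
    unfolding one_cps_def by transfer simp
  then show "(0 :: 'a cps) \<noteq> 1" by metis
qed

end


section \<open>Projective space\<close>

definition proportional :: "complex ^ 'n \<Rightarrow> complex ^ 'n \<Rightarrow> bool" where
  "proportional u v \<longleftrightarrow> u \<noteq> 0 \<and> v \<noteq> 0 \<and> (\<exists>c. v = c *s u)"

quotient_type 'n proj = "complex ^ ('n::finite)" / partial: proportional
proof (rule part_equivpI)
  show "\<exists>v :: complex ^ 'n. proportional v v"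
    by (rule exI[of _ 1]) (auto simp: proportional_def intro: exI[of _ 1])
  show "symp (proportional :: complex ^ 'n \<Rightarrow> _)"
  proof (rule sympI)
    fix u v :: "complex ^ 'n"
    assume uv: "proportional u v"
    then obtain c where c: "u \<noteq> 0" "v \<noteq> 0" "v = c *s u"
      by (auto simp: proportional_def)
    then have "u = inverse c *s v"
      by (auto simp: vec_eq_iff)
    with c show "proportional v u"
      unfolding proportional_def by blast
  qed
  show "transp (proportional :: complex ^ 'n \<Rightarrow> _)"
    by (rule transpI) (auto simp: proportional_def)
qed

text \<open>The quotient topology; \<open>abs_proj\<close> is meaningful on nonzero vectors only.\<close>

instantiation proj :: (finite) topological_space
begin

definition open_proj :: "'a proj set \<Rightarrow> bool" where
  "open_proj U \<longleftrightarrow> open {v. v \<noteq> 0 \<and> abs_proj v \<in> U}"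

instance
proof
  have "{v :: complex ^ 'a. v \<noteq> 0 \<and> abs_proj v \<in> UNIV} = - {0}"
    by auto
  then show "open (UNIV :: 'a proj set)"
    unfolding open_proj_def by (simp add: open_Compl)
next
  fix S T :: "'a proj set"
  assume "open S" "open T"
  moreover have "{v. v \<noteq> 0 \<and> abs_proj v \<in> S \<inter> T}
      = {v. v \<noteq> 0 \<and> abs_proj v \<in> S} \<inter> {v. v \<noteq> 0 \<and> abs_proj v \<in> T}"
    by auto
  ultimately show "open (S \<inter> T)"
    unfolding open_proj_def by (simp add: open_Int)
next
  fix K :: "'a proj set set"
  assume "\<forall>S\<in>K. open S"
  moreover have "{v. v \<noteq> 0 \<and> abs_proj v \<in> \<Union>K} = (\<Union>S\<in>K. {v. v \<noteq> 0 \<and> abs_proj v \<in> S})"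
    by auto
  ultimately show "open (\<Union>K)"
    unfolding open_proj_def by (simp add: open_UN)
qed

end

text \<open>
  The following are used for homogeneous \<open>F\<close> only, so that nothing depends on the
  representative \<open>rep_proj p\<close> of \<open>p\<close>.
\<close>

definition zero_locus :: "'n::finite mpoly \<Rightarrow> 'n proj set" where
  "zero_locus F = {p. mp_eval id (rep_proj p) F = 0}"

definition sing_locus :: "'n::finite mpoly \<Rightarrow> 'n proj set" where
  "sing_locus F = {p \<in> zero_locus F. \<forall>i. mp_eval id (rep_proj p) (mp_deriv i F) = 0}"

text \<open>The affine cone over the projective tangent hyperplane of \<open>F = 0\<close> at a smooth point \<open>p\<close>.\<close>

definition tangent_space :: "'n::finite mpoly \<Rightarrow> 'n proj \<Rightarrow> (complex ^ 'n) set" where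
  "tangent_space F p = {v. (\<Sum>i\<in>UNIV. mp_eval id (rep_proj p) (mp_deriv i F) * v $ i) = 0}"

text \<open>
  \<open>g\<close> is an equation of \<open>F = 0\<close> at \<open>p\<close>, moved to the origin, in a standard affine chart: \<open>v\<close>
  represents \<open>p\<close> with \<open>i\<close>-th homogeneous coordinate 1, and \<open>\<sigma>\<close> numbers the other coordinates, so
  that the homogeneous coordinate \<open>\<sigma> j\<close> becomes \<open>v $ \<sigma> j\<close> plus the \<open>j\<close>-th local coordinate.
\<close>

definition local_equation :: "'n::finite mpoly \<Rightarrow> 'n proj \<Rightarrow> 'm::finite mpoly \<Rightarrow> bool" where
  "local_equation F p g \<longleftrightarrow>
     (\<exists>i v \<sigma>. v $ i = 1 \<and> abs_proj v = p \<and> bij_betw \<sigma> UNIV (- {i}) \<and>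
        g = mp_eval Const (\<chi> l. Const (v $ l) + (\<Sum>j | \<sigma> j = l. Var j)) F)"


section \<open>Tjurina numbers\<close>

definition basis_mod :: "'v::finite cps set \<Rightarrow> 'v cps set \<Rightarrow> bool" where
  "basis_mod I B \<longleftrightarrow> finite B \<and>
     (\<forall>h. \<exists>c. h - (\<Sum>b\<in>B. cps_const (c b) * b) \<in> I) \<and>
     (\<forall>c. (\<Sum>b\<in>B. cps_const (c b) * b) \<in> I \<longrightarrow> (\<forall>b\<in>B. c b = 0))"

text \<open>
  The complex dimension of the quotient by the ideal \<open>I\<close>. As for \<open>dim\<close> in the library, it is 0 by
  convention if the quotient is infinite-dimensional.
\<close>

definition quotient_dim :: "'v::finite cps set \<Rightarrow> nat" where
  "quotient_dim I = (if \<exists>B. basis_mod I B then card (SOME B. basis_mod I B) else 0)"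

text \<open>The span of a set over the ring itself is the ideal that it generates.\<close>

definition tjurina_ideal :: "'v::finite mpoly \<Rightarrow> 'v cps set" where
  "tjurina_ideal g =
     module.span (*) (insert (cps_of_mpoly g) (range (\<lambda>i. cps_of_mpoly (mp_deriv i g))))"

definition local_tjurina :: "4 mpoly \<Rightarrow> 4 proj \<Rightarrow> nat" where
  "local_tjurina F p = quotient_dim (tjurina_ideal (SOME g :: 3 mpoly. local_equation F p g))"

definition total_tjurina :: "4 mpoly \<Rightarrow> nat" where
  "total_tjurina F = (\<Sum>p\<in>sing_locus F. local_tjurina F p)"


section \<open>Arrangements of smooth conics and lines\<close>

definition smooth_conic :: "3 mpoly \<Rightarrow> bool" where
  "smooth_conic q \<longleftrightarrow> homogeneous 2 q \<and> sing_locus q = {}"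

definition proj_line :: "3 mpoly \<Rightarrow> bool" where
  "proj_line l \<longleftrightarrow> homogeneous 1 l \<and> l \<noteq> 0"

text \<open>Each curve is given by one equation; different equations must define different curves.\<close>

definition conic_line_arrangement :: "3 mpoly set \<Rightarrow> 3 mpoly set \<Rightarrow> bool" where
  "conic_line_arrangement Q L \<longleftrightarrow>
     finite Q \<and> finite L \<and> (\<forall>q\<in>Q. smooth_conic q) \<and> (\<forall>l\<in>L. proj_line l) \<and>
     inj_on zero_locus Q \<and> inj_on zero_locus L"

definition transversal_at :: "3 mpoly \<Rightarrow> 3 mpoly \<Rightarrow> 3 proj \<Rightarrow> bool" where
  "transversal_at g h p \<longleftrightarrow>
     p \<in> zero_locus g - sing_locus g \<and> p \<in> zero_locus h - sing_locus h \<and>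
     tangent_space g p \<noteq> tangent_space h p"

definition ordinary_point :: "3 mpoly set \<Rightarrow> 3 proj \<Rightarrow> nat \<Rightarrow> bool" where
  "ordinary_point K p r \<longleftrightarrow>
     2 \<le> r \<and> card {g\<in>K. p \<in> zero_locus g} = r \<and>
     pairwise (\<lambda>g h. transversal_at g h p) {g\<in>K. p \<in> zero_locus g}"

definition weighted_homogeneous :: "('v::finite \<Rightarrow> real) \<Rightarrow> 'v mpoly \<Rightarrow> bool" where
  "weighted_homogeneous wt h \<longleftrightarrow>
     (\<exists>D. \<forall>m\<in>Poly_Mapping.keys h. (\<Sum>i\<in>UNIV. wt i * real (Poly_Mapping.lookup m i)) = D)"

text \<open>
  \<open>\<phi>\<close> consists of the components of a germ of biholomorphic map fixing the origin
  (inverse function theorem).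
\<close>

definition coordinate_change :: "('v::finite cps) ^ 'v \<Rightarrow> bool" where
  "coordinate_change \<phi> \<longleftrightarrow>
     (\<forall>i. cps_coeff (\<phi> $ i) 0 = 0) \<and>
     det (\<chi> i j. cps_coeff (\<phi> $ i) (Poly_Mapping.single j 1)) \<noteq> 0"

text \<open>
  In the coordinates \<open>\<phi>\<close>, the germ is defined by \<open>h\<close>: the pullback of a local equation \<open>g\<close> is a
  unit \<open>e\<close> times \<open>h\<close>.
\<close>

definition quasi_homogeneous_at :: "3 mpoly \<Rightarrow> 3 proj \<Rightarrow> bool" where
  "quasi_homogeneous_at f p \<longleftrightarrow>
     (\<exists>(g :: 2 mpoly) (\<phi> :: (2 cps) ^ 2) (e :: 2 cps) (h :: 2 mpoly) (wt :: 2 \<Rightarrow> real).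
        local_equation f p g \<and> coordinate_change \<phi> \<and> e dvd 1 \<and>
        (\<forall>i. wt i > 0) \<and> weighted_homogeneous wt h \<and>
        mp_eval cps_const \<phi> g = e * cps_of_mpoly h)"


section \<open>Free curves\<close>

definition AR :: "3 mpoly \<Rightarrow> (3 mpoly ^ 3) set" where
  "AR f = {\<rho>. (\<Sum>i\<in>UNIV. \<rho> $ i * mp_deriv i f) = 0}"

text \<open>Freeness as a graded module: there is a basis of homogeneous elements.\<close>

definition free_curve :: "3 mpoly \<Rightarrow> bool" where
  "free_curve f \<longleftrightarrow>
     (\<exists>B. card B = 2 \<and> (\<forall>\<rho>\<in>B. \<exists>n. \<forall>i. homogeneous n (\<rho> $ i)) \<and>
        \<not> module.dependent (*s) B \<and> module.span (*s) B = AR f)"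

text \<open>
  The scalar multiplications to which the constants of the locale \<open>module\<close> are applied above
  do satisfy its axioms.
\<close>

lemma module_times: "module ((*) :: 'a::comm_ring_1 \<Rightarrow> 'a \<Rightarrow> 'a)"
  by unfold_locales (simp_all add: algebra_simps)

lemma module_vec: "module ((*s) :: 'a::comm_ring_1 \<Rightarrow> 'a ^ 'n \<Rightarrow> 'a ^ 'n)"
  by unfold_locales (simp_all add: vec_eq_iff algebra_simps)

end

theory Submission
  imports Defs "HOL-Computational_Algebra.Polynomial_Factorial"
    "HOL-Computational_Algebra.Fundamental_Theorem_Algebra" "HOL-Computational_Algebra.Field_as_Ring"
begin

text \<open>
  Let \<open>m = 2k + d\<close> and let \<open>J\<close> be the Jacobian ideal of \<open>f\<close> in \<open>S = \<complex>[x, y, z]\<close>. The singular points of \<open>C\<close>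
  are transversal intersections of components, hence isolated, so some line \<open>l = 0\<close> avoids them. If
  \<open>b, c\<close> is a homogeneous basis of \<open>AR(f)\<close>, of degrees \<open>d\<^sub>1, d\<^sub>2\<close>, then \<open>b \<times> c\<close> restricts on that line to a
  nonzero constant multiple of the gradient of \<open>f\<close>. Therefore \<open>d\<^sub>1 + d\<^sub>2 = m - 1\<close> and \<open>l\<close> is a
  nonzerodivisor modulo \<open>J\<close>, and the exact sequence given by \<open>b, c\<close> shows that the graded pieces of
  \<open>S/J\<close> finally have dimension \<open>(m - 1)\<^sup>2 - d\<^sub>1 d\<^sub>2 \<ge> 3/4 (m - 1)\<^sup>2\<close>. For \<open>F = f + w^m\<close> the Jacobian ring
  is \<open>S/J \<otimes> \<complex>[w]/(w^(m - 1))\<close>, which multiplies this dimension by \<open>m - 1\<close>. Since \<open>l\<close> remains a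
  nonzerodivisor, a form that lies in the Tjurina ideal at every singular point of \<open>X\<close> lies in the
  Jacobian ideal of \<open>F\<close>, so the graded pieces embed into the sum of the local Tjurina algebras.
\<close>

section \<open>Polynomials\<close>

text \<open>The target number is \<open>3/4 (m - 1)^3\<close>:
  \<open>3k(k-1) + 3kd + 3(d-1)^2/4\<close> equals \<open>3/4 (2k+d-1)^2\<close>, and 3/4 is
  \<open>1 - 1/4\<close> by \<open>4 d1 d2 \<le> (d1 + d2)^2\<close>. A sum over an infinite set and
  \<open>quotient_dim\<close> of an infinite-dimensional quotient are both 0, so a lower bound for
  \<open>total_tjurina\<close> demands finiteness of the singular locus and of every local algebra.
  Both come from integrality: graded pieces of bounded dimension make the forms
  \<open>l^(n-j) x_i^j\<close> dependent modulo \<open>J\<close>, and cancelling powers of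
  \<open>l\<close> leaves a product of linear factors \<open>x_i - b l\<close> in \<open>J\<close>.
  These products also supply the zeros in a Nullstellensatz on the affine part \<open>l = 1\<close>
  and, at each point, a cofactor that removes the other points. The obstacle in passing from local
  to global is that Tjurina ideals consist of power series; they contain high powers of the local
  coordinates, so coefficients can be truncated. The line exists because isolated points in a second
  countable space are countable, while a one-parameter family of lines is not.\<close>

lemma Const_0 [simp]: "Const 0 = 0"
  by (simp add: Const_def)

lemma Const_1 [simp]: "Const 1 = 1"
  by (simp add: Const_def)

lemma Const_add: "Const (a + b) = Const a + Const b"
  by (simp add: Const_def single_add)

lemma Const_mult: "Const (a * b) = Const a * Const b"
  by (simp add: Const_def mult_single)

lemma Const_uminus: "Const (- a) = - Const a"
  by (simp add: Const_def single_uminus)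

lemma Const_of_nat: "Const (of_nat n) = of_nat n"
  by (induction n) (auto simp: Const_add)

lemma mdeg_single [simp]: "mdeg (Poly_Mapping.single i n) = n"
  by (simp add: mdeg_def lookup_single when_def)

lemma mdeg_eq_0_iff [simp]: "mdeg m = 0 \<longleftrightarrow> m = 0"
  by (auto simp: mdeg_def intro: poly_mapping_eqI)

lemma single_diff_add:
  fixes m :: "'v \<Rightarrow>\<^sub>0 nat"
  assumes "Poly_Mapping.lookup m i > 0"
  shows "m = Poly_Mapping.single i 1 + (m - Poly_Mapping.single i 1)"
  using assms by (intro poly_mapping_eqI) (auto simp: lookup_add lookup_minus lookup_single when_def)

lemma Var_mult_single:
  "Var i * Poly_Mapping.single m c = Poly_Mapping.single (Poly_Mapping.single i 1 + m) c"
  by (simp add: Var_def mult_single)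

lemma Const_mult_single:
  "Const a * Poly_Mapping.single m c = Poly_Mapping.single m (a * c)"
  by (simp add: Const_def mult_single)

lemma mpoly_expand: "p = (\<Sum>m\<in>Poly_Mapping.keys p. Poly_Mapping.single m (Poly_Mapping.lookup p m))"
  by (rule poly_mapping_eqI) (auto simp: lookup_sum lookup_single when_def in_keys_iff)

text \<open>One variable at a time is split off. The exponent is an argument of \<open>P\<close> so
  that the rule serves both \<open>mpoly_induct\<close>, which ignores it, and
  \<open>homogeneous_induct\<close>, which reads off its degree.\<close>

lemma monomial_induct [case_names Const Var]:
  fixes m :: "'v::finite \<Rightarrow>\<^sub>0 nat"
  assumes "P 0 (Const c)"
    and "\<And>i m. P m (Poly_Mapping.single m c) \<Longrightarrow>
      P (Poly_Mapping.single i 1 + m) (Var i * Poly_Mapping.single m c)"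
  shows "P m (Poly_Mapping.single m c)"
proof (induction "mdeg m" arbitrary: m)
  case 0
  then show ?case using assms(1) by (simp add: Const_def)
next
  case (Suc n)
  then have "m \<noteq> 0" by auto
  then obtain i where i: "Poly_Mapping.lookup m i > 0"
    by (metis gr0I lookup_zero poly_mapping_eqI)
  define m' where "m' = m - Poly_Mapping.single i 1"
  have m: "m = Poly_Mapping.single i 1 + m'"
    unfolding m'_def by (rule single_diff_add[OF i])
  then have "mdeg m' = n"
    using Suc(2) by (simp add: mdeg_add)
  with Suc(1) have "P m' (Poly_Mapping.single m' c)" by blast
  then show ?case
    unfolding m using assms(2)[of m' i] by (simp add: Var_mult_single)
qed

lemma mpoly_induct [case_names Const Var add]:
  fixes p :: "'v::finite mpoly"
  assumes "\<And>c. P (Const c)" and "\<And>i p. P p \<Longrightarrow> P (Var i * p)"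
    and "\<And>p q. P p \<Longrightarrow> P q \<Longrightarrow> P (p + q)"
  shows "P p"
proof -
  have *: "P (Poly_Mapping.single m c)" for m c
    by (rule monomial_induct[of "\<lambda>_. P"]) (use assms in auto)
  have "P (\<Sum>m\<in>A. Poly_Mapping.single m (Poly_Mapping.lookup p m))" if "finite A" for A
    using that by (induction A) (use * assms(1)[of 0] assms(3) in auto)
  then show ?thesis
    by (subst mpoly_expand) auto
qed

lemma homogeneousI: "(\<And>m. Poly_Mapping.lookup p m \<noteq> 0 \<Longrightarrow> mdeg m = n) \<Longrightarrow> homogeneous n p"
  by (auto simp: homogeneous_def in_keys_iff)

lemma homogeneousD: "homogeneous n p \<Longrightarrow> Poly_Mapping.lookup p m \<noteq> 0 \<Longrightarrow> mdeg m = n"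
  by (auto simp: homogeneous_def in_keys_iff)

lemma homogeneous_0 [simp]: "homogeneous n 0"
  by (simp add: homogeneous_def)

lemma homogeneous_add: "homogeneous n p \<Longrightarrow> homogeneous n q \<Longrightarrow> homogeneous n (p + q)"
  unfolding homogeneous_def using keys_add[of p q] by blast

lemma homogeneous_sum: "(\<And>x. x \<in> A \<Longrightarrow> homogeneous n (f x)) \<Longrightarrow> homogeneous n (\<Sum>x\<in>A. f x)"
  by (induction A rule: infinite_finite_induct) (auto intro: homogeneous_add)

lemma homogeneous_mult: "homogeneous n p \<Longrightarrow> homogeneous k q \<Longrightarrow> homogeneous (n + k) (p * q)"
  unfolding homogeneous_def using keys_mult[of p q] by (force simp: mdeg_add)

lemma homogeneous_uminus: "homogeneous n p \<Longrightarrow> homogeneous n (- p)"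
  by (rule homogeneousI) (use homogeneousD in fastforce)

lemma homogeneous_diff: "homogeneous n p \<Longrightarrow> homogeneous n q \<Longrightarrow> homogeneous n (p - q)"
  using homogeneous_add[of n p "- q"] by (simp add: homogeneous_uminus)

lemma homogeneous_Const [simp]: "homogeneous 0 (Const c)"
  by (simp add: homogeneous_def Const_def)

lemma homogeneous_1 [simp]: "homogeneous 0 1"
  by (simp add: homogeneous_def)

lemma homogeneous_Var [simp]: "homogeneous 1 (Var i)"
  by (simp add: homogeneous_def Var_def)

lemma homogeneous_single [simp]: "homogeneous (mdeg m) (Poly_Mapping.single m c)"
  by (simp add: homogeneous_def)

lemma homogeneous_Const_mult: "homogeneous n p \<Longrightarrow> homogeneous n (Const c * p)"
  using homogeneous_mult[OF homogeneous_Const[of c]] by fastforce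

lemma homogeneous_Var_mult: "homogeneous n p \<Longrightarrow> homogeneous (Suc n) (Var i * p)"
  using homogeneous_mult[OF homogeneous_Var[of i]] by fastforce

lemma homogeneous_power: "homogeneous n p \<Longrightarrow> homogeneous (k * n) (p ^ k)"
  by (induction k) (auto intro: homogeneous_mult)

lemma homogeneous_prod:
  "(\<And>x. x \<in> A \<Longrightarrow> homogeneous (n x) (f x)) \<Longrightarrow> homogeneous (\<Sum>x\<in>A. n x) (\<Prod>x\<in>A. f x)"
  by (induction A rule: infinite_finite_induct) (auto intro: homogeneous_mult)

lemma homogeneous_prod_list:
  "(\<And>x. x \<in> set xs \<Longrightarrow> homogeneous 1 (f x)) \<Longrightarrow> homogeneous (length xs) (\<Prod>x\<leftarrow>xs. f x)"
proof (induction xs)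
  case (Cons x xs)
  then show ?case
    using homogeneous_mult[of 1 "f x" "length xs"] by auto
qed auto

text \<open>The case \<open>zero\<close> stands apart because 0 is homogeneous of every degree,
  whereas \<open>Const\<close> covers degree 0 alone.\<close>

lemma homogeneous_induct [consumes 1, case_names Const Var zero add]:
  fixes p :: "'v::finite mpoly"
  assumes "homogeneous n p"
    and "\<And>c. P 0 (Const c)" and "\<And>i n p. homogeneous n p \<Longrightarrow> P n p \<Longrightarrow> P (Suc n) (Var i * p)"
    and "\<And>n. P n 0"
    and "\<And>n p q. P n p \<Longrightarrow> P n q \<Longrightarrow> P n (p + q)"
  shows "P n p"
proof -
  have *: "P (mdeg m) (Poly_Mapping.single m c)" for m c
    by (rule monomial_induct[of "\<lambda>m p. P (mdeg m) p"])
       (use assms in \<open>auto simp: mdeg_add\<close>)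
  have "P n (\<Sum>m\<in>A. Poly_Mapping.single m (Poly_Mapping.lookup p m))"
    if "finite A" "A \<subseteq> Poly_Mapping.keys p" for A
    using that
  proof (induction A)
    case (insert m A)
    then have "mdeg m = n"
      using assms(1) by (auto simp: homogeneous_def)
    then show ?case
      using insert *[of m "Poly_Mapping.lookup p m"] by (auto intro!: assms(5))
  qed (use assms(4) in auto)
  then show ?thesis
    by (subst mpoly_expand) auto
qed

section \<open>Ring homomorphisms and evaluation of polynomials\<close>

definition ring_morphism :: "('a::comm_ring_1 \<Rightarrow> 'b::comm_ring_1) \<Rightarrow> bool" where
  "ring_morphism \<phi> \<longleftrightarrow> \<phi> 1 = 1 \<and> (\<forall>a b. \<phi> (a + b) = \<phi> a + \<phi> b) \<and> (\<forall>a b. \<phi> (a * b) = \<phi> a * \<phi> b)"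

lemma ring_morphism_add: "ring_morphism \<phi> \<Longrightarrow> \<phi> (a + b) = \<phi> a + \<phi> b"
  and ring_morphism_mult: "ring_morphism \<phi> \<Longrightarrow> \<phi> (a * b) = \<phi> a * \<phi> b"
  and ring_morphism_1: "ring_morphism \<phi> \<Longrightarrow> \<phi> 1 = 1"
  by (auto simp: ring_morphism_def)

lemma ring_morphism_0: "ring_morphism \<phi> \<Longrightarrow> \<phi> 0 = 0"
  by (metis add_cancel_left_left add.right_neutral ring_morphism_def)

lemma ring_morphism_uminus: "ring_morphism \<phi> \<Longrightarrow> \<phi> (- a) = - \<phi> a"
  by (metis add.right_inverse add_eq_0_iff ring_morphism_0 ring_morphism_add)

lemma ring_morphism_diff: "ring_morphism \<phi> \<Longrightarrow> \<phi> (a - b) = \<phi> a - \<phi> b"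
  by (metis diff_conv_add_uminus ring_morphism_add ring_morphism_uminus)

lemma ring_morphism_sum: "ring_morphism \<phi> \<Longrightarrow> \<phi> (\<Sum>x\<in>A. f x) = (\<Sum>x\<in>A. \<phi> (f x))"
  by (induction A rule: infinite_finite_induct) (auto simp: ring_morphism_0 ring_morphism_add)

lemma ring_morphism_prod: "ring_morphism \<phi> \<Longrightarrow> \<phi> (\<Prod>x\<in>A. f x) = (\<Prod>x\<in>A. \<phi> (f x))"
  by (induction A rule: infinite_finite_induct) (auto simp: ring_morphism_1 ring_morphism_mult)

lemma ring_morphism_prod_list: "ring_morphism \<phi> \<Longrightarrow> \<phi> (\<Prod>x\<leftarrow>xs. f x) = (\<Prod>x\<leftarrow>xs. \<phi> (f x))"
  by (induction xs) (auto simp: ring_morphism_1 ring_morphism_mult)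

lemma ring_morphism_power: "ring_morphism \<phi> \<Longrightarrow> \<phi> (a ^ n) = \<phi> a ^ n"
  by (induction n) (auto simp: ring_morphism_1 ring_morphism_mult)

lemmas ring_morphism_simps =
  ring_morphism_add ring_morphism_mult ring_morphism_1 ring_morphism_0 ring_morphism_uminus
  ring_morphism_diff ring_morphism_sum ring_morphism_prod ring_morphism_prod_list ring_morphism_power

lemma ring_morphism_comp:
  "ring_morphism \<phi> \<Longrightarrow> ring_morphism \<psi> \<Longrightarrow> ring_morphism (\<lambda>a. \<phi> (\<psi> a))"
  by (auto simp: ring_morphism_def)

lemma ring_morphism_id [simp]: "ring_morphism id"
  by (simp add: ring_morphism_def)

lemma ring_morphism_ident [simp]: "ring_morphism (\<lambda>a. a)"
  by (simp add: ring_morphism_def)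

lemma ring_morphism_Const [simp]: "ring_morphism (Const :: complex \<Rightarrow> 'v mpoly)"
  by (simp add: ring_morphism_def Const_add Const_mult)

lemma ring_morphism_eqI:
  fixes \<phi> \<psi> :: "'v::finite mpoly \<Rightarrow> 'a::comm_ring_1"
  assumes "ring_morphism \<phi>" "ring_morphism \<psi>"
    and "\<And>c. \<phi> (Const c) = \<psi> (Const c)" "\<And>i. \<phi> (Var i) = \<psi> (Var i)"
  shows "\<phi> p = \<psi> p"
  by (induction p rule: mpoly_induct)
     (use assms in \<open>auto simp: ring_morphism_add ring_morphism_mult\<close>)

context
  fixes e :: "complex \<Rightarrow> 'a::comm_ring_1" and x :: "'a ^ 'v::finite"
  assumes e: "ring_morphism e"
begin

text \<open>The support of a sum can be smaller than the union of the supports. Summing over a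
  common finite superset makes additivity a termwise matter.\<close>

lemma mp_eval_superset:
  assumes "finite A" "Poly_Mapping.keys p \<subseteq> A"
  shows "mp_eval e x p = (\<Sum>m\<in>A. e (Poly_Mapping.lookup p m) * (\<Prod>i\<in>UNIV. (x $ i) ^ Poly_Mapping.lookup m i))"
  unfolding mp_eval_def
  by (rule sum.mono_neutral_left) (use assms e in \<open>auto simp: in_keys_iff ring_morphism_0\<close>)

lemma mp_eval_add: "mp_eval e x (p + q) = mp_eval e x p + mp_eval e x q"
proof -
  let ?A = "Poly_Mapping.keys p \<union> Poly_Mapping.keys q"
  have "Poly_Mapping.keys (p + q) \<subseteq> ?A" by (rule keys_add)
  then show ?thesis
    using mp_eval_superset[of ?A p] mp_eval_superset[of ?A q] mp_eval_superset[of ?A "p + q"]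
    by (simp add: lookup_add ring_morphism_add[OF e] distrib_right sum.distrib)
qed

lemma mp_eval_single:
  "mp_eval e x (Poly_Mapping.single m c) = e c * (\<Prod>i\<in>UNIV. (x $ i) ^ Poly_Mapping.lookup m i)"
  using mp_eval_superset[of "{m}" "Poly_Mapping.single m c"] by (simp split: if_splits)

lemma mp_eval_Const [simp]: "mp_eval e x (Const c) = e c"
  by (simp add: Const_def mp_eval_single)

lemma mp_eval_Var_mult: "mp_eval e x (Var j * p) = x $ j * mp_eval e x p"
proof -
  have *: "mp_eval e x (Var j * Poly_Mapping.single m c) = x $ j * mp_eval e x (Poly_Mapping.single m c)" for m c
  proof -
    have "(\<Prod>i\<in>UNIV. (x $ i) ^ (Poly_Mapping.lookup (Poly_Mapping.single j 1) i))
        = (\<Prod>i\<in>UNIV. if i = j then x $ j else 1)"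
      by (intro prod.cong) (auto simp: lookup_single when_def)
    then show ?thesis
      by (simp add: Var_mult_single mp_eval_single lookup_add power_add prod.distrib mult_ac)
  qed
  have **: "mp_eval e x (sum f A) = (\<Sum>a\<in>A. mp_eval e x (f a))" for f and A :: "('v \<Rightarrow>\<^sub>0 nat) set"
    by (induction A rule: infinite_finite_induct) (auto simp: mp_eval_add mp_eval_def[of _ _ 0])
  show ?thesis
    by (subst (1 2) mpoly_expand[of p]) (simp add: ** sum_distrib_left *)
qed

lemma mp_eval_mult: "mp_eval e x (p * q) = mp_eval e x p * mp_eval e x q"
proof (induction p rule: mpoly_induct)
  case (Const c)
  show ?case
  proof (induction q rule: mpoly_induct)
    case (Var i q)
    then show ?case
      by (metis (no_types, lifting) mp_eval_Var_mult mult.left_commute)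
  qed (auto simp: distrib_left mp_eval_add ring_morphism_mult[OF e] simp flip: Const_mult)
qed (auto simp: distrib_right mp_eval_add mp_eval_Var_mult mult.assoc)

lemma ring_morphism_mp_eval [simp]: "ring_morphism (mp_eval e x)"
  using mp_eval_Const[of 1] by (simp add: ring_morphism_def mp_eval_add mp_eval_mult ring_morphism_1[OF e])

lemma mp_eval_Var [simp]: "mp_eval e x (Var j) = x $ j"
  using mp_eval_Var_mult[of j 1] by (simp add: ring_morphism_1)

end

lemma mp_eval_0 [simp]: "mp_eval e x 0 = 0"
  by (simp add: mp_eval_def)

lemmas mp_eval_simps = ring_morphism_simps[OF ring_morphism_mp_eval]

section \<open>Partial derivatives and Euler's identity\<close>

lemma mp_deriv_superset:
  assumes "finite A" "Poly_Mapping.keys p \<subseteq> A"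
  shows "mp_deriv i p = (\<Sum>m\<in>A. Poly_Mapping.single (m - Poly_Mapping.single i 1)
       (of_nat (Poly_Mapping.lookup m i) * Poly_Mapping.lookup p m))"
  unfolding mp_deriv_def
  by (rule sum.mono_neutral_left) (use assms in \<open>auto simp: in_keys_iff\<close>)

lemma mp_deriv_add: "mp_deriv i (p + q) = mp_deriv i p + mp_deriv i q"
proof -
  let ?A = "Poly_Mapping.keys p \<union> Poly_Mapping.keys q"
  have "Poly_Mapping.keys (p + q) \<subseteq> ?A" by (rule keys_add)
  then show ?thesis
    using mp_deriv_superset[of ?A p] mp_deriv_superset[of ?A q] mp_deriv_superset[of ?A "p + q"]
    by (simp add: lookup_add distrib_left sum.distrib single_add)
qed

lemma mp_deriv_0 [simp]: "mp_deriv i 0 = 0"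
  by (simp add: mp_deriv_def)

lemma mp_deriv_sum: "mp_deriv i (sum f A) = (\<Sum>a\<in>A. mp_deriv i (f a))"
  by (induction A rule: infinite_finite_induct) (auto simp: mp_deriv_add)

lemma mp_deriv_single:
  "mp_deriv i (Poly_Mapping.single m c) =
     Poly_Mapping.single (m - Poly_Mapping.single i 1) (of_nat (Poly_Mapping.lookup m i) * c)"
  using mp_deriv_superset[of "{m}" "Poly_Mapping.single m c"] by (simp split: if_splits)

lemma mp_deriv_Const [simp]: "mp_deriv i (Const c) = 0"
  by (simp add: Const_def mp_deriv_single)

lemma mp_deriv_1 [simp]: "mp_deriv i 1 = 0"
  using mp_deriv_Const[of i 1] by simp

lemma mp_deriv_Var_mult:
  "mp_deriv i (Var j * p) = (if i = j then p else 0) + Var j * mp_deriv i p"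
proof -
  have *: "mp_deriv i (Var j * Poly_Mapping.single m c) =
      (if i = j then Poly_Mapping.single m c else 0) + Var j * mp_deriv i (Poly_Mapping.single m c)" for m c
  proof (cases "i = j")
    case True
    \<comment> \<open>If the exponent of variable \<open>i\<close> in \<open>m\<close> is 0, the
      truncated subtraction in \<open>mp_deriv\<close> leaves \<open>m\<close> as it is, but the
      coefficient vanishes; this is why the two cases are separated.\<close>
    show ?thesis
    proof (cases "Poly_Mapping.lookup m i = 0")
      case False
      then have "Poly_Mapping.single i 1 + (m - Poly_Mapping.single i 1) = m"
        using single_diff_add[of m i] by simp
      then show ?thesis
        using True by (simp add: Var_mult_single mp_deriv_single lookup_add distrib_right
            add.commute flip: single_add)
    qed (use True in \<open>simp add: Var_mult_single mp_deriv_single lookup_add\<close>)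
  next
    case False
    show ?thesis
    proof (cases "Poly_Mapping.lookup m i = 0")
      case F: False
      have "Poly_Mapping.single j 1 + m - Poly_Mapping.single i 1
          = Poly_Mapping.single j 1 + (m - Poly_Mapping.single i 1)"
        using F False by (intro poly_mapping_eqI) (auto simp: lookup_add lookup_minus lookup_single when_def)
      then show ?thesis
        using False by (simp add: Var_mult_single mp_deriv_single lookup_add lookup_single when_def)
    qed (use False in \<open>simp add: Var_mult_single mp_deriv_single lookup_add lookup_single when_def\<close>)
  qed
  show ?thesis
    by (subst (1 2 3) mpoly_expand[of p])
       (auto simp: sum_distrib_left mp_deriv_sum * sum.distrib)
qed

lemma mp_deriv_mult:
  "mp_deriv i (p * q) = mp_deriv i p * q + p * mp_deriv i (q :: 'v::finite mpoly)"
proof (induction p rule: mpoly_induct)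
  case (Const c)
  show ?case
  proof (induction q rule: mpoly_induct)
    case (Var i q)
    then show ?case
      by (simp add: mult.left_commute[of "Const c"] mp_deriv_Var_mult distrib_left)
  qed (auto simp: distrib_left mp_deriv_add simp flip: Const_mult)
next
  case (Var j p)
  then show ?case
    by (simp add: mult.assoc mp_deriv_Var_mult) (simp add: algebra_simps)
qed (simp_all add: mp_deriv_add algebra_simps)

lemma mp_deriv_Var: "mp_deriv i (Var j) = (if i = j then 1 else 0)"
  using mp_deriv_Var_mult[of i j 1] by simp

lemma mp_deriv_power:
  "mp_deriv i (p ^ n) = of_nat n * p ^ (n - 1) * mp_deriv i (p :: 'v::finite mpoly)"
proof (induction n)
  case (Suc n)
  then show ?case
    by (cases n) (auto simp: mp_deriv_mult algebra_simps)
qed auto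

lemma homogeneous_mp_deriv:
  assumes "homogeneous n p"
  shows "homogeneous (n - 1) (mp_deriv i p)"
  unfolding mp_deriv_def
proof (rule homogeneous_sum)
  fix m assume m: "m \<in> Poly_Mapping.keys p"
  show "homogeneous (n - 1) (Poly_Mapping.single (m - Poly_Mapping.single i 1)
     (of_nat (Poly_Mapping.lookup m i) * Poly_Mapping.lookup p m))"
  proof (cases "Poly_Mapping.lookup m i = 0")
    case False
    have "n = mdeg m"
      using m assms by (simp add: homogeneous_def)
    also have "m = Poly_Mapping.single i 1 + (m - Poly_Mapping.single i 1)"
      using False by (intro single_diff_add) simp
    finally have "mdeg (m - Poly_Mapping.single i 1) = n - 1"
      by (simp add: mdeg_add)
    then show ?thesis
      by (metis homogeneous_single)
  qed auto
qed

lemma euler_identity: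
  fixes p :: "'v::finite mpoly"
  assumes "homogeneous n p"
  shows "(\<Sum>i\<in>UNIV. Var i * mp_deriv i p) = of_nat n * p"
  using assms
proof (induction rule: homogeneous_induct)
  case (Var j n p)
  have "(\<Sum>i\<in>UNIV. Var i * mp_deriv i (Var j * p))
      = (\<Sum>i\<in>UNIV. (if i = j then Var j * p else 0) + Var j * (Var i * mp_deriv i p))"
    by (intro sum.cong) (auto simp: mp_deriv_Var_mult distrib_left mult.left_commute)
  also have "\<dots> = Var j * p + Var j * (\<Sum>i\<in>UNIV. Var i * mp_deriv i p)"
    by (simp add: sum.distrib sum_distrib_left)
  finally show ?case
    using Var by (simp add: algebra_simps)
qed (auto simp: mp_deriv_add distrib_left sum.distrib)

lemma mp_eval_scale:
  fixes x :: "complex ^ 'v::finite"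
  assumes "homogeneous n p"
  shows "mp_eval id (c *s x) p = c ^ n * mp_eval id x p"
  using assms
  by (induction rule: homogeneous_induct) (auto simp: mp_eval_simps algebra_simps)

section \<open>Homogeneous components\<close>

definition hcomp :: "nat \<Rightarrow> 'v::finite mpoly \<Rightarrow> 'v mpoly" where
  "hcomp n p = (\<Sum>m\<in>{m\<in>Poly_Mapping.keys p. mdeg m = n}. Poly_Mapping.single m (Poly_Mapping.lookup p m))"

lemma lookup_hcomp: "Poly_Mapping.lookup (hcomp n p) m = (if mdeg m = n then Poly_Mapping.lookup p m else 0)"
  by (auto simp: hcomp_def lookup_sum lookup_single when_def in_keys_iff)

lemma homogeneous_hcomp [simp]: "homogeneous n (hcomp n p)"
  by (rule homogeneousI) (auto simp: lookup_hcomp split: if_splits)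

lemma hcomp_add: "hcomp n (p + q) = hcomp n p + hcomp n q"
  by (rule poly_mapping_eqI) (auto simp: lookup_hcomp lookup_add)

lemma hcomp_0 [simp]: "hcomp n 0 = 0"
  by (rule poly_mapping_eqI) (auto simp: lookup_hcomp)

lemma hcomp_diff: "hcomp n (p - q) = hcomp n p - hcomp n q"
  by (rule poly_mapping_eqI) (auto simp: lookup_hcomp lookup_minus)

lemma hcomp_sum: "hcomp n (\<Sum>x\<in>A. f x) = (\<Sum>x\<in>A. hcomp n (f x))"
  by (induction A rule: infinite_finite_induct) (auto simp: hcomp_add)

lemma hcomp_homogeneous: "homogeneous k p \<Longrightarrow> hcomp n p = (if n = k then p else 0)"
  by (rule poly_mapping_eqI) (use homogeneousD in \<open>force simp: lookup_hcomp\<close>)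

lemma obtain_hcomp_bound: obtains N where "\<And>n. n \<ge> N \<Longrightarrow> hcomp n p = 0" and "p = (\<Sum>n<N. hcomp n p)"
proof -
  obtain N where N: "\<And>m. m \<in> Poly_Mapping.keys p \<Longrightarrow> mdeg m < N"
    using finite_nat_bounded[of "mdeg ` Poly_Mapping.keys p"] by auto
  show thesis
  proof (rule that)
    show "hcomp n p = 0" if "n \<ge> N" for n
      by (rule poly_mapping_eqI) (use N that in \<open>force simp: lookup_hcomp in_keys_iff\<close>)
    show "p = (\<Sum>n<N. hcomp n p)"
      by (rule poly_mapping_eqI) (use N in \<open>force simp: lookup_hcomp lookup_sum in_keys_iff\<close>)
  qed
qed

text \<open>Multiplication by a form of degree \<open>k\<close> shifts components by
  \<open>k\<close>. The guard \<open>n \<ge> k\<close> keeps truncated subtraction from selecting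
  component 0 by mistake.\<close>

lemma hcomp_mult:
  assumes "homogeneous k q"
  shows "hcomp n (p * q) = (if n \<ge> k then hcomp (n - k) p * q else 0)"
proof -
  obtain N where N: "\<And>n. n \<ge> N \<Longrightarrow> hcomp n p = 0" "p = (\<Sum>n<N. hcomp n p)"
    by (rule obtain_hcomp_bound[of p]) blast
  have "hcomp n (p * q) = (\<Sum>j<N. hcomp n (hcomp j p * q))"
    by (subst N(2)) (simp add: sum_distrib_right hcomp_sum)
  also have "\<dots> = (\<Sum>j<N. if j + k = n then hcomp j p * q else 0)"
    by (intro sum.cong refl, subst hcomp_homogeneous[OF homogeneous_mult[OF homogeneous_hcomp assms]]) auto
  also have "\<dots> = (\<Sum>j<N. if n \<ge> k \<and> j = n - k then hcomp j p * q else 0)"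
    by (intro sum.cong) auto
  also have "\<dots> = (if n \<ge> k then hcomp (n - k) p * q else 0)"
    using N(1)[of "n - k"] by auto
  finally show ?thesis .
qed

section \<open>Convergent power series\<close>

lemma cps_eqI: "(\<And>m. cps_coeff a m = cps_coeff b m) \<Longrightarrow> a = b"
  by (rule cps_coeff_inject[THEN iffD1]) (rule ext)

lemma cps_coeff_add [simp]: "cps_coeff (a + b) m = cps_coeff a m + cps_coeff b m"
  by (simp add: plus_cps.rep_eq)

lemma cps_coeff_uminus [simp]: "cps_coeff (- a) m = - cps_coeff a m"
  by (simp add: uminus_cps.rep_eq)

lemma cps_coeff_diff [simp]: "cps_coeff (a - b) m = cps_coeff a m - cps_coeff b m"
  by (simp only: minus_cps_def cps_coeff_add cps_coeff_uminus) simp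

lemma cps_coeff_0 [simp]: "cps_coeff 0 m = 0"
  by (simp add: zero_cps.rep_eq)

lemma cps_coeff_const: "cps_coeff (cps_const c) m = (if m = 0 then c else 0)"
  by (simp add: cps_const.rep_eq)

lemma cps_coeff_sum [simp]: "cps_coeff (\<Sum>x\<in>A. f x) m = (\<Sum>x\<in>A. cps_coeff (f x) m)"
  by (induction A rule: infinite_finite_induct) auto

lemma cps_coeff_mult: "cps_coeff (a * b) m = (\<Sum>x\<in>splits m. cps_coeff a (fst x) * cps_coeff b (snd x))"
  by (simp add: times_cps.rep_eq case_prod_unfold)

lemma cps_coeff_mult_0: "cps_coeff (a * b) 0 = cps_coeff a 0 * cps_coeff b 0"
  by (simp add: cps_coeff_mult)

lemma sum_splits_single:
  fixes b :: "('v::finite \<Rightarrow>\<^sub>0 nat) \<Rightarrow> complex"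
  shows "(\<Sum>x\<in>splits (e + m). (if e = fst x then c else 0) * b (snd x)) = c * b m"
    and "(\<nexists>m'. m = e + m') \<Longrightarrow> (\<Sum>x\<in>splits m. (if e = fst x then c else 0) * b (snd x)) = 0"
proof -
  have "(\<Sum>x\<in>splits (e + m). (if e = fst x then c else 0) * b (snd x))
     = (\<Sum>x\<in>{(e, m)}. (if e = fst x then c else 0) * b (snd x))"
    by (rule sum.mono_neutral_right[OF finite_splits]) (auto simp: splits_def)
  then show "(\<Sum>x\<in>splits (e + m). (if e = fst x then c else 0) * b (snd x)) = c * b m"
    by simp
  show "(\<Sum>x\<in>splits m. (if e = fst x then c else 0) * b (snd x)) = 0" if "\<nexists>m'. m = e + m'"
    by (rule sum.neutral) (use that in \<open>auto simp: splits_def\<close>)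
qed

lemma cps_coeff_single_mult:
  "cps_coeff (cps_of_mpoly (Poly_Mapping.single e c) * b) (e + m) = c * cps_coeff b m"
  "(\<nexists>m'. m = e + m') \<Longrightarrow> cps_coeff (cps_of_mpoly (Poly_Mapping.single e c) * b) m = 0"
  using sum_splits_single[where b = "cps_coeff b"]
  by (simp_all add: cps_coeff_mult lookup_single when_def)

lemma cps_of_mpoly_add: "cps_of_mpoly (p + q) = cps_of_mpoly p + cps_of_mpoly q"
  by (rule cps_eqI) (simp add: lookup_add)

lemma cps_of_mpoly_0 [simp]: "cps_of_mpoly 0 = 0"
  by (rule cps_eqI) simp

lemma cps_of_mpoly_sum: "cps_of_mpoly (\<Sum>x\<in>A. f x) = (\<Sum>x\<in>A. cps_of_mpoly (f x))"
  by (induction A rule: infinite_finite_induct) (auto simp: cps_of_mpoly_add)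

lemma cps_of_mpoly_Const [simp]: "cps_of_mpoly (Const c) = cps_const c"
  by (rule cps_eqI) (simp add: Const_def cps_coeff_const lookup_single when_def)

lemma cps_of_mpoly_1 [simp]: "cps_of_mpoly 1 = 1"
  using cps_of_mpoly_Const[of 1] by (simp add: one_cps_def)

lemma cps_of_mpoly_mult: "cps_of_mpoly (p * q) = cps_of_mpoly p * cps_of_mpoly q"
proof -
  have *: "cps_of_mpoly (Poly_Mapping.single m c * Poly_Mapping.single m' c')
    = cps_of_mpoly (Poly_Mapping.single m c) * cps_of_mpoly (Poly_Mapping.single m' c')"
    for m m' :: "'a \<Rightarrow>\<^sub>0 nat" and c c'
  proof (rule cps_eqI)
    fix k
    show "cps_coeff (cps_of_mpoly (Poly_Mapping.single m c * Poly_Mapping.single m' c')) k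
      = cps_coeff (cps_of_mpoly (Poly_Mapping.single m c) * cps_of_mpoly (Poly_Mapping.single m' c')) k"
    proof (cases "\<exists>k'. k = m + k'")
      case True
      then show ?thesis
        by (auto simp: cps_coeff_single_mult mult_single lookup_single when_def)
    next
      case False
      then show ?thesis
        using cps_coeff_single_mult(2)[OF False] by (auto simp: mult_single lookup_single when_def)
    qed
  qed
  let ?f = "\<lambda>p m. Poly_Mapping.single m (Poly_Mapping.lookup p m)"
  have "p * q = (\<Sum>m\<in>Poly_Mapping.keys p. \<Sum>m'\<in>Poly_Mapping.keys q. ?f p m * ?f q m')"
    by (simp only: sum_product[symmetric] mpoly_expand[symmetric])
  then have "cps_of_mpoly (p * q)
      = (\<Sum>m\<in>Poly_Mapping.keys p. cps_of_mpoly (?f p m)) * (\<Sum>m'\<in>Poly_Mapping.keys q. cps_of_mpoly (?f q m'))"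
    by (simp only: cps_of_mpoly_sum sum_product *)
  also have "\<dots> = cps_of_mpoly p * cps_of_mpoly q"
    by (simp only: cps_of_mpoly_sum[symmetric] mpoly_expand[symmetric])
  finally show ?thesis .
qed

lemma ring_morphism_cps_of_mpoly [simp]: "ring_morphism cps_of_mpoly"
  by (simp add: ring_morphism_def cps_of_mpoly_add cps_of_mpoly_mult)

lemma ring_morphism_cps_const [simp]: "ring_morphism cps_const"
  using ring_morphism_comp[OF ring_morphism_cps_of_mpoly ring_morphism_Const] by simp

lemmas cps_of_mpoly_simps = ring_morphism_simps[OF ring_morphism_cps_of_mpoly]
lemmas cps_const_simps = ring_morphism_simps[OF ring_morphism_cps_const]

lemma cps_coeff_const_mult [simp]: "cps_coeff (cps_const c * a) m = c * cps_coeff a m"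
  using cps_coeff_single_mult(1)[of 0 c a m] by (simp flip: cps_of_mpoly_Const add: Const_def)

section \<open>Inverses of convergent power series\<close>

lemma finite_mdeg_le: "finite {e :: 'v::finite \<Rightarrow>\<^sub>0 nat. mdeg e \<le> n}"
proof -
  have "Poly_Mapping.lookup ` {e :: 'v \<Rightarrow>\<^sub>0 nat. mdeg e \<le> n} \<subseteq> (\<Pi>\<^sub>E i\<in>UNIV. {..n})"
  proof (rule image_subsetI, rule PiE_I)
    fix e :: "'v \<Rightarrow>\<^sub>0 nat" and i
    assume "e \<in> {e. mdeg e \<le> n}"
    then have "mdeg e \<le> n" by simp
    moreover have "Poly_Mapping.lookup e i \<le> mdeg e"
      unfolding mdeg_def by (rule member_le_sum) auto
    ultimately show "Poly_Mapping.lookup e i \<in> {..n}" by simp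
  qed simp
  moreover have "finite (\<Pi>\<^sub>E i\<in>(UNIV :: 'v set). {..n})"
    by (intro finite_PiE) auto
  ultimately have "finite (Poly_Mapping.lookup ` {e :: 'v \<Rightarrow>\<^sub>0 nat. mdeg e \<le> n})"
    by (rule finite_subset)
  then show ?thesis
    by (rule finite_imageD) (auto simp: inj_on_def intro: poly_mapping_eqI)
qed

text \<open>The equation \<open>a * b = 1\<close> solved for the coefficients of \<open>b\<close>:
  at exponent \<open>e\<close> the unknown occurs once, with factor \<open>a 0\<close>, and all
  other terms involve \<open>b\<close> at smaller degree because
  \<open>fst x \<noteq> 0\<close>.\<close>

function inverse_coeff :: "(('v::finite \<Rightarrow>\<^sub>0 nat) \<Rightarrow> complex) \<Rightarrow> ('v \<Rightarrow>\<^sub>0 nat) \<Rightarrow> complex" where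
  "inverse_coeff a e = (if e = 0 then 1 / a 0 else
     - (\<Sum>x\<in>{x\<in>splits e. fst x \<noteq> 0}. a (fst x) * inverse_coeff a (snd x)) / a 0)"
  by auto
termination
proof (relation "Wellfounded.measure (\<lambda>(a, e). mdeg e)")
  show "((a, snd x), a, e) \<in> Wellfounded.measure (\<lambda>(a, e). mdeg e)"
    if "x \<in> {x \<in> splits e. fst x \<noteq> 0}" for a :: "('v \<Rightarrow>\<^sub>0 nat) \<Rightarrow> complex" and e x
    using that by (cases x) (auto simp: splits_def mdeg_add mdeg_eq_0_iff[symmetric] simp del: mdeg_eq_0_iff)
qed simp

declare inverse_coeff.simps [simp del]

lemma inverse_coeff_mult:
  assumes "a 0 \<noteq> 0"
  shows "(\<Sum>x\<in>splits m. a (fst x) * inverse_coeff a (snd x)) = (if m = 0 then 1 else 0)"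
proof (cases "m = 0")
  case True
  then show ?thesis
    using assms by (simp add: inverse_coeff.simps[of a 0])
next
  case False
  have eq: "splits m = insert (0, m) {x\<in>splits m. fst x \<noteq> 0}"
    by (auto simp: splits_def)
  have "(\<Sum>x\<in>splits m. a (fst x) * inverse_coeff a (snd x))
     = a 0 * inverse_coeff a m + (\<Sum>x\<in>{x\<in>splits m. fst x \<noteq> 0}. a (fst x) * inverse_coeff a (snd x))"
    by (subst eq, subst sum.insert) (auto simp del: splits_0)
  also have "\<dots> = 0"
    using False assms by (subst inverse_coeff.simps) simp
  finally show ?thesis
    using False by simp
qed

text \<open>
  If \<open>\<Sum>\<^bsub>s\<noteq>0\<^esub> |a s| q^|s| \<le> |a 0| / 2\<close>, then the recursion bounds the partial sums of the inverse
  series at \<open>q\<close> by \<open>2 / |a 0|\<close>.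
\<close>

lemma convergent_inverse_coeff:
  fixes a :: "('v::finite \<Rightarrow>\<^sub>0 nat) \<Rightarrow> complex"
  assumes "convergent_coeffs a" and a0: "a 0 \<noteq> 0"
  shows "convergent_coeffs (inverse_coeff a)"
proof -
  obtain r where r: "r > 0" "(\<lambda>m. norm (a m) * r ^ mdeg m) summable_on UNIV"
    using assms by (auto simp: convergent_coeffs_def)
  define A where "A = (\<Sum>\<^sub>\<infinity>m. norm (a m) * r ^ mdeg m)"
  have A: "(\<Sum>m\<in>X. norm (a m) * r ^ mdeg m) \<le> A" if "finite X" for X
    unfolding A_def using r that by (intro finite_sum_le_infsum) auto
  have A0: "A \<ge> 0"
    using A[of "{}"] by simp
  define c where "c = norm (a 0)"
  have c: "c > 0" using a0 by (simp add: c_def)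
  \<comment> \<open>Shrinking the radius by \<open>\<theta> \<le> 1\<close> multiplies every term of
    positive degree by at most \<open>\<theta>\<close>, which brings the tail from \<open>A\<close>
    down to \<open>c / 2\<close>. Adding 1 to \<open>A\<close> avoids a zero denominator.\<close>
  define \<theta> where "\<theta> = min 1 (c / (2 * (A + 1)))"
  have \<theta>: "0 < \<theta>" "\<theta> \<le> 1"
    using c A0 by (auto simp: \<theta>_def)
  have \<theta>A: "\<theta> * A \<le> c / 2"
  proof -
    have "\<theta> * A \<le> c / (2 * (A + 1)) * A"
      using A0 by (intro mult_right_mono) (auto simp: \<theta>_def)
    also have "\<dots> \<le> c / 2"
      using A0 c by (simp add: field_simps)
    finally show ?thesis .
  qed
  define q where "q = \<theta> * r"
  have q: "q > 0" using \<theta> r by (simp add: q_def)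
  have tail: "(\<Sum>s\<in>X. norm (a s) * q ^ mdeg s) \<le> c / 2" if X: "finite X" "0 \<notin> X" for X
  proof -
    have "(\<Sum>s\<in>X. norm (a s) * q ^ mdeg s) \<le> (\<Sum>s\<in>X. \<theta> * (norm (a s) * r ^ mdeg s))"
    proof (rule sum_mono)
      fix s assume "s \<in> X"
      then obtain n where n: "mdeg s = Suc n"
        using X(2) by (metis mdeg_eq_0_iff not0_implies_Suc)
      have "\<theta> ^ mdeg s \<le> \<theta>"
        using \<theta> by (simp add: n mult_left_le power_le_one)
      then have "norm (a s) * r ^ mdeg s * \<theta> ^ mdeg s \<le> norm (a s) * r ^ mdeg s * \<theta>"
        using r by (intro mult_left_mono) auto
      then show "norm (a s) * q ^ mdeg s \<le> \<theta> * (norm (a s) * r ^ mdeg s)"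
        by (simp add: q_def power_mult_distrib mult_ac)
    qed
    also have "\<dots> \<le> \<theta> * A"
      using A[OF X(1)] \<theta> by (simp flip: sum_distrib_left)
    finally show ?thesis using \<theta>A by simp
  qed
  define b where "b = inverse_coeff a"
  define B where "B n = (\<Sum>e | mdeg e \<le> n. norm (b e) * q ^ mdeg e)" for n
  have b0: "norm (b 0) = 1 / c"
    by (simp add: b_def inverse_coeff.simps c_def norm_divide)
  \<comment> \<open>The recursion yields \<open>B (Suc n) \<le> 1 / c + B n / 2\<close>, and
    \<open>2 / c\<close> is the fixed point of this bound.\<close>
  have B: "B n \<le> 2 / c" for n
  proof (induction n)
    case 0
    have "{e :: 'v \<Rightarrow>\<^sub>0 nat. mdeg e \<le> 0} = {0}" by auto
    then show ?case using b0 c by (simp add: B_def divide_right_mono)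
  next
    case (Suc n)
    let ?Y = "{e :: 'v \<Rightarrow>\<^sub>0 nat. mdeg e \<le> Suc n} - {0}"
    let ?Z = "{e :: 'v \<Rightarrow>\<^sub>0 nat. mdeg e \<le> n}"
    let ?S = "\<lambda>e :: 'v \<Rightarrow>\<^sub>0 nat. {x\<in>splits e. fst x \<noteq> 0}"
    let ?g = "\<lambda>x. (norm (a (fst x)) * q ^ mdeg (fst x)) * (norm (b (snd x)) * q ^ mdeg (snd x))"
    have fin: "finite {e :: 'v \<Rightarrow>\<^sub>0 nat. mdeg e \<le> k}" for k
      by (rule finite_mdeg_le)
    have le: "norm (b e) * q ^ mdeg e \<le> (1 / c) * (\<Sum>x\<in>?S e. ?g x)" if "e \<in> ?Y" for e
    proof -
      have "norm (b e) = norm (\<Sum>x\<in>?S e. a (fst x) * b (snd x)) / c"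
        using that by (simp add: b_def inverse_coeff.simps[of a e] norm_divide c_def)
      also have "\<dots> \<le> (\<Sum>x\<in>?S e. norm (a (fst x)) * norm (b (snd x))) / c"
        using c by (intro divide_right_mono order.trans[OF norm_sum]) (auto simp: norm_mult)
      finally have "norm (b e) * q ^ mdeg e \<le> (\<Sum>x\<in>?S e. norm (a (fst x)) * norm (b (snd x))) / c * q ^ mdeg e"
        using q by (intro mult_right_mono) auto
      also have "\<dots> = (1 / c) * (\<Sum>x\<in>?S e. norm (a (fst x)) * norm (b (snd x)) * q ^ mdeg e)"
        by (simp add: sum_distrib_right sum_divide_distrib)
      also have "(\<Sum>x\<in>?S e. norm (a (fst x)) * norm (b (snd x)) * q ^ mdeg e) = (\<Sum>x\<in>?S e. ?g x)"
        by (intro sum.cong) (auto simp: splits_def mdeg_add power_add)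
      finally show ?thesis .
    qed
    have "{e :: 'v \<Rightarrow>\<^sub>0 nat. mdeg e \<le> Suc n} = insert 0 ?Y" by auto
    then have "B (Suc n) = norm (b 0) + (\<Sum>e\<in>?Y. norm (b e) * q ^ mdeg e)"
      unfolding B_def using fin by (subst \<open>_ = insert 0 ?Y\<close>) (subst sum.insert, auto)
    also have "\<dots> \<le> 1 / c + (\<Sum>e\<in>?Y. (1 / c) * (\<Sum>x\<in>?S e. ?g x))"
      using le by (intro add_mono sum_mono) (auto simp: b0)
    also have "\<dots> = 1 / c + (1 / c) * (\<Sum>e\<in>?Y. \<Sum>x\<in>?S e. ?g x)"
      by (simp only: sum_distrib_left)
    also have "(\<Sum>e\<in>?Y. \<Sum>x\<in>?S e. ?g x) = (\<Sum>x\<in>(\<Union>e\<in>?Y. ?S e). ?g x)"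
      using fin by (intro sum.UNION_disjoint[symmetric]) (auto simp: splits_def intro: finite_subset[OF _ finite_splits])
    \<comment> \<open>A nonzero first part leaves degree at most \<open>n\<close> for the second.
      All terms are nonnegative, so the index set may grow to a product, where the sum
      factors.\<close>
    also have "\<dots> \<le> (\<Sum>x\<in>?Y \<times> ?Z. ?g x)"
    proof (rule sum_mono2)
      show "(\<Union>e\<in>?Y. ?S e) \<subseteq> ?Y \<times> ?Z"
      proof (rule subsetI, elim UN_E)
        fix x and e :: "'v \<Rightarrow>\<^sub>0 nat"
        assume "e \<in> ?Y" "x \<in> ?S e"
        then have *: "mdeg (fst x) + mdeg (snd x) \<le> Suc n" "fst x \<noteq> 0"
          by (auto simp: splits_def mdeg_add)
        then have "mdeg (fst x) \<noteq> 0"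
          by simp
        with * have "mdeg (fst x) \<le> Suc n" "mdeg (snd x) \<le> n" by linarith+
        with * show "x \<in> ?Y \<times> ?Z" by (cases x) auto
      qed
    qed (use fin q in auto)
    also have "\<dots> = (\<Sum>s\<in>?Y. norm (a s) * q ^ mdeg s) * B n"
      by (simp add: B_def sum_product sum.cartesian_product case_prod_unfold)
    also have "\<dots> \<le> c / 2 * (2 / c)"
      using Suc tail[of ?Y] fin c q by (intro mult_mono) (auto simp: B_def intro!: sum_nonneg)
    finally show ?case
      using c by (simp add: field_simps)
  qed
  have "(\<lambda>m. norm (b m) * q ^ mdeg m) summable_on UNIV"
  proof (rule nonneg_bdd_above_summable_on)
    show "bdd_above (sum (\<lambda>m. norm (b m) * q ^ mdeg m) ` {F. F \<subseteq> UNIV \<and> finite F})"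
    proof (rule bdd_aboveI2)
      fix F :: "('v \<Rightarrow>\<^sub>0 nat) set" assume "F \<in> {F. F \<subseteq> UNIV \<and> finite F}"
      then have F: "finite F" by simp
      then obtain n where "\<forall>x\<in>mdeg ` F. x \<le> n"
        using finite_nat_set_iff_bounded_le[of "mdeg ` F"] by auto
      then have "sum (\<lambda>m. norm (b m) * q ^ mdeg m) F \<le> B n"
        unfolding B_def using q by (intro sum_mono2 finite_mdeg_le) auto
      then show "sum (\<lambda>m. norm (b m) * q ^ mdeg m) F \<le> 2 / c"
        using B[of n] by simp
    qed
  qed (use q in auto)
  then show ?thesis
    using q unfolding convergent_coeffs_def b_def by blast
qed

text \<open>The ring is local with residue field \<complex>. A form that does not vanish at a point
  thereby becomes a unit in the chart and can be cancelled from memberships in the Tjurina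
  ideal.\<close>

lemma cps_unit:
  assumes "cps_coeff a 0 \<noteq> 0"
  obtains b where "a * b = 1"
proof
  let ?b = "Abs_cps (inverse_coeff (cps_coeff a))"
  have "cps_coeff ?b = inverse_coeff (cps_coeff a)"
    using assms cps_coeff[of a] by (intro Abs_cps_inverse) (auto intro: convergent_inverse_coeff)
  then show "a * ?b = 1"
    using inverse_coeff_mult[of "cps_coeff a"] assms
    by (intro cps_eqI) (simp add: cps_coeff_mult one_cps_def cps_coeff_const)
qed

lemma Var_power: "Var j ^ n = Poly_Mapping.single (Poly_Mapping.single j n) 1"
  by (induction n) (auto simp: Var_mult_single simp flip: single_add)

lemma finite_box: "finite {m :: 'v::finite \<Rightarrow>\<^sub>0 nat. \<forall>j. Poly_Mapping.lookup m j < N}"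
proof (rule finite_subset[OF _ finite_mdeg_le])
  show "{m :: 'v \<Rightarrow>\<^sub>0 nat. \<forall>j. Poly_Mapping.lookup m j < N} \<subseteq> {e. mdeg e \<le> (\<Sum>j\<in>(UNIV :: 'v set). N)}"
    unfolding mdeg_def by (intro subsetI CollectI sum_mono) (auto simp: less_imp_le)
qed

lemma exponent_split:
  assumes "Poly_Mapping.lookup m j \<ge> N"
  shows "\<exists>m'. m = Poly_Mapping.single j N + (m' :: 'v \<Rightarrow>\<^sub>0 nat)"
  using assms
  by (intro exI[of _ "m - Poly_Mapping.single j N"] poly_mapping_eqI)
     (auto simp: lookup_add lookup_minus lookup_single when_def)

text \<open>Division with remainder by the monomial ideal of the \<open>Var j ^ N\<close>: a
  monomial outside the box is divisible by one of these powers. It bounds the local algebras and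
  turns power series coefficients into polynomials.\<close>

lemma cps_truncate:
  fixes c :: "'v::finite cps"
  obtains t :: "'v mpoly" and r
  where "Poly_Mapping.keys t \<subseteq> {m. \<forall>j. Poly_Mapping.lookup m j < N}"
    and "c = cps_of_mpoly t + (\<Sum>j\<in>UNIV. cps_of_mpoly (Var j ^ N) * r j)"
proof -
  let ?Box = "{m :: 'v \<Rightarrow>\<^sub>0 nat. \<forall>j. Poly_Mapping.lookup m j < N}"
  define t where "t = (\<Sum>m\<in>?Box. Poly_Mapping.single m (cps_coeff c m))"
  have t: "Poly_Mapping.lookup t m = (if m \<in> ?Box then cps_coeff c m else 0)" for m
    unfolding t_def lookup_sum lookup_single when_def
    by (subst sum.delta) (use finite_box[of N] in auto)
  \<comment> \<open>Several variables may have exponent at least \<open>N\<close>; \<open>ch\<close>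
    picks one, so that each monomial outside the box goes into exactly one quotient
    \<open>r j\<close>.\<close>
  define ch where "ch m = (SOME j. Poly_Mapping.lookup m j \<ge> N)" for m :: "'v \<Rightarrow>\<^sub>0 nat"
  define rc where "rc j m = (if ch (Poly_Mapping.single j N + m) = j
    then cps_coeff c (Poly_Mapping.single j N + m) else 0)" for j m
  have conv: "convergent_coeffs (rc j)" for j
  proof -
    obtain r where r: "r > 0" "(\<lambda>m. norm (cps_coeff c m) * r ^ mdeg m) summable_on UNIV"
      using cps_coeff[of c] by (auto simp: convergent_coeffs_def)
    have "(\<lambda>m. norm (cps_coeff c m) * r ^ mdeg m) summable_on range (\<lambda>m. Poly_Mapping.single j N + m)"
      using r(2) by (rule summable_on_subset_banach) auto
    then have "(\<lambda>m. norm (cps_coeff c (Poly_Mapping.single j N + m)) * r ^ mdeg (Poly_Mapping.single j N + m))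
        summable_on UNIV"
      by (subst (asm) summable_on_reindex) (auto simp: inj_def o_def)
    then have "(\<lambda>m. inverse (r ^ N) * (norm (cps_coeff c (Poly_Mapping.single j N + m))
        * r ^ mdeg (Poly_Mapping.single j N + m))) summable_on UNIV"
      by (rule summable_on_cmult_right)
    then have "(\<lambda>m. norm (rc j m) * r ^ mdeg m) summable_on UNIV"
      by (rule summable_on_comparison_test)
         (use r in \<open>auto simp: rc_def mdeg_add power_add field_simps\<close>)
    then show ?thesis
      using r unfolding convergent_coeffs_def by blast
  qed
  define r where "r j = Abs_cps (rc j)" for j
  have r: "cps_coeff (r j) = rc j" for j
    unfolding r_def by (rule Abs_cps_inverse) (use conv in auto)
  have coef: "cps_coeff (cps_of_mpoly (Var j ^ N) * r j) m
      = (if m \<notin> ?Box \<and> j = ch m then cps_coeff c m else 0)" for j m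
  proof (cases "\<exists>m'. m = Poly_Mapping.single j N + m'")
    case True
    then obtain m' where m': "m = Poly_Mapping.single j N + m'" by blast
    then have "Poly_Mapping.lookup m j \<ge> N"
      by (simp add: lookup_add)
    then have "m \<notin> ?Box" by (auto simp: not_less)
    then show ?thesis
      by (auto simp: m' Var_power cps_coeff_single_mult r rc_def)
  next
    case False
    then have "\<not> Poly_Mapping.lookup m j \<ge> N"
      using False exponent_split[of N m j] by fast
    moreover have "Poly_Mapping.lookup m (ch m) \<ge> N" if "m \<notin> ?Box"
      unfolding ch_def using that by (intro someI_ex[of "\<lambda>j. Poly_Mapping.lookup m j \<ge> N"]) (auto simp: not_less)
    ultimately show ?thesis
      using cps_coeff_single_mult(2)[OF False] by (auto simp: Var_power)
  qed
  show thesis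
  proof (rule that[of t r])
    show "Poly_Mapping.keys t \<subseteq> ?Box"
      using t by (auto simp: in_keys_iff split: if_splits)
    show "c = cps_of_mpoly t + (\<Sum>j\<in>UNIV. cps_of_mpoly (Var j ^ N) * r j)"
      by (rule cps_eqI) (auto simp: t coef)
  qed
qed

section \<open>Bases of quotients\<close>

text \<open>Gaussian elimination: an equation \<open>e\<close> with nonzero coefficient at some
  unknown \<open>s\<close> removes \<open>s\<close> from the other equations, and the induction
  hypothesis solves those in one unknown fewer.\<close>

lemma underdetermined_system:
  fixes c :: "'e \<Rightarrow> 't \<Rightarrow> complex"
  assumes "finite E" "finite T" "card T > card E"
  obtains x where "\<exists>t\<in>T. x t \<noteq> 0" and "\<And>e. e \<in> E \<Longrightarrow> (\<Sum>t\<in>T. x t * c e t) = 0"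
proof -
  have "\<exists>x. (\<exists>t\<in>T. x t \<noteq> 0) \<and> (\<forall>e\<in>E. (\<Sum>t\<in>T. x t * c e t) = 0)"
    using assms
  proof (induction E arbitrary: T c rule: finite_induct)
    case empty
    then show ?case
      by (intro exI[of _ "\<lambda>_. 1"]) (auto simp: card_gt_0_iff)
  next
    case (insert e E)
    show ?case
    proof (cases "\<forall>t\<in>T. c e t = 0")
      case True
      obtain x where "\<exists>t\<in>T. x t \<noteq> 0" "\<forall>e\<in>E. (\<Sum>t\<in>T. x t * c e t) = 0"
        using insert.IH[of T c] insert.prems insert.hyps by auto
      then show ?thesis
        using True by (intro exI[of _ x]) auto
    next
      case False
      then obtain s where s: "s \<in> T" "c e s \<noteq> 0" by blast
      let ?T = "T - {s}"
      have "card ?T > card E"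
        using insert s by auto
      then obtain x where x: "\<exists>t\<in>?T. x t \<noteq> 0"
          "\<forall>e'\<in>E. (\<Sum>t\<in>?T. x t * (c e' t - c e t / c e s * c e' s)) = 0"
        using insert.IH[of ?T "\<lambda>e' t. c e' t - c e t / c e s * c e' s"] insert.prems by auto
      \<comment> \<open>Back substitution: the value at the pivot \<open>s\<close> is the one that
        satisfies equation \<open>e\<close>.\<close>
      define y where "y = x(s := - (\<Sum>t\<in>?T. x t * c e t) / c e s)"
      have y: "(\<Sum>t\<in>T. y t * c e' t) = y s * c e' s + (\<Sum>t\<in>?T. x t * c e' t)" for e'
        using s insert.prems by (simp add: sum.remove[OF _ s(1)] y_def)
      have "(\<Sum>t\<in>T. y t * c e' t) = 0" if "e' \<in> insert e E" for e'
      proof (cases "e' = e")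
        case True
        then show ?thesis using s by (simp add: y) (simp add: y_def)
      next
        case False
        then have "0 = (\<Sum>t\<in>?T. x t * (c e' t - c e t / c e s * c e' s))"
          using x(2) that by auto
        also have "\<dots> = (\<Sum>t\<in>?T. x t * c e' t - x t * c e t * (c e' s / c e s))"
          by (simp add: right_diff_distrib mult.assoc)
        also have "\<dots> = (\<Sum>t\<in>?T. x t * c e' t) - (\<Sum>t\<in>?T. x t * c e t) * (c e' s / c e s)"
          by (simp only: sum_subtractf sum_distrib_right)
        finally show ?thesis
          by (simp add: y) (simp add: y_def)
      qed
      moreover have "\<exists>t\<in>T. y t \<noteq> 0"
        using x(1) by (auto simp: y_def)
      ultimately show ?thesis by blast
    qed
  qed
  then show thesis using that by blast
qed

definition cps_subspace :: "'v::finite cps set \<Rightarrow> bool" where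
  "cps_subspace I \<longleftrightarrow> 0 \<in> I \<and> (\<forall>a\<in>I. \<forall>b\<in>I. a + b \<in> I) \<and> (\<forall>c. \<forall>a\<in>I. cps_const c * a \<in> I)"

text \<open>A finite generating family is thinned out: a relation with nonzero coefficient at
  \<open>s\<close> makes \<open>s\<close> dispensable. Existence of a basis is what rules out the
  default value of \<open>quotient_dim\<close>.\<close>

lemma basis_mod_exists:
  fixes I :: "'v::finite cps set"
  assumes I: "cps_subspace I" and "finite G"
    and "\<And>h. \<exists>c. h - (\<Sum>b\<in>G. cps_const (c b) * b) \<in> I"
  obtains B where "basis_mod I B"
proof -
  have "\<exists>B. basis_mod I B"
    using assms(2,3)
  proof (induction "card G" arbitrary: G rule: less_induct)
    case less
    show ?case
    proof (cases "\<forall>c. (\<Sum>b\<in>G. cps_const (c b) * b) \<in> I \<longrightarrow> (\<forall>b\<in>G. c b = 0)")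
      case True
      then have "basis_mod I G"
        using less.prems unfolding basis_mod_def by blast
      then show ?thesis by blast
    next
      case False
      then obtain c s where c: "(\<Sum>b\<in>G. cps_const (c b) * b) \<in> I" and s: "s \<in> G" "c s \<noteq> 0" by blast
      have "\<exists>d'. h - (\<Sum>b\<in>G-{s}. cps_const (d' b) * b) \<in> I" for h
      proof -
        obtain d where d: "h - (\<Sum>b\<in>G. cps_const (d b) * b) \<in> I"
          using less.prems by blast
        let ?d = "\<lambda>b. d b - d s / c s * c b"
        have "(h - (\<Sum>b\<in>G. cps_const (d b) * b)) + cps_const (d s / c s) * (\<Sum>b\<in>G. cps_const (c b) * b) \<in> I"
          using I c d unfolding cps_subspace_def by blast
        also have "(h - (\<Sum>b\<in>G. cps_const (d b) * b)) + cps_const (d s / c s) * (\<Sum>b\<in>G. cps_const (c b) * b)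
            = h - (\<Sum>b\<in>G. cps_const (?d b) * b)"
          by (simp only: cps_const_simps sum_subtractf left_diff_distrib sum_distrib_left mult.assoc) simp
        also have "(\<Sum>b\<in>G. cps_const (?d b) * b) = (\<Sum>b\<in>G-{s}. cps_const (?d b) * b)"
          using s less.prems(1) by (subst sum.remove[of _ s]) (auto simp: cps_const_simps)
        finally show ?thesis
          by (intro exI[of _ ?d])
      qed
      moreover have "card (G - {s}) < card G"
        using s less.prems(1) by (intro psubset_card_mono) auto
      ultimately show ?thesis
        using less.hyps[of "G - {s}"] less.prems(1) by blast
    qed
  qed
  then show thesis using that by blast
qed

section \<open>Ideals\<close>

definition is_ideal :: "'a::comm_ring_1 set \<Rightarrow> bool" where
  "is_ideal I \<longleftrightarrow> 0 \<in> I \<and> (\<forall>a\<in>I. \<forall>b\<in>I. a + b \<in> I) \<and> (\<forall>r. \<forall>a\<in>I. r * a \<in> I)"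

lemma is_ideal_0: "is_ideal I \<Longrightarrow> 0 \<in> I"
  and is_ideal_add: "is_ideal I \<Longrightarrow> a \<in> I \<Longrightarrow> b \<in> I \<Longrightarrow> a + b \<in> I"
  and is_ideal_mult: "is_ideal I \<Longrightarrow> a \<in> I \<Longrightarrow> r * a \<in> I"
  by (auto simp: is_ideal_def)

lemma is_ideal_mult_right: "is_ideal I \<Longrightarrow> a \<in> I \<Longrightarrow> a * r \<in> I"
  using is_ideal_mult[of I a r] by (simp add: mult.commute)

lemma is_ideal_uminus: "is_ideal I \<Longrightarrow> a \<in> I \<Longrightarrow> - a \<in> I"
  using is_ideal_mult[of I a "- 1"] by simp

lemma is_ideal_diff: "is_ideal I \<Longrightarrow> a \<in> I \<Longrightarrow> b \<in> I \<Longrightarrow> a - b \<in> I"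
  using is_ideal_add[of I a "- b"] is_ideal_uminus[of I b] by simp

lemma is_ideal_sum: "is_ideal I \<Longrightarrow> (\<And>x. x \<in> A \<Longrightarrow> f x \<in> I) \<Longrightarrow> (\<Sum>x\<in>A. f x) \<in> I"
  by (induction A rule: infinite_finite_induct) (auto simp: is_ideal_0 is_ideal_add)

lemma is_ideal_adjoin:
  assumes "is_ideal I"
  shows "is_ideal {a + r * y | a r. a \<in> I}" (is "is_ideal ?K")
  unfolding is_ideal_def
proof (intro conjI ballI allI)
  show "0 \<in> ?K"
    using is_ideal_0[OF assms] by (auto intro!: exI[of _ 0])
next
  fix u v assume "u \<in> ?K" "v \<in> ?K"
  then obtain a r b s where "u = a + r * y" "v = b + s * y" "a \<in> I" "b \<in> I" by blast
  then have "u + v = (a + b) + (r + s) * y" "a + b \<in> I"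
    using is_ideal_add[OF assms] by (auto simp: algebra_simps)
  then show "u + v \<in> ?K" by blast
next
  fix t u assume "u \<in> ?K"
  then obtain a r where "u = a + r * y" "a \<in> I" by blast
  then have "t * u = t * a + (t * r) * y" "t * a \<in> I"
    using is_ideal_mult[OF assms] by (auto simp: algebra_simps)
  then show "t * u \<in> ?K" by blast
qed

lemma is_ideal_multiples: "is_ideal (range (\<lambda>r. r * y))"
  unfolding is_ideal_def
  by (auto simp flip: distrib_right mult.assoc intro: range_eqI[of _ _ 0])

text \<open>In each term of the expansion with exponent \<open>2 * N\<close>, one of
  \<open>a\<close>, \<open>b\<close> has exponent at least \<open>N\<close>. The statement is
  nilpotency of a sum modulo the colon ideal of \<open>I\<close> by \<open>s\<close>.\<close>

lemma is_ideal_binomial: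
  assumes "is_ideal I" "s * a ^ N \<in> I" "s * b ^ N \<in> I"
  shows "s * (a + b) ^ (2 * N) \<in> I"
proof -
  have "s * (of_nat (2 * N choose k) * a ^ k * b ^ (2 * N - k)) \<in> I" for k
  proof (cases "k \<ge> N")
    case True
    then have "a ^ k = a ^ (k - N) * a ^ N"
      by (simp flip: power_add)
    then have eq: "s * (of_nat (2 * N choose k) * a ^ k * b ^ (2 * N - k))
      = (of_nat (2 * N choose k) * a ^ (k - N) * b ^ (2 * N - k)) * (s * a ^ N)"
      by (simp add: mult_ac)
    show ?thesis unfolding eq by (rule is_ideal_mult[OF assms(1,2)])
  next
    case False
    then have "2 * N - k = (N - k) + N" by simp
    then have "b ^ (2 * N - k) = b ^ (N - k) * b ^ N"
      by (simp only: power_add)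
    then have eq: "s * (of_nat (2 * N choose k) * a ^ k * b ^ (2 * N - k))
      = (of_nat (2 * N choose k) * a ^ k * b ^ (N - k)) * (s * b ^ N)"
      by (simp add: mult_ac)
    show ?thesis unfolding eq by (rule is_ideal_mult[OF assms(1,3)])
  qed
  then show ?thesis
    unfolding binomial_ring sum_distrib_left by (intro is_ideal_sum assms(1))
qed

text \<open>Congruence modulo an ideal respects sums and products, so the variables decide. It
  serves for evaluation at a point and for the round trip to an affine chart, modulo
  \<open>Var i0 - 1\<close>.\<close>

lemma substitution_congruent:
  fixes \<psi> :: "'v::finite mpoly \<Rightarrow> 'v mpoly"
  assumes "is_ideal I" "ring_morphism \<psi>" "\<And>c. \<psi> (Const c) = Const c" "\<And>i. \<psi> (Var i) - Var i \<in> I"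
  shows "\<psi> h - h \<in> I"
proof (induction h rule: mpoly_induct)
  case (Const c)
  then show ?case using assms is_ideal_0 by auto
next
  case (Var i p)
  have "\<psi> (Var i * p) - Var i * p = \<psi> p * (\<psi> (Var i) - Var i) + Var i * (\<psi> p - p)"
    by (simp add: ring_morphism_mult[OF assms(2)] algebra_simps)
  also have "\<dots> \<in> I"
    using assms Var by (intro is_ideal_add is_ideal_mult)
  finally show ?case .
next
  case (add p q)
  have eq: "\<psi> (p + q) - (p + q) = (\<psi> p - p) + (\<psi> q - q)"
    by (simp add: ring_morphism_add[OF assms(2)])
  show ?case unfolding eq by (rule is_ideal_add[OF assms(1) add])
qed

lemma evaluation_congruent:
  fixes w :: "complex ^ 'v::finite"
  assumes "is_ideal I" "\<And>i. Var i - Const (w $ i) \<in> I"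
  shows "g - Const (mp_eval id w g) \<in> I"
proof -
  have "Const (mp_eval id w (Var i)) - Var i \<in> I" for i
    using is_ideal_uminus[OF assms(1) assms(2)[of i]] mp_eval_Var[OF ring_morphism_id, of w i] by simp
  moreover have "ring_morphism (\<lambda>h. Const (mp_eval id w h) :: 'v mpoly)"
    using ring_morphism_comp[OF ring_morphism_Const ring_morphism_mp_eval[OF ring_morphism_id, of w]] .
  moreover have "Const (mp_eval id w (Const c)) = (Const c :: 'v mpoly)" for c
    using mp_eval_Const[OF ring_morphism_id, of w c] by simp
  ultimately have "Const (mp_eval id w g) - g \<in> I"
    by (rule substitution_congruent[OF assms(1), where \<psi> = "\<lambda>h. Const (mp_eval id w h)", rotated 2])
  from is_ideal_uminus[OF assms(1) this] show ?thesis by simp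
qed

text \<open>The coordinates of the zero are chosen one by one, keeping the ideal proper. If no value
  \<open>b\<close> were possible for \<open>Var i\<close>, every \<open>Var i - Const b\<close>
  would be invertible modulo the current ideal, and so would the split monic polynomial in
  \<open>Var i\<close> that lies in it.\<close>

lemma nullstellensatz_monic:
  fixes I :: "'v::finite mpoly set"
  assumes "is_ideal I" "1 \<notin> I" and monic: "\<And>i. \<exists>bs. (\<Prod>b\<leftarrow>bs. Var i - Const b) \<in> I"
  obtains w where "\<And>g. g \<in> I \<Longrightarrow> mp_eval id w g = 0"
proof -
  have "\<exists>I' w. is_ideal I' \<and> I \<subseteq> I' \<and> 1 \<notin> I' \<and> (\<forall>i\<in>A. Var i - Const (w i) \<in> I')" if "finite A" for A :: "'v set"
    using that
  proof (induction A)
    case empty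
    then show ?case using assms by blast
  next
    case (insert i A)
    then obtain I' w where I': "is_ideal I'" "I \<subseteq> I'" "1 \<notin> I'" "\<forall>i\<in>A. Var i - Const (w i) \<in> I'" by blast
    have "\<exists>b. 1 \<notin> {a + r * (Var i - Const b) | a r. a \<in> I'}"
    proof (rule ccontr)
      assume "\<nexists>b. 1 \<notin> {a + r * (Var i - Const b) | a r. a \<in> I'}"
      then have ex: "\<exists>a\<in>I'. \<exists>r. 1 = a + r * (Var i - Const b)" for b by blast
      have "x \<in> I'" if "(\<Prod>b\<leftarrow>bs. Var i - Const b) * x \<in> I'" for bs x
        using that
      proof (induction bs)
        case (Cons b bs)
        obtain a r where ar: "a \<in> I'" "1 = a + r * (Var i - Const b)"
          using ex by blast
        let ?z = "(\<Prod>b\<leftarrow>bs. Var i - Const b) * x"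
        have "?z = (a + r * (Var i - Const b)) * ?z"
          by (simp flip: ar(2))
        also have "\<dots> = ?z * a + r * ((\<Prod>b\<leftarrow>b # bs. Var i - Const b) * x)"
          by (simp add: algebra_simps)
        also have "\<dots> \<in> I'"
          using is_ideal_mult[OF I'(1) ar(1)] is_ideal_mult[OF I'(1) Cons.prems] by (rule is_ideal_add[OF I'(1)])
        finally show ?case by (rule Cons.IH)
      qed simp
      moreover obtain bs where "(\<Prod>b\<leftarrow>bs. Var i - Const b) * 1 \<in> I'"
        using monic[of i] I'(2) by auto
      ultimately show False using I'(3) by blast
    qed
    then obtain b where b: "1 \<notin> {a + r * (Var i - Const b) | a r. a \<in> I'}" (is "1 \<notin> ?K") by blast
    have "I' \<subseteq> ?K" by (force intro: exI[of _ 0])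
    moreover have "Var i - Const b \<in> ?K"
      using is_ideal_0[OF I'(1)] by (force intro: exI[of _ 0] exI[of _ 1])
    moreover have "is_ideal ?K" by (rule is_ideal_adjoin[OF I'(1)])
    ultimately have "is_ideal ?K \<and> I \<subseteq> ?K \<and> 1 \<notin> ?K \<and> (\<forall>j\<in>insert i A. Var j - Const ((w(i := b)) j) \<in> ?K)"
      using I' b by auto
    then show ?case by blast
  qed
  from this[of UNIV] obtain I' w where I': "is_ideal I'" "I \<subseteq> I'" "1 \<notin> I'" "\<And>i. Var i - Const (w i) \<in> I'"
    by auto
  show thesis
  proof (rule that[of "\<chi> i. w i"])
    fix g assume "g \<in> I"
    let ?c = "mp_eval id (\<chi> i. w i) g"
    have "g - Const ?c \<in> I'"
      by (rule evaluation_congruent) (use I' in auto)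
    then have "Const ?c \<in> I'"
      using is_ideal_diff[OF I'(1), of g "g - Const ?c"] \<open>g \<in> I\<close> I'(2) by auto
    then have "Const (inverse ?c) * Const ?c \<in> I'"
      by (rule is_ideal_mult[OF I'(1)])
    then show "?c = 0"
      using I'(3) by (metis Const_1 Const_mult left_inverse)
  qed
qed

text \<open>
  Comparing homogeneous components of \<open>h - (l - 1) b\<close>: those of \<open>b\<close> below degree \<open>n\<close> lie in \<open>J\<close>, and the
  one of degree \<open>n + M\<close> is congruent to \<open>- l ^ M h\<close>; it vanishes for large \<open>M\<close>.
\<close>

lemma homogenize_membership:
  fixes J :: "'v::finite mpoly set"
  assumes J: "is_ideal J" "\<And>a k. a \<in> J \<Longrightarrow> hcomp k a \<in> J"
    and l: "homogeneous 1 l" and h: "homogeneous n h" and mem: "h - b * (l - 1) \<in> J"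
  obtains M where "l ^ M * h \<in> J"
proof -
  define c where "c k = hcomp k b" for k
  have step: "(if Suc k = n then h else 0) - c k * l + c (Suc k) \<in> J" for k
  proof -
    have "hcomp (Suc k) (h - b * (l - 1)) = (if Suc k = n then h else 0) - c k * l + c (Suc k)"
      using hcomp_mult[OF l, of "Suc k" b]
      by (simp add: right_diff_distrib hcomp_diff hcomp_homogeneous[OF h] c_def)
    then show ?thesis using J(2)[OF mem] by metis
  qed
  have "hcomp 0 (h - b * (l - 1)) = (if n = 0 then h else 0) + c 0"
    using hcomp_mult[OF l, of 0 b]
    by (simp add: right_diff_distrib hcomp_diff hcomp_homogeneous[OF h] c_def)
  then have base: "(if n = 0 then h else 0) + c 0 \<in> J"
    using J(2)[OF mem] by metis
  have below: "c k \<in> J" if "k < n" for k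
    using that
  proof (induction k)
    case 0
    then show ?case using base by simp
  next
    case (Suc k)
    then have "- (c k * l) + c (Suc k) \<in> J" "c k * l \<in> J"
      using step[of k] is_ideal_mult_right[OF J(1)] by auto
    then show ?case
      using is_ideal_add[OF J(1)] by fastforce
  qed
  have above: "c (n + M) + l ^ M * h \<in> J" for M
  proof (induction M)
    case 0
    show ?case
    proof (cases n)
      case 0
      then show ?thesis using base by (simp add: add.commute)
    next
      case (Suc k)
      then have "(h - c k * l + c n) + c k * l \<in> J"
        using step[of k] is_ideal_mult_right[OF J(1) below[of k]]
        by (intro is_ideal_add[OF J(1), of "h - c k * l + c n"]) auto
      then show ?thesis by (simp add: add.commute)
    qed
  next
    case (Suc M)
    have "- (c (n + M) * l) + c (Suc (n + M)) \<in> J"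
      using step[of "n + M"] by simp
    from is_ideal_add[OF J(1) this is_ideal_mult_right[OF J(1) Suc, of l]]
    have "(- (c (n + M) * l) + c (Suc (n + M))) + (c (n + M) + l ^ M * h) * l \<in> J" .
    then show ?case by (simp add: algebra_simps)
  qed
  obtain N where "\<And>k. k \<ge> N \<Longrightarrow> c k = 0"
    unfolding c_def by (rule obtain_hcomp_bound[of b]) blast
  then have "c (n + N) = 0" by simp
  then have "l ^ N * h \<in> J" using above[of N] by simp
  then show thesis by (rule that)
qed


section \<open>Projective space\<close>

lemma abs_rep_proj [simp]: "abs_proj (rep_proj p) = p"
  by (rule Quotient3_abs_rep[OF Quotient3_proj])

lemma rep_proj_nonzero [simp]: "rep_proj p \<noteq> 0"
  using Quotient3_rep_reflp[OF Quotient3_proj, of p] by (simp add: proportional_def)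

lemma abs_proj_eq_iff: "x \<noteq> 0 \<Longrightarrow> y \<noteq> 0 \<Longrightarrow> abs_proj x = abs_proj y \<longleftrightarrow> (\<exists>c. y = c *s x)"
proof -
  assume xy: "x \<noteq> 0" "y \<noteq> 0"
  then have "proportional x x" "proportional y y"
    by (auto simp: proportional_def intro: exI[of _ 1])
  then have "abs_proj x = abs_proj y \<longleftrightarrow> proportional x y"
    using Quotient3_rel[OF Quotient3_proj, of x y] by simp
  then show ?thesis using xy by (simp add: proportional_def)
qed

lemma rep_abs_proj:
  assumes "x \<noteq> 0"
  obtains c where "c \<noteq> 0" "rep_proj (abs_proj x) = c *s x"
proof -
  have "\<exists>c. rep_proj (abs_proj x) = c *s x"
    using abs_proj_eq_iff[of x "rep_proj (abs_proj x)"] assms by simp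
  then obtain c where c: "rep_proj (abs_proj x) = c *s x" by blast
  moreover have "c \<noteq> 0" using c rep_proj_nonzero[of "abs_proj x"] by auto
  ultimately show thesis using that by blast
qed

lemma mp_eval_rep_abs_proj:
  assumes "homogeneous n p" "x \<noteq> 0"
  shows "mp_eval id (rep_proj (abs_proj x)) p = 0 \<longleftrightarrow> mp_eval id x p = 0"
  using rep_abs_proj[OF assms(2)] mp_eval_scale[OF assms(1)] by (metis mult_eq_0_iff power_eq_0_iff)

lemma zero_locus_abs_proj:
  "homogeneous n F \<Longrightarrow> x \<noteq> 0 \<Longrightarrow> abs_proj x \<in> zero_locus F \<longleftrightarrow> mp_eval id x F = 0"
  by (simp add: zero_locus_def mp_eval_rep_abs_proj)

lemma euler_identity_eval:
  fixes x :: "complex ^ 'v::finite"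
  assumes "homogeneous n p"
  shows "(\<Sum>i\<in>UNIV. x $ i * mp_eval id x (mp_deriv i p)) = of_nat n * mp_eval id x p"
proof -
  have "mp_eval id x (\<Sum>i\<in>UNIV. Var i * mp_deriv i p) = mp_eval id x (Const (of_nat n) * p)"
    by (simp add: euler_identity[OF assms] Const_of_nat)
  then show ?thesis
    by (simp add: mp_eval_simps[OF ring_morphism_id] mp_eval_Var[OF ring_morphism_id] mp_eval_Const[OF ring_morphism_id])
qed

text \<open>For positive degree, Euler's identity derives \<open>F = 0\<close> from the vanishing of
  the gradient; \<open>n > 0\<close> excludes nonzero constants, whose gradient is zero
  everywhere.\<close>

lemma sing_locus_abs_proj:
  assumes "homogeneous n F" "n > 0" "x \<noteq> 0"
  shows "abs_proj x \<in> sing_locus F \<longleftrightarrow> (\<forall>i. mp_eval id x (mp_deriv i F) = 0)"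
proof -
  have "mp_eval id x F = 0" if "\<forall>i. mp_eval id x (mp_deriv i F) = 0"
    using euler_identity_eval[OF assms(1), of x] that assms(2) by simp
  then show ?thesis
    using mp_eval_rep_abs_proj[OF homogeneous_mp_deriv[OF assms(1)] assms(3)] assms
    by (auto simp: sing_locus_def zero_locus_abs_proj)
qed

lemma sing_locus_mp_deriv: "p \<in> sing_locus F \<Longrightarrow> mp_eval id (rep_proj p) (mp_deriv i F) = 0"
  by (simp add: sing_locus_def)


section \<open>Tjurina numbers and the Jacobian ideal\<close>

definition jacobian_ideal :: "'n::finite mpoly \<Rightarrow> 'n mpoly set" where
  "jacobian_ideal F = range (\<lambda>a. \<Sum>i\<in>UNIV. a i * mp_deriv i F)"

lemma jacobian_idealI: "(\<Sum>i\<in>UNIV. a i * mp_deriv i F) \<in> jacobian_ideal F"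
  by (auto simp: jacobian_ideal_def)

lemma is_ideal_jacobian: "is_ideal (jacobian_ideal F)"
  unfolding is_ideal_def
proof (intro conjI ballI allI)
  show "0 \<in> jacobian_ideal F"
    using jacobian_idealI[of "\<lambda>_. 0" F] by simp
next
  fix a b assume "a \<in> jacobian_ideal F" "b \<in> jacobian_ideal F"
  then obtain u v where "a = (\<Sum>i\<in>UNIV. u i * mp_deriv i F)" "b = (\<Sum>i\<in>UNIV. v i * mp_deriv i F)"
    by (auto simp: jacobian_ideal_def)
  then have eq: "a + b = (\<Sum>i\<in>UNIV. (u i + v i) * mp_deriv i F)"
    by (simp add: distrib_right sum.distrib)
  show "a + b \<in> jacobian_ideal F" unfolding eq by (rule jacobian_idealI)
next
  fix r a assume "a \<in> jacobian_ideal F"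
  then obtain u where "a = (\<Sum>i\<in>UNIV. u i * mp_deriv i F)"
    by (auto simp: jacobian_ideal_def)
  then have eq: "r * a = (\<Sum>i\<in>UNIV. (r * u i) * mp_deriv i F)"
    by (simp add: sum_distrib_left mult.assoc)
  show "r * a \<in> jacobian_ideal F" unfolding eq by (rule jacobian_idealI)
qed

lemma mp_deriv_in_jacobian: "mp_deriv i F \<in> jacobian_ideal F"
proof -
  have "(\<Sum>j\<in>UNIV. (if j = i then 1 else 0) * mp_deriv j F) = (\<Sum>j\<in>UNIV. if j = i then mp_deriv j F else 0)"
    by (intro sum.cong) auto
  then show ?thesis using jacobian_idealI[of "\<lambda>j. if j = i then 1 else 0" F] by simp
qed

lemma hcomp_jacobian:
  assumes "homogeneous m F" "a \<in> jacobian_ideal F"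
  shows "hcomp k a \<in> jacobian_ideal F"
proof -
  obtain u where u: "a = (\<Sum>i\<in>UNIV. u i * mp_deriv i F)"
    using assms by (auto simp: jacobian_ideal_def)
  have eq: "hcomp k a = (\<Sum>i\<in>UNIV. (if k \<ge> m - 1 then hcomp (k - (m - 1)) (u i) else 0) * mp_deriv i F)"
    unfolding u hcomp_sum
    by (intro sum.cong refl) (use hcomp_mult[OF homogeneous_mp_deriv[OF assms(1)], of k] in simp)
  show ?thesis unfolding eq by (rule jacobian_idealI)
qed

lemma jacobian_eval:
  assumes "a \<in> jacobian_ideal F" "\<And>i. mp_eval id x (mp_deriv i F) = 0"
  shows "mp_eval id x a = 0"
  using assms by (auto simp: jacobian_ideal_def mp_eval_simps[OF ring_morphism_id])

lemma ring_morphism_cps_coeff_0 [simp]: "ring_morphism (\<lambda>a. cps_coeff a 0)"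
  by (simp add: ring_morphism_def cps_coeff_mult_0 one_cps_def cps_coeff_const)

text \<open>
  The ring \<open>S/J\<close> behaves like the homogeneous coordinate ring of a zero-dimensional scheme that misses
  the hyperplane \<open>l = 0\<close>: \<open>l\<close> is a nonzerodivisor and every coordinate is integral over \<open>\<complex>[l]\<close>.
\<close>

locale saturated_jacobian =
  fixes F l :: "'n::finite mpoly" and m :: nat
  assumes F: "homogeneous m F" "m > 0" and l: "homogeneous 1 l"
    and integral: "\<And>i. \<exists>bs. (\<Prod>b\<leftarrow>bs. Var i - Const b * l) \<in> jacobian_ideal F"
    and nonzerodivisor: "\<And>h. l * h \<in> jacobian_ideal F \<Longrightarrow> h \<in> jacobian_ideal F"
begin

abbreviation "J \<equiv> jacobian_ideal F"

lemmas J_ideal = is_ideal_jacobian[of F]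

lemma l_power_cancel: "l ^ M * h \<in> J \<Longrightarrow> h \<in> J"
  by (induction M) (auto simp: mult.assoc intro: nonzerodivisor)

lemma eval_id_simps [simp]:
  fixes x :: "complex ^ 'v::finite"
  shows "mp_eval id x (p + q) = mp_eval id x p + mp_eval id x q"
  "mp_eval id x (p - q) = mp_eval id x p - mp_eval id x q"
  "mp_eval id x (p * q) = mp_eval id x p * mp_eval id x q"
  "mp_eval id x 1 = 1" "mp_eval id x (Var i) = x $ i" "mp_eval id x (Const c) = c"
  "mp_eval id x (p ^ n) = mp_eval id x p ^ n"
  "mp_eval id x (prod_list (map f xs)) = (\<Prod>y\<leftarrow>xs. mp_eval id x (f y))"
  "mp_eval id x (prod g A) = (\<Prod>a\<in>A. mp_eval id x (g a))"
  by (simp_all add: mp_eval_simps[OF ring_morphism_id] mp_eval_Var[OF ring_morphism_id] mp_eval_Const[OF ring_morphism_id])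

lemma coordinate_root:
  fixes x :: "complex ^ 'n"
  assumes "\<And>i. mp_eval id x (mp_deriv i F) = 0" "(\<Prod>b\<leftarrow>bs. Var i - Const b * l) \<in> J"
  shows "\<exists>b\<in>set bs. x $ i = b * mp_eval id x l"
proof -
  have "(\<Prod>b\<leftarrow>bs. x $ i - b * mp_eval id x l) = 0"
    using jacobian_eval[OF assms(2,1)] by simp
  then show ?thesis
    by (auto simp: prod_list_zero_iff)
qed

text \<open>At a zero of \<open>l\<close> the integral equation of \<open>Var i\<close> degenerates
  to the vanishing of a power of \<open>x $ i\<close>.\<close>

lemma l_nonzero:
  assumes "\<And>i. mp_eval id x (mp_deriv i F) = 0" "x \<noteq> 0"
  shows "mp_eval id x l \<noteq> 0"
proof
  assume "mp_eval id x l = 0"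
  then have "x $ i = 0" for i
    using coordinate_root[of x i] integral[of i] assms by fastforce
  then show False using assms(2) by (simp add: vec_eq_iff)
qed

text \<open>Scaling a singular point to \<open>l = 1\<close> puts each of its coordinates among the
  finitely many roots of an integral equation.\<close>

lemma finite_sing_locus: "finite (sing_locus F)"
proof -
  obtain bs where bs: "\<And>i. (\<Prod>b\<leftarrow>bs i. Var i - Const b * l) \<in> J"
    using choice[of "\<lambda>i bs. (\<Prod>b\<leftarrow>bs. Var i - Const b * l) \<in> J"] integral by blast
  let ?W = "{w :: complex ^ 'n. \<forall>i. w $ i \<in> set (bs i)}"
  have "finite (\<Pi>\<^sub>E i\<in>UNIV. set (bs i))" by (intro finite_PiE) auto
  moreover have "?W \<subseteq> vec_lambda ` (\<Pi>\<^sub>E i\<in>UNIV. set (bs i))"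
  proof
    fix w assume "w \<in> ?W"
    then have "vec_nth w \<in> (\<Pi>\<^sub>E i\<in>UNIV. set (bs i))" by auto
    then show "w \<in> vec_lambda ` (\<Pi>\<^sub>E i\<in>UNIV. set (bs i))"
      using image_eqI[of w vec_lambda "vec_nth w"] by simp
  qed
  ultimately have "finite ?W" using finite_subset finite_imageI by blast
  moreover have "sing_locus F \<subseteq> abs_proj ` ?W"
  proof
    fix p assume "p \<in> sing_locus F"
    then have x: "\<And>i. mp_eval id (rep_proj p) (mp_deriv i F) = 0"
      by (rule sing_locus_mp_deriv)
    define c where "c = mp_eval id (rep_proj p) l"
    have c: "c \<noteq> 0" unfolding c_def by (rule l_nonzero) (use x in auto)
    let ?w = "inverse c *s rep_proj p"
    have "?w $ i \<in> set (bs i)" for i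
    proof -
      obtain b where b: "b \<in> set (bs i)" "rep_proj p $ i = b * c"
        using coordinate_root[OF x bs[of i]] unfolding c_def by blast
      then have "?w $ i = b" using c by (simp add: field_simps)
      then show ?thesis using b(1) by (simp only:)
    qed
    moreover have "?w \<noteq> 0"
      using c rep_proj_nonzero[of p] by (auto simp: vec_eq_iff)
    then have "abs_proj ?w = p"
      using abs_proj_eq_iff[of "rep_proj p" ?w] by auto
    ultimately show "p \<in> abs_proj ` ?W" by (intro image_eqI[of _ _ ?w]) auto
  qed
  ultimately show ?thesis using finite_subset finite_imageI by blast
qed

text \<open>In the integral equation of each coordinate, the factors that do not vanish at
  \<open>x\<close> are collected into \<open>s\<close>; a power of the one factor vanishing there
  remains. Multiplication by \<open>s\<close> thus isolates the part of the scheme supported at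
  \<open>x\<close>.\<close>

lemma local_annihilator:
  fixes x :: "complex ^ 'n"
  assumes "\<And>i. mp_eval id x (mp_deriv i F) = 0" "x $ i = 1"
  obtains s n N where "homogeneous n s" "mp_eval id x s \<noteq> 0"
    "\<And>k. s * (Var k - Const (x $ k) * Var i) ^ N \<in> J"
proof -
  obtain bs where bs: "\<And>i. (\<Prod>b\<leftarrow>bs i. Var i - Const b * l) \<in> J"
    using choice[of "\<lambda>i bs. (\<Prod>b\<leftarrow>bs. Var i - Const b * l) \<in> J"] integral by blast
  define c where "c = mp_eval id x l"
  have "c \<noteq> 0" unfolding c_def using assms by (intro l_nonzero) auto
  define f where "f k b = Var k - Const b * l" for k b
  define w where "w k = x $ k / c" for k
  define s where "s k = (\<Prod>b\<leftarrow>filter (\<lambda>b. b \<noteq> w k) (bs k). f k b)" for k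
  \<comment> \<open>A single exponent that exceeds the multiplicity of every root in every list
    \<open>bs k\<close>.\<close>
  define N where "N = (\<Sum>k\<in>UNIV. length (bs k))"
  have f1: "homogeneous 1 (f k b)" for k b
    unfolding f_def by (intro homogeneous_diff homogeneous_Const_mult homogeneous_Var l)
  have sh: "homogeneous (length (filter (\<lambda>b. b \<noteq> w k) (bs k))) (s k)" for k
    unfolding s_def using f1 by (intro homogeneous_prod_list)
  have snz: "mp_eval id x (s k) \<noteq> 0" for k
    using \<open>c \<noteq> 0\<close> by (auto simp: s_def f_def prod_list_zero_iff w_def eq_divide_eq simp flip: c_def)
  have split: "(\<Prod>b\<leftarrow>xs. f k b) = (\<Prod>b\<leftarrow>filter (\<lambda>b. b \<noteq> w k) xs. f k b) * f k (w k) ^ count_list xs (w k)" for k xs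
    by (induction xs) (auto simp: mult_ac)
  have single: "s k * f k (w k) ^ N \<in> J" for k
  proof -
    have "count_list (bs k) (w k) \<le> length (bs k)"
      by (rule count_le_length)
    also have "\<dots> \<le> N"
      unfolding N_def by (rule member_le_sum) auto
    finally have "f k (w k) ^ N = f k (w k) ^ (N - count_list (bs k) (w k)) * f k (w k) ^ count_list (bs k) (w k)"
      by (simp flip: power_add)
    then have "s k * f k (w k) ^ N = f k (w k) ^ (N - count_list (bs k) (w k)) * (\<Prod>b\<leftarrow>bs k. f k b)"
      by (simp only: split[of k "bs k", folded s_def] mult_ac)
    then show ?thesis
      using is_ideal_mult[OF J_ideal bs[of k]] by (simp add: f_def)
  qed
  define S where "S = (\<Prod>k\<in>UNIV. s k)"
  have all: "S * f k (w k) ^ N \<in> J" for k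
  proof -
    have "S = (\<Prod>k\<in>UNIV-{k}. s k) * s k"
      unfolding S_def by (subst prod.remove[of UNIV k]) (auto simp: mult.commute)
    then show ?thesis
      using is_ideal_mult[OF J_ideal single[of k]] by (simp add: mult.assoc)
  qed
  show thesis
  proof (rule that)
    show "homogeneous (\<Sum>k\<in>UNIV. length (filter (\<lambda>b. b \<noteq> w k) (bs k))) S"
      unfolding S_def by (rule homogeneous_prod) (rule sh)
    show "mp_eval id x S \<noteq> 0"
      using snz by (simp add: S_def)
    fix k
    \<comment> \<open>The form \<open>l\<close> is eliminated between the factors for
      \<open>k\<close> and \<open>i\<close>: \<open>w k = x $ k * w i\<close> because
      \<open>x $ i = 1\<close>. Adding two nilpotents is what doubles the exponent to
      \<open>2 * N\<close>.\<close>
    have eq: "Var k - Const (x $ k) * Var i = f k (w k) + (- Const (x $ k)) * f i (w i)"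
    proof -
      have "(Const (w k) :: 'n mpoly) = Const (x $ k) * Const (w i)"
        using assms(2) by (simp add: w_def flip: Const_mult)
      then show ?thesis
        by (simp add: f_def algebra_simps)
    qed
    have "S * ((- Const (x $ k)) * f i (w i)) ^ N \<in> J"
      using is_ideal_mult[OF J_ideal all[of i], of "(- Const (x $ k)) ^ N"]
      by (simp only: power_mult_distrib mult_ac)
    then show "S * (Var k - Const (x $ k) * Var i) ^ (2 * N) \<in> J"
      unfolding eq by (rule is_ideal_binomial[OF J_ideal all])
  qed
qed

end

section \<open>Affine charts at a singular point\<close>

lemma lookup_substitute_0:
  "Poly_Mapping.lookup (mp_eval Const (\<chi> k. Const (v $ k) + (\<Sum>j | \<sigma> j = k. Var j)) h :: 'm::finite mpoly) 0
     = mp_eval id (v :: complex ^ 'n::finite) h"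
proof -
  let ?X = "\<chi> k. Const (v $ k) + (\<Sum>j | \<sigma> j = k. Var j) :: 'm mpoly ^ 'n"
  let ?\<phi> = "\<lambda>h. cps_coeff (cps_of_mpoly (mp_eval Const ?X h)) 0"
  have 1: "ring_morphism ?\<phi>"
    by (rule ring_morphism_comp[OF ring_morphism_cps_coeff_0 ring_morphism_comp[OF ring_morphism_cps_of_mpoly
          ring_morphism_mp_eval[OF ring_morphism_Const]]])
  have 2: "?\<phi> (Var k) = mp_eval id v (Var k)" for k
    by (simp add: mp_eval_Var[OF ring_morphism_Const] mp_eval_Var[OF ring_morphism_id] lookup_add lookup_sum)
       (simp add: Const_def Var_def lookup_single when_def flip: mdeg_eq_0_iff)
  have 3: "?\<phi> (Const c) = mp_eval id v (Const c)" for c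
    by (simp add: mp_eval_Const[OF ring_morphism_Const] mp_eval_Const[OF ring_morphism_id] cps_coeff_const
        del: cps_coeff_of_mpoly)
  have "?\<phi> h = mp_eval id v h"
    by (rule ring_morphism_eqI[OF 1 ring_morphism_mp_eval[OF ring_morphism_id] 3 2])
  then show ?thesis by simp
qed

lemma mp_deriv_substitute:
  fixes \<sigma> :: "'m::finite \<Rightarrow> 'n::finite" and v :: "complex ^ 'n"
  defines "X \<equiv> \<chi> k. Const (v $ k) + (\<Sum>j | \<sigma> j = k. Var j) :: 'm mpoly ^ 'n"
  assumes "inj \<sigma>"
  shows "mp_deriv j (mp_eval Const X h) = mp_eval Const X (mp_deriv (\<sigma> j) h)"
proof (induction h rule: mpoly_induct)
  case (Var k h)
  have "mp_deriv j (X $ k) = (\<Sum>i | \<sigma> i = k. if i = j then 1 else 0)"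
    unfolding X_def by (simp add: mp_deriv_add mp_deriv_sum mp_deriv_Var eq_commute)
  also have "\<dots> = (if \<sigma> j = k then 1 else 0)"
    by simp
  finally show ?case
    using Var by (simp add: mp_deriv_mult mp_deriv_Var mp_eval_simps[OF ring_morphism_Const]
        mp_eval_Var[OF ring_morphism_Const] mp_deriv_Var_mult)
qed (simp_all add: mp_eval_simps[OF ring_morphism_Const] mp_eval_Const[OF ring_morphism_Const] mp_deriv_add)

lemma tjurina_ideal_is_ideal: "is_ideal (tjurina_ideal g)"
proof -
  interpret module "(*) :: 'a cps \<Rightarrow> 'a cps \<Rightarrow> 'a cps" by (rule module_times)
  show ?thesis
    unfolding is_ideal_def tjurina_ideal_def by (auto intro: span_zero span_add span_scale)
qed

lemma tjurina_ideal_generators: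
  "cps_of_mpoly g \<in> tjurina_ideal g" "cps_of_mpoly (mp_deriv i g) \<in> tjurina_ideal g"
proof -
  interpret module "(*) :: 'a cps \<Rightarrow> 'a cps \<Rightarrow> 'a cps" by (rule module_times)
  show "cps_of_mpoly g \<in> tjurina_ideal g" "cps_of_mpoly (mp_deriv i g) \<in> tjurina_ideal g"
    unfolding tjurina_ideal_def by (auto intro: span_base)
qed

lemma tjurina_ideal_minimal:
  assumes "is_ideal I" "cps_of_mpoly g \<in> I" "\<And>i. cps_of_mpoly (mp_deriv i g) \<in> I"
  shows "tjurina_ideal g \<subseteq> I"
proof -
  interpret module "(*) :: 'a cps \<Rightarrow> 'a cps \<Rightarrow> 'a cps" by (rule module_times)
  show ?thesis
    unfolding tjurina_ideal_def
  proof (rule span_minimal)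
    show "subspace I"
      using assms(1) unfolding is_ideal_def by (intro subspaceI) auto
  qed (use assms in auto)
qed

lemma is_ideal_cps_subspace: "is_ideal I \<Longrightarrow> cps_subspace I"
  by (auto simp: is_ideal_def cps_subspace_def)

lemma is_ideal_combinations: "is_ideal (range (\<lambda>c. \<Sum>k\<in>(UNIV :: 'k::finite set). c k * x k))"
  unfolding is_ideal_def
proof (intro conjI ballI allI)
  show "0 \<in> range (\<lambda>c. \<Sum>k\<in>UNIV. c k * x k)"
    by (rule range_eqI[of _ _ "\<lambda>_. 0"]) simp
next
  fix a b assume "a \<in> range (\<lambda>c. \<Sum>k\<in>UNIV. c k * x k)" "b \<in> range (\<lambda>c. \<Sum>k\<in>UNIV. c k * x k)"
  then obtain c d where "a = (\<Sum>k\<in>UNIV. c k * x k)" "b = (\<Sum>k\<in>UNIV. d k * x k)" by blast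
  then show "a + b \<in> range (\<lambda>c. \<Sum>k\<in>UNIV. c k * x k)"
    by (intro range_eqI[of _ _ "\<lambda>k. c k + d k"]) (simp add: distrib_right sum.distrib)
next
  fix r a assume "a \<in> range (\<lambda>c. \<Sum>k\<in>UNIV. c k * x k)"
  then obtain c where "a = (\<Sum>k\<in>UNIV. c k * x k)" by blast
  then show "r * a \<in> range (\<lambda>c. \<Sum>k\<in>UNIV. c k * x k)"
    by (intro range_eqI[of _ _ "\<lambda>k. r * c k"]) (simp add: sum_distrib_left mult.assoc)
qed

text \<open>The witnesses of \<open>local_equation\<close> at a singular point, under fixed names.
  The map \<open>E\<close> defined below sets \<open>Var i0\<close> to 1 and translates the point to
  the origin.\<close>

locale local_chart = saturated_jacobian F l m
  for F l :: "'n::finite mpoly" and m +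
  fixes v :: "complex ^ 'n" and i0 :: 'n and \<sigma> :: "'m::finite \<Rightarrow> 'n" and g :: "'m mpoly"
  assumes sing: "\<And>i. mp_eval id v (mp_deriv i F) = 0"
    and v: "v $ i0 = 1" and \<sigma>: "bij_betw \<sigma> UNIV (- {i0})"
    and g: "g = mp_eval Const (\<chi> k. Const (v $ k) + (\<Sum>j | \<sigma> j = k. Var j)) F"
begin

definition "X = (\<chi> k. Const (v $ k) + (\<Sum>j | \<sigma> j = k. Var j) :: 'm mpoly ^ 'n)"

definition E :: "'n mpoly \<Rightarrow> 'm mpoly" where "E = mp_eval Const X"

lemma ring_morphism_E: "ring_morphism E"
  by (simp add: E_def)

lemma E_Const: "E (Const c) = Const c"
  by (simp add: E_def)

lemma E_Var: "E (Var k) = X $ k"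
  by (simp add: E_def)

lemma inj_\<sigma>: "inj \<sigma>"
  using \<sigma> by (simp add: bij_betw_def)

lemma X_\<sigma>: "X $ \<sigma> j = Const (v $ \<sigma> j) + Var j"
proof -
  have "{j'. \<sigma> j' = \<sigma> j} = {j}"
    using inj_\<sigma> by (auto simp: inj_def)
  then show ?thesis by (simp add: X_def)
qed

lemma X_i0: "X $ i0 = 1"
proof -
  have "{j. \<sigma> j = i0} = {}"
    using \<sigma> by (auto simp: bij_betw_def)
  then show ?thesis by (simp add: X_def v)
qed

lemma \<sigma>_cases: obtains "k = i0" | j where "k = \<sigma> j"
  using \<sigma> by (cases "k = i0") (auto simp: bij_betw_def)

lemma mp_deriv_g: "mp_deriv j g = E (mp_deriv (\<sigma> j) F)"
  unfolding g E_def X_def by (rule mp_deriv_substitute[OF inj_\<sigma>])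

abbreviation "T \<equiv> tjurina_ideal g"

lemmas T_ideal = tjurina_ideal_is_ideal[of g]

text \<open>No local derivative corresponds to the index \<open>i0\<close>. Euler's identity with
  \<open>Var i0 = 1\<close> expresses this partial derivative through \<open>g\<close> and the
  others.\<close>

lemma E_mp_deriv_in_T: "cps_of_mpoly (E (mp_deriv k F)) \<in> T"
proof (cases k rule: \<sigma>_cases)
  case 1
  have "E (\<Sum>k\<in>UNIV. Var k * mp_deriv k F) = E (Const (of_nat m) * F)"
    by (simp add: euler_identity[OF F(1)] Const_of_nat)
  then have "(\<Sum>k\<in>UNIV. X $ k * E (mp_deriv k F)) = Const (of_nat m) * g"
    using g by (simp add: ring_morphism_simps[OF ring_morphism_E] E_Const E_Var) (simp add: E_def X_def)
  moreover have "(\<Sum>k\<in>UNIV. X $ k * E (mp_deriv k F))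
     = E (mp_deriv i0 F) + (\<Sum>k\<in>-{i0}. X $ k * E (mp_deriv k F))"
    by (subst sum.remove[of UNIV i0]) (auto simp: X_i0 Compl_eq_Diff_UNIV)
  moreover have "(\<Sum>k\<in>-{i0}. X $ k * E (mp_deriv k F)) = (\<Sum>j\<in>UNIV. X $ \<sigma> j * mp_deriv j g)"
    unfolding mp_deriv_g using sum.reindex_bij_betw[OF \<sigma>, of "\<lambda>k. X $ k * E (mp_deriv k F)"] by simp
  ultimately have "E (mp_deriv i0 F) = Const (of_nat m) * g - (\<Sum>j\<in>UNIV. X $ \<sigma> j * mp_deriv j g)"
    by (simp add: algebra_simps)
  then have eq: "cps_of_mpoly (E (mp_deriv k F)) = cps_of_mpoly (Const (of_nat m)) * cps_of_mpoly g
      - (\<Sum>j\<in>UNIV. cps_of_mpoly (X $ \<sigma> j) * cps_of_mpoly (mp_deriv j g))"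
    using 1 by (simp only: cps_of_mpoly_simps)
  show ?thesis
    unfolding eq
    by (intro is_ideal_diff[OF T_ideal] is_ideal_sum[OF T_ideal] is_ideal_mult[OF T_ideal] tjurina_ideal_generators)
next
  case (2 j)
  then show ?thesis
    using tjurina_ideal_generators(2)[of j g] by (simp add: mp_deriv_g)
qed

lemma E_jacobian_in_T: "a \<in> J \<Longrightarrow> cps_of_mpoly (E a) \<in> T"
  by (auto simp: jacobian_ideal_def ring_morphism_simps[OF ring_morphism_E] cps_of_mpoly_simps
      intro!: is_ideal_sum[OF T_ideal] is_ideal_mult[OF T_ideal] E_mp_deriv_in_T)

text \<open>The converse use of Euler's identity: as \<open>m\<close> is invertible,
  \<open>g\<close> is itself a combination of the pulled back partial derivatives, which therefore
  generate the Tjurina ideal.\<close>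

lemma T_combination:
  assumes "a \<in> T"
  obtains c where "a = (\<Sum>k\<in>UNIV. c k * cps_of_mpoly (E (mp_deriv k F)))"
proof -
  let ?I = "range (\<lambda>c. \<Sum>k\<in>UNIV. c k * cps_of_mpoly (E (mp_deriv k F)))"
  have I: "is_ideal ?I" by (rule is_ideal_combinations)
  have gen: "cps_of_mpoly (E (mp_deriv k F)) \<in> ?I" for k
  proof (rule range_eqI[of _ _ "\<lambda>k'. if k' = k then 1 else 0"])
    have "(\<Sum>k'\<in>UNIV. (if k' = k then 1 else 0) * cps_of_mpoly (E (mp_deriv k' F)))
      = (\<Sum>k'\<in>UNIV. if k' = k then cps_of_mpoly (E (mp_deriv k' F)) else 0)"
      by (rule sum.cong) auto
    then show "cps_of_mpoly (E (mp_deriv k F)) = (\<Sum>k'\<in>UNIV. (if k' = k then 1 else 0) * cps_of_mpoly (E (mp_deriv k' F)))"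
      by simp
  qed
  have "Const (inverse (of_nat m)) * (\<Sum>k\<in>UNIV. Var k * mp_deriv k F)
     = (Const (inverse (of_nat m)) * Const (of_nat m)) * F"
    by (simp add: euler_identity[OF F(1)] Const_of_nat mult.assoc)
  also have "\<dots> = F"
    using F(2) by (simp flip: Const_mult)
  finally have "g = E (Const (inverse (of_nat m)) * (\<Sum>k\<in>UNIV. Var k * mp_deriv k F))"
    using g by (simp add: E_def X_def)
  then have eq: "cps_of_mpoly g = cps_of_mpoly (E (Const (inverse (of_nat m))))
      * (\<Sum>k\<in>UNIV. cps_of_mpoly (E (Var k)) * cps_of_mpoly (E (mp_deriv k F)))"
    by (simp only: ring_morphism_simps[OF ring_morphism_E] cps_of_mpoly_simps)
  have "cps_of_mpoly g \<in> ?I"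
    unfolding eq by (intro is_ideal_mult[OF I] is_ideal_sum[OF I] gen)
  moreover have "cps_of_mpoly (mp_deriv j g) \<in> ?I" for j
    unfolding mp_deriv_g by (rule gen)
  ultimately have "T \<subseteq> ?I"
    by (intro tjurina_ideal_minimal[OF I])
  then show thesis using assms that by blast
qed

text \<open>Under \<open>E\<close> the factor
  \<open>Var (\<sigma> j) - Const (v $ \<sigma> j) * Var i0\<close> becomes the local coordinate
  \<open>Var j\<close>, and \<open>s\<close> becomes a unit since its constant term is its value at
  \<open>v\<close>.\<close>

lemma power_annihilator:
  obtains s n N where "homogeneous n s" "mp_eval id v s \<noteq> 0"
    "\<And>j. s * (Var (\<sigma> j) - Const (v $ \<sigma> j) * Var i0) ^ N \<in> J"
    "\<And>j. cps_of_mpoly (Var j ^ N) \<in> T"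
proof -
  obtain s n N where s: "homogeneous n s" "mp_eval id v s \<noteq> 0"
    "\<And>k. s * (Var k - Const (v $ k) * Var i0) ^ N \<in> J"
    by (rule local_annihilator[OF sing v]) blast
  have "cps_coeff (cps_of_mpoly (E s)) 0 = mp_eval id v s"
    unfolding E_def X_def by (simp add: lookup_substitute_0)
  then have "cps_coeff (cps_of_mpoly (E s)) 0 \<noteq> 0"
    using s(2) by (simp only: not_False_eq_True)
  then obtain b where b: "cps_of_mpoly (E s) * b = 1"
    by (rule cps_unit)
  have "cps_of_mpoly (Var j ^ N) \<in> T" for j
  proof -
    have "E (s * (Var (\<sigma> j) - Const (v $ \<sigma> j) * Var i0) ^ N) = E s * Var j ^ N"
      by (simp add: ring_morphism_simps[OF ring_morphism_E] E_Const E_Var X_\<sigma> X_i0)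
    then have "cps_of_mpoly (E s) * cps_of_mpoly (Var j ^ N) \<in> T"
      using E_jacobian_in_T[OF s(3)[of "\<sigma> j"]] by (simp add: cps_of_mpoly_mult)
    then have "b * (cps_of_mpoly (E s) * cps_of_mpoly (Var j ^ N)) \<in> T"
      by (rule is_ideal_mult[OF T_ideal])
    also have "b * (cps_of_mpoly (E s) * cps_of_mpoly (Var j ^ N)) = (cps_of_mpoly (E s) * b) * cps_of_mpoly (Var j ^ N)"
      by (simp only: mult_ac)
    also have "\<dots> = cps_of_mpoly (Var j ^ N)"
      by (simp only: b mult_1_left)
    finally show ?thesis .
  qed
  with s show thesis by (intro that)
qed

text \<open>High powers of the coordinates lie in \<open>T\<close>, so the finitely many monomials
  of a box generate the quotient.\<close>

lemma basis_mod_T: obtains B where "basis_mod T B"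
proof -
  obtain N where N: "\<And>j. cps_of_mpoly (Var j ^ N) \<in> T"
    by (rule power_annihilator) blast
  let ?Box = "{e :: 'm \<Rightarrow>\<^sub>0 nat. \<forall>j. Poly_Mapping.lookup e j < N}"
  let ?f = "\<lambda>e. cps_of_mpoly (Poly_Mapping.single e 1)"
  have inj: "inj_on ?f ?Box"
  proof (rule inj_onI)
    fix a b :: "'m \<Rightarrow>\<^sub>0 nat" assume "?f a = ?f b"
    then have "cps_coeff (?f a) a = cps_coeff (?f b) a" by simp
    then show "a = b" by (auto simp: lookup_single when_def split: if_splits)
  qed
  have "\<exists>c. h - (\<Sum>b\<in>?f ` ?Box. cps_const (c b) * b) \<in> T" for h
  proof -
    obtain t r where t: "Poly_Mapping.keys t \<subseteq> ?Box"
      and h: "h = cps_of_mpoly t + (\<Sum>j\<in>UNIV. cps_of_mpoly (Var j ^ N) * r j)"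
      by (rule cps_truncate[where N = N and c = h])
    define c where "c b = Poly_Mapping.lookup t (inv_into ?Box ?f b)" for b
    have "(\<Sum>b\<in>?f ` ?Box. cps_const (c b) * b) = (\<Sum>e\<in>?Box. cps_const (Poly_Mapping.lookup t e) * ?f e)"
      unfolding c_def by (subst sum.reindex[OF inj]) (auto intro!: sum.cong simp: inv_into_f_f[OF inj])
    also have "\<dots> = (\<Sum>e\<in>?Box. cps_of_mpoly (Poly_Mapping.single e (Poly_Mapping.lookup t e)))"
      by (intro sum.cong refl) (simp add: Const_mult_single flip: cps_of_mpoly_Const cps_of_mpoly_mult)
    also have "\<dots> = (\<Sum>e\<in>Poly_Mapping.keys t. cps_of_mpoly (Poly_Mapping.single e (Poly_Mapping.lookup t e)))"
      by (rule sum.mono_neutral_right) (use t finite_box in \<open>auto simp: in_keys_iff\<close>)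
    also have "\<dots> = cps_of_mpoly t"
      by (simp only: cps_of_mpoly_sum[symmetric] mpoly_expand[symmetric])
    finally have "h - (\<Sum>b\<in>?f ` ?Box. cps_const (c b) * b) = (\<Sum>j\<in>UNIV. cps_of_mpoly (Var j ^ N) * r j)"
      using h by simp
    also have "\<dots> \<in> T"
      by (intro is_ideal_sum[OF T_ideal] is_ideal_mult_right[OF T_ideal] N)
    finally show ?thesis by blast
  qed
  then show thesis
    using basis_mod_exists[OF is_ideal_cps_subspace[OF T_ideal], of "?f ` ?Box"] finite_box that by blast
qed

text \<open>
  A relation \<open>h = \<Sum> c\<^sub>k \<partial>\<^sub>k F\<close> in the local ring becomes polynomial after truncating the \<open>c\<^sub>k\<close>, up to terms that
  are killed by the element \<open>s\<close> of \<open>power_annihilator\<close>.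
\<close>

lemma local_membership:
  assumes h: "homogeneous n h" and "cps_of_mpoly (E h) \<in> T"
  obtains s k where "homogeneous k s" "mp_eval id v s \<noteq> 0" "s * h \<in> J"
proof -
  obtain s a N where s: "homogeneous a s" "mp_eval id v s \<noteq> 0"
    and sz: "\<And>j. s * (Var (\<sigma> j) - Const (v $ \<sigma> j) * Var i0) ^ N \<in> J"
    by (rule power_annihilator) blast
  obtain c where c: "cps_of_mpoly (E h) = (\<Sum>k\<in>UNIV. c k * cps_of_mpoly (E (mp_deriv k F)))"
    using T_combination[OF assms(2)] by blast
  have "\<forall>k. \<exists>t r. c k = cps_of_mpoly t + (\<Sum>j\<in>UNIV. cps_of_mpoly (Var j ^ N) * r j)"
  proof
    fix k
    obtain t r where "c k = cps_of_mpoly t + (\<Sum>j\<in>UNIV. cps_of_mpoly (Var j ^ N) * r j)"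
      by (rule cps_truncate[where N = N and c = "c k"])
    then show "\<exists>t r. c k = cps_of_mpoly t + (\<Sum>j\<in>UNIV. cps_of_mpoly (Var j ^ N) * r j)" by blast
  qed
  then have "\<exists>t r. \<forall>k. c k = cps_of_mpoly (t k) + (\<Sum>j\<in>UNIV. cps_of_mpoly (Var j ^ N) * r k j)"
    unfolding choice_iff .
  then obtain t r where tr: "\<And>k. c k = cps_of_mpoly (t k) + (\<Sum>j\<in>UNIV. cps_of_mpoly (Var j ^ N) * r k j)"
    by blast
  \<comment> \<open>The error of truncation. As a power series it is a combination of the
    \<open>Var j ^ N\<close>, and it is a polynomial.\<close>
  define q where "q = E h - (\<Sum>k\<in>UNIV. t k * E (mp_deriv k F))"
  have "cps_of_mpoly q = (\<Sum>k\<in>UNIV. \<Sum>j\<in>UNIV. cps_of_mpoly (Var j ^ N) * (r k j * cps_of_mpoly (E (mp_deriv k F))))"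
    by (simp add: q_def cps_of_mpoly_simps c tr distrib_right sum.distrib sum_distrib_right mult.assoc)
  also have "\<dots> = (\<Sum>j\<in>UNIV. \<Sum>k\<in>UNIV. cps_of_mpoly (Var j ^ N) * (r k j * cps_of_mpoly (E (mp_deriv k F))))"
    by (rule sum.swap)
  also have "\<dots> = (\<Sum>j\<in>UNIV. cps_of_mpoly (Var j ^ N) * (\<Sum>k\<in>UNIV. r k j * cps_of_mpoly (E (mp_deriv k F))))"
    by (simp only: sum_distrib_left)
  finally have q: "cps_of_mpoly q = (\<Sum>j\<in>UNIV. cps_of_mpoly (Var j ^ N) * (\<Sum>k\<in>UNIV. r k j * cps_of_mpoly (E (mp_deriv k F))))" .
  define z where "z j = Var (\<sigma> j) - Const (v $ \<sigma> j) * Var i0" for j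
  \<comment> \<open>\<open>\<theta>\<close> leads back from the chart by linear forms:
    \<open>z j\<close> is sent to \<open>Var j\<close> by \<open>E\<close>.\<close>
  define \<theta> where "\<theta> = mp_eval Const (\<chi> j. z j)"
  have \<theta>: "ring_morphism \<theta>" by (simp add: \<theta>_def)
  have \<theta>_Const: "\<theta> (Const b) = Const b" and \<theta>_Var: "\<theta> (Var j) = z j" for b j
    by (simp_all add: \<theta>_def)
  \<comment> \<open>Membership in a monomial ideal is visible on single coefficients, so it passes
    from power series to the polynomial \<open>q\<close>.\<close>
  have keys: "\<exists>j. Poly_Mapping.lookup e j \<ge> N" if "e \<in> Poly_Mapping.keys q" for e
  proof (rule ccontr)
    assume no: "\<nexists>j. Poly_Mapping.lookup e j \<ge> N"
    have "cps_coeff (cps_of_mpoly (Var j ^ N) * b) e = 0" for j b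
      unfolding Var_power
    proof (rule cps_coeff_single_mult(2), rule notI, elim exE)
      fix m' assume "e = Poly_Mapping.single j N + m'"
      then have "Poly_Mapping.lookup e j \<ge> N" by (simp add: lookup_add)
      then show False using no by blast
    qed
    then have "cps_coeff (cps_of_mpoly q) e = 0" unfolding q by simp
    then show False using that by (simp add: in_keys_iff)
  qed
  have "s * \<theta> (Poly_Mapping.single e b) \<in> J" if e: "e \<in> Poly_Mapping.keys q" for e b
  proof -
    obtain j where "Poly_Mapping.lookup e j \<ge> N"
      using keys[OF e] by blast
    from exponent_split[OF this] obtain e' where e': "e = Poly_Mapping.single j N + e'"
      by (elim exE)
    have "Poly_Mapping.single e b = Poly_Mapping.single e' b * Var j ^ N"
      by (simp add: e' Var_power mult_single add.commute)
    then have "s * \<theta> (Poly_Mapping.single e b) = \<theta> (Poly_Mapping.single e' b) * (s * z j ^ N)"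
      by (simp add: ring_morphism_simps[OF \<theta>] \<theta>_Var mult_ac)
    also have "\<dots> \<in> J"
      unfolding z_def by (rule is_ideal_mult[OF J_ideal sz])
    finally show ?thesis .
  qed
  then have "(\<Sum>e\<in>Poly_Mapping.keys q. s * \<theta> (Poly_Mapping.single e (Poly_Mapping.lookup q e))) \<in> J"
    by (rule is_ideal_sum[OF J_ideal])
  then have sq: "s * \<theta> q \<in> J"
    by (simp only: sum_distrib_left[symmetric] ring_morphism_sum[OF \<theta>, symmetric] mpoly_expand[symmetric])
  \<comment> \<open>Modulo \<open>Var i0 - 1\<close>, the composite of \<open>E\<close> and
    \<open>\<theta>\<close> is the identity; this replaces pulled back partial derivatives by the
    original ones.\<close>
  let ?M = "range (\<lambda>r. r * (Var i0 - 1 :: 'n mpoly))"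
  have M: "is_ideal ?M" by (rule is_ideal_multiples)
  have cong: "\<theta> (E b) - b \<in> ?M" for b
  proof (rule substitution_congruent[OF M])
    show "ring_morphism (\<lambda>b. \<theta> (E b))" by (rule ring_morphism_comp[OF \<theta> ring_morphism_E])
    show "\<theta> (E (Const b)) = Const b" for b by (simp add: E_Const \<theta>_Const)
    fix k
    show "\<theta> (E (Var k)) - Var k \<in> ?M"
    proof (cases k rule: \<sigma>_cases)
      case 1
      then show ?thesis
        by (auto simp: E_Var X_i0 ring_morphism_simps[OF \<theta>] intro!: range_eqI[of _ _ "-1"])
    next
      case (2 j)
      then show ?thesis
        by (auto simp: E_Var X_\<sigma> ring_morphism_simps[OF \<theta>] \<theta>_Const \<theta>_Var z_def algebra_simps
            intro!: range_eqI[of _ _ "- Const (v $ \<sigma> j)"])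
    qed
  qed
  have "\<theta> (E h) = \<theta> q + (\<Sum>k\<in>UNIV. \<theta> (t k) * \<theta> (E (mp_deriv k F)))"
    by (simp add: q_def ring_morphism_simps[OF \<theta>])
  moreover have "(\<Sum>k\<in>UNIV. \<theta> (t k) * \<theta> (E (mp_deriv k F)))
      = (\<Sum>k\<in>UNIV. \<theta> (t k) * mp_deriv k F) + (\<Sum>k\<in>UNIV. \<theta> (t k) * (\<theta> (E (mp_deriv k F)) - mp_deriv k F))"
    by (simp add: right_diff_distrib sum_subtractf)
  ultimately have "s * h - (s * \<theta> q + s * (\<Sum>k\<in>UNIV. \<theta> (t k) * mp_deriv k F))
     = s * (\<Sum>k\<in>UNIV. \<theta> (t k) * (\<theta> (E (mp_deriv k F)) - mp_deriv k F)) - s * (\<theta> (E h) - h)"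
    by (simp add: algebra_simps)
  also have "\<dots> \<in> ?M"
    by (intro is_ideal_diff[OF M] is_ideal_mult[OF M] is_ideal_sum[OF M] cong)
  finally obtain b where b: "s * h - (s * \<theta> q + s * (\<Sum>k\<in>UNIV. \<theta> (t k) * mp_deriv k F)) = b * (Var i0 - 1)"
    by blast
  have "s * h - b * (Var i0 - 1) = s * \<theta> q + s * (\<Sum>k\<in>UNIV. \<theta> (t k) * mp_deriv k F)"
    using b by (simp add: algebra_simps)
  also have "\<dots> \<in> J"
    by (intro is_ideal_add[OF J_ideal] sq is_ideal_mult[OF J_ideal] jacobian_idealI)
  \<comment> \<open>Homogenization with respect to \<open>Var i0\<close> in the role of
    \<open>l\<close>. The extra power is absorbed by the cofactor, as \<open>Var i0\<close> has
    value 1 at \<open>v\<close>.\<close>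
  finally obtain M where M: "Var i0 ^ M * (s * h) \<in> J"
    using homogenize_membership[OF J_ideal hcomp_jacobian[OF F(1)] homogeneous_Var homogeneous_mult[OF s(1) h]] by blast
  show thesis
  proof (rule that)
    show "homogeneous (M * 1 + a) (Var i0 ^ M * s)"
      by (intro homogeneous_mult homogeneous_power homogeneous_Var s)
    show "mp_eval id v (Var i0 ^ M * s) \<noteq> 0"
      using s(2) v by simp
    show "Var i0 ^ M * s * h \<in> J"
      using M by (simp add: mult.assoc)
  qed
qed

end

context saturated_jacobian
begin

lemma local_chart_exists:
  assumes "p \<in> sing_locus F" "local_equation F p (g :: 'm::finite mpoly)"
  obtains v i \<sigma> where "local_chart F l m v i \<sigma> g" "v \<noteq> 0" "abs_proj v = p"
proof -
  obtain i \<sigma> and v :: "complex ^ 'n" where *: "v $ i = 1" "abs_proj v = p" "bij_betw \<sigma> UNIV (- {i})"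
     "g = mp_eval Const (\<chi> l. Const (v $ l) + (\<Sum>j | \<sigma> j = l. Var j)) F"
    using assms(2) unfolding local_equation_def by blast
  have "v \<noteq> 0" using *(1) by auto
  moreover from this have "mp_eval id v (mp_deriv i F) = 0" for i
    using sing_locus_abs_proj[OF F, of v] assms(1) *(2) by blast
  then have "local_chart F l m v i \<sigma> g"
    using * by unfold_locales auto
  ultimately show thesis using that * by blast
qed

text \<open>If \<open>h\<close> were not in the ideal generated by \<open>J\<close> and
  \<open>l - 1\<close>, the multipliers that bring it there would form a proper ideal, with a common
  zero \<open>w\<close>. This \<open>w\<close> represents a singular point, yet the local cofactor
  \<open>s\<close> there is such a multiplier and does not vanish. Homogenizing and cancelling
  powers of \<open>l\<close> then gives \<open>h \<in> J\<close>.\<close>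

lemma membership_local_global:
  assumes h: "homogeneous n h"
    and local: "\<And>p. p \<in> sing_locus F \<Longrightarrow>
      \<exists>v s k. v \<noteq> 0 \<and> abs_proj v = p \<and> homogeneous k s \<and> mp_eval id v s \<noteq> 0 \<and> s * h \<in> J"
  shows "h \<in> J"
proof -
  let ?J1 = "{a + r * (l - 1) | a r. a \<in> J}"
  have J1: "is_ideal ?J1" by (rule is_ideal_adjoin[OF J_ideal])
  have sub: "J \<subseteq> ?J1" by (force intro: exI[of _ 0])
  have l1: "r * (l - 1) \<in> ?J1" for r
    using is_ideal_0[OF J_ideal] by force
  \<comment> \<open>The colon ideal of \<open>?J1\<close> by \<open>h\<close>.\<close>
  let ?W = "{a. a * h \<in> ?J1}"
  have W: "is_ideal ?W"
    unfolding is_ideal_def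
  proof (intro conjI ballI allI)
    show "0 \<in> ?W" using is_ideal_0[OF J1] by simp
    show "a + b \<in> ?W" if "a \<in> ?W" "b \<in> ?W" for a b
      using is_ideal_add[OF J1, of "a * h" "b * h"] that by (simp add: distrib_right)
    show "r * a \<in> ?W" if "a \<in> ?W" for r a
      using is_ideal_mult[OF J1, of "a * h" r] that by (simp add: mult.assoc)
  qed
  have JW: "?J1 \<subseteq> ?W"
    using is_ideal_mult_right[OF J1] by blast
  have "1 \<in> ?W"
  proof (rule ccontr)
    assume "1 \<notin> ?W"
    moreover have "\<exists>bs. (\<Prod>b\<leftarrow>bs. Var i - Const b) \<in> ?W" for i
    proof -
      obtain bs where bs: "(\<Prod>b\<leftarrow>bs. Var i - Const b * l) \<in> J"
        using integral by blast
      \<comment> \<open>Modulo \<open>l - 1\<close> the homogeneous integral equations become the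
        split monic polynomials demanded by \<open>nullstellensatz_monic\<close>.\<close>
      have "(\<Prod>b\<leftarrow>xs. Var i - Const b) - (\<Prod>b\<leftarrow>xs. Var i - Const b * l) \<in> ?J1" for xs
      proof (induction xs)
        case Nil
        then show ?case using is_ideal_0[OF J1] by simp
      next
        case (Cons b xs)
        let ?P = "(\<Prod>b\<leftarrow>xs. Var i - Const b)" and ?Q = "(\<Prod>b\<leftarrow>xs. Var i - Const b * l)"
        have eq: "(\<Prod>b\<leftarrow>b # xs. Var i - Const b) - (\<Prod>b\<leftarrow>b # xs. Var i - Const b * l)
          = (Var i - Const b) * (?P - ?Q) + (Const b * ?Q) * (l - 1)"
          by (simp add: algebra_simps)
        show ?case
          unfolding eq by (intro is_ideal_add[OF J1] is_ideal_mult[OF J1 Cons.IH] l1)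
      qed
      from is_ideal_add[OF J1 this[of bs] subsetD[OF sub bs]]
      have "(\<Prod>b\<leftarrow>bs. Var i - Const b) \<in> ?J1"
        by (simp only: diff_add_cancel)
      then show ?thesis using JW by blast
    qed
    ultimately obtain w where w: "\<And>a. a \<in> ?W \<Longrightarrow> mp_eval id w a = 0"
      using nullstellensatz_monic[OF W] by blast
    have "l - 1 \<in> ?J1" using l1[of 1] by simp
    then have "mp_eval id w (l - 1) = 0"
      by (intro w subsetD[OF JW])
    then have "mp_eval id w l = 1" by simp
    then have "w \<noteq> 0"
      using mp_eval_scale[OF l, of 0 w] by auto
    have "mp_eval id w (mp_deriv i F) = 0" for i
      using w[of "mp_deriv i F"] mp_deriv_in_jacobian[of i F] sub JW by blast
    then have "abs_proj w \<in> sing_locus F"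
      using sing_locus_abs_proj[OF F \<open>w \<noteq> 0\<close>] by blast
    then obtain v s k where vs: "v \<noteq> 0" "abs_proj v = abs_proj w" "homogeneous k s" "mp_eval id v s \<noteq> 0" "s * h \<in> J"
      using local by blast
    then have "s \<in> ?W" using sub by blast
    then have "mp_eval id w s = 0" by (rule w)
    moreover obtain c where "v = c *s w"
      using abs_proj_eq_iff[OF \<open>w \<noteq> 0\<close> vs(1)] vs(2) by auto
    ultimately show False
      using mp_eval_scale[OF vs(3), of c w] vs(4) by simp
  qed
  then obtain a r where "h = a + r * (l - 1)" "a \<in> J" by auto
  then have "h - r * (l - 1) \<in> J" by simp
  then obtain M where "l ^ M * h \<in> J"
    using homogenize_membership[OF J_ideal hcomp_jacobian[OF F(1)] l h] by blast
  then show ?thesis by (rule l_power_cancel)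
qed

text \<open>With more forms than local basis elements, some nontrivial combination has all its local
  coordinates equal to 0. It lies in every Tjurina ideal, hence in \<open>J\<close>, against
  independence.\<close>

theorem sum_quotient_dim_ge:
  fixes h :: "'t \<Rightarrow> 'n mpoly" and g :: "'n proj \<Rightarrow> 'm::finite mpoly"
  assumes g: "\<And>p. p \<in> sing_locus F \<Longrightarrow> local_equation F p (g p)"
    and A: "finite A" and hom: "\<And>t. t \<in> A \<Longrightarrow> homogeneous n (h t)"
    and indep: "\<And>x. (\<Sum>t\<in>A. Const (x t) * h t) \<in> J \<Longrightarrow> \<forall>t\<in>A. x t = 0"
  shows "card A \<le> (\<Sum>p\<in>sing_locus F. quotient_dim (tjurina_ideal (g p)))"
proof (rule ccontr)
  assume less: "\<not> ?thesis"
  have "\<forall>p. \<exists>v i \<sigma>. p \<in> sing_locus F \<longrightarrow> local_chart F l m v i \<sigma> (g p) \<and> v \<noteq> 0 \<and> abs_proj v = p"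
    using local_chart_exists g by blast
  then have "\<exists>v i \<sigma>. \<forall>p. p \<in> sing_locus F \<longrightarrow>
      local_chart F l m (v p) (i p) (\<sigma> p) (g p) \<and> v p \<noteq> 0 \<and> abs_proj (v p) = p"
    unfolding choice_iff .
  then obtain v i \<sigma> where chart: "\<And>p. p \<in> sing_locus F \<Longrightarrow> local_chart F l m (v p) (i p) (\<sigma> p) (g p)"
    and v: "\<And>p. p \<in> sing_locus F \<Longrightarrow> v p \<noteq> 0 \<and> abs_proj (v p) = p"
    by blast
  \<comment> \<open>The same choice as in the definition of \<open>quotient_dim\<close>, whose value
    is thus the cardinality of this very basis.\<close>
  define B where "B p = (SOME B. basis_mod (tjurina_ideal (g p)) B)" for p
  have ex: "\<exists>B. basis_mod (tjurina_ideal (g p)) B" if "p \<in> sing_locus F" for p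
    using local_chart.basis_mod_T[OF chart[OF that]] by blast
  have B: "basis_mod (tjurina_ideal (g p)) (B p)" if "p \<in> sing_locus F" for p
    unfolding B_def by (rule someI_ex[OF ex[OF that]])
  have card_B: "quotient_dim (tjurina_ideal (g p)) = card (B p)" if "p \<in> sing_locus F" for p
    using ex[OF that] by (simp add: quotient_dim_def B_def)
  have fin_B: "finite (B p)" if "p \<in> sing_locus F" for p
    using B[OF that] by (simp add: basis_mod_def)
  define E where "E p = local_chart.E (v p) (\<sigma> p)" for p
  have "\<forall>p t. \<exists>c. p \<in> sing_locus F \<longrightarrow>
      cps_of_mpoly (E p (h t)) - (\<Sum>b\<in>B p. cps_const (c b) * b) \<in> tjurina_ideal (g p)"
    using B by (simp add: basis_mod_def)
  then have "\<exists>c. \<forall>p t. p \<in> sing_locus F \<longrightarrow>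
      cps_of_mpoly (E p (h t)) - (\<Sum>b\<in>B p. cps_const (c p t b) * b) \<in> tjurina_ideal (g p)"
    unfolding choice_iff .
  then obtain c where c: "\<And>p t. p \<in> sing_locus F \<Longrightarrow>
      cps_of_mpoly (E p (h t)) - (\<Sum>b\<in>B p. cps_const (c p t b) * b) \<in> tjurina_ideal (g p)"
    by blast
  let ?E = "SIGMA p:sing_locus F. B p"
  have "card ?E = (\<Sum>p\<in>sing_locus F. card (B p))"
    using finite_sing_locus fin_B by (intro card_SigmaI) auto
  then have "card A > card ?E"
    using less card_B by simp
  moreover have "finite ?E"
    using finite_sing_locus fin_B by (intro finite_SigmaI) auto
  ultimately obtain x where x: "\<exists>t\<in>A. x t \<noteq> 0"
    "\<And>e. e \<in> ?E \<Longrightarrow> (\<Sum>t\<in>A. x t * c (fst e) t (snd e)) = 0"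
    using underdetermined_system[of ?E A "\<lambda>e t. c (fst e) t (snd e)"] A by blast
  define H where "H = (\<Sum>t\<in>A. Const (x t) * h t)"
  have "H \<in> J"
  proof (rule membership_local_global)
    show H: "homogeneous n H"
      unfolding H_def by (intro homogeneous_sum homogeneous_Const_mult hom)
    fix p assume p: "p \<in> sing_locus F"
    interpret ch: local_chart F l m "v p" "i p" "\<sigma> p" "g p"
      by (rule chart[OF p])
    have sum0: "(\<Sum>t\<in>A. cps_const (x t) * (\<Sum>b\<in>B p. cps_const (c p t b) * b)) = 0"
    proof -
      have "(\<Sum>t\<in>A. cps_const (x t) * (\<Sum>b\<in>B p. cps_const (c p t b) * b))
        = (\<Sum>t\<in>A. \<Sum>b\<in>B p. cps_const (x t * c p t b) * b)"
        by (simp only: sum_distrib_left cps_const_simps mult.assoc)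
      also have "\<dots> = (\<Sum>b\<in>B p. \<Sum>t\<in>A. cps_const (x t * c p t b) * b)"
        by (rule sum.swap)
      also have "\<dots> = (\<Sum>b\<in>B p. cps_const (\<Sum>t\<in>A. x t * c p t b) * b)"
        by (simp only: sum_distrib_right cps_const_simps)
      also have "\<dots> = (\<Sum>b\<in>B p. cps_const 0 * b)"
        using x(2) p by (intro sum.cong refl) force
      finally show ?thesis by (simp add: cps_const_simps)
    qed
    have "cps_of_mpoly (E p H) = (\<Sum>t\<in>A. cps_const (x t) * cps_of_mpoly (E p (h t)))"
      unfolding H_def E_def
      by (simp add: ring_morphism_simps[OF ch.ring_morphism_E] cps_of_mpoly_simps ch.E_Const)
    also have "\<dots> = (\<Sum>t\<in>A. cps_const (x t) * (cps_of_mpoly (E p (h t)) - (\<Sum>b\<in>B p. cps_const (c p t b) * b)))"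
      using sum0 by (simp add: right_diff_distrib sum_subtractf)
    also have "\<dots> \<in> tjurina_ideal (g p)"
      by (intro is_ideal_sum[OF ch.T_ideal] is_ideal_mult[OF ch.T_ideal] c p)
    finally obtain s k where "homogeneous k s" "mp_eval id (v p) s \<noteq> 0" "s * H \<in> J"
      using ch.local_membership[OF H] unfolding E_def by blast
    then show "\<exists>v s k. v \<noteq> 0 \<and> abs_proj v = p \<and> homogeneous k s \<and> mp_eval id v s \<noteq> 0 \<and> s * H \<in> J"
      using v[OF p] by blast
  qed
  then show False
    using indep[of x] x(1) unfolding H_def by blast
qed

end

section \<open>Adding a variable\<close>

locale new_variable =
  fixes \<kappa> :: "'n::finite \<Rightarrow> 'm::finite" and z :: 'm
  assumes \<kappa>: "bij_betw \<kappa> UNIV (- {z})"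
begin

lemma inj_\<kappa>: "\<kappa> i = \<kappa> j \<longleftrightarrow> i = j"
  using \<kappa> by (auto simp: bij_betw_def inj_def)

lemma \<kappa>_neq_z [simp]: "\<kappa> i \<noteq> z" "z \<noteq> \<kappa> i"
  using \<kappa> by (auto simp: bij_betw_def)

lemma variable_cases: obtains "k = z" | i where "k = \<kappa> i"
  using \<kappa> by (cases "k = z") (auto simp: bij_betw_def)

lemma sum_variables: "(\<Sum>k\<in>UNIV. f k) = f z + (\<Sum>i\<in>UNIV. f (\<kappa> i))"
proof -
  have "(\<Sum>k\<in>UNIV. f k) = f z + (\<Sum>k\<in>-{z}. f k)"
    by (subst sum.remove[of UNIV z]) (auto simp: Compl_eq_Diff_UNIV)
  also have "(\<Sum>k\<in>-{z}. f k) = (\<Sum>i\<in>UNIV. f (\<kappa> i))"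
    by (rule sum.reindex_bij_betw[OF \<kappa>, symmetric])
  finally show ?thesis .
qed

definition \<iota> :: "'n mpoly \<Rightarrow> 'm mpoly" where
  "\<iota> = mp_eval Const (\<chi> i. Var (\<kappa> i))"

lemma ring_morphism_\<iota>: "ring_morphism \<iota>"
  by (simp add: \<iota>_def)

lemmas \<iota>_simps = ring_morphism_simps[OF ring_morphism_\<iota>]

lemma \<iota>_Const: "\<iota> (Const c) = Const c" and \<iota>_Var: "\<iota> (Var i) = Var (\<kappa> i)"
  by (simp_all add: \<iota>_def)

lemma homogeneous_\<iota>: "homogeneous n p \<Longrightarrow> homogeneous n (\<iota> p)"
proof (induction rule: homogeneous_induct)
  case (Var i n p)
  then show ?case
    using homogeneous_Var_mult[of n "\<iota> p" "\<kappa> i"] by (simp add: \<iota>_simps \<iota>_Var)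
qed (simp_all add: \<iota>_simps \<iota>_Const homogeneous_add)

lemma mp_deriv_\<iota>: "mp_deriv (\<kappa> i) (\<iota> p) = \<iota> (mp_deriv i p)"
  by (induction p rule: mpoly_induct)
     (simp_all add: \<iota>_simps \<iota>_Const \<iota>_Var mp_deriv_add mp_deriv_Var_mult inj_\<kappa>)

lemma mp_deriv_z_\<iota>: "mp_deriv z (\<iota> p) = 0"
  by (induction p rule: mpoly_induct)
     (simp_all add: \<iota>_simps \<iota>_Const \<iota>_Var mp_deriv_add mp_deriv_Var_mult)

definition down :: "('m \<Rightarrow>\<^sub>0 nat) \<Rightarrow> ('n \<Rightarrow>\<^sub>0 nat)" where
  "down m = (\<Sum>i\<in>UNIV. Poly_Mapping.single i (Poly_Mapping.lookup m (\<kappa> i)))"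

lemma lookup_down: "Poly_Mapping.lookup (down m) i = Poly_Mapping.lookup m (\<kappa> i)"
  by (simp add: down_def lookup_sum lookup_single when_def)

text \<open>The coefficient of \<open>Var z ^ j\<close> when polynomials are read as polynomials in
  \<open>Var z\<close> over the ring in the old variables.\<close>

definition coef :: "nat \<Rightarrow> 'm mpoly \<Rightarrow> 'n mpoly" where
  "coef j p = (\<Sum>m\<in>Poly_Mapping.keys p.
     if Poly_Mapping.lookup m z = j then Poly_Mapping.single (down m) (Poly_Mapping.lookup p m) else 0)"

lemma coef_superset:
  assumes "finite A" "Poly_Mapping.keys p \<subseteq> A"
  shows "coef j p = (\<Sum>m\<in>A.
     if Poly_Mapping.lookup m z = j then Poly_Mapping.single (down m) (Poly_Mapping.lookup p m) else 0)"
  unfolding coef_def by (rule sum.mono_neutral_left) (use assms in \<open>auto simp: in_keys_iff\<close>)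

lemma coef_add: "coef j (p + q) = coef j p + coef j q"
proof -
  let ?A = "Poly_Mapping.keys p \<union> Poly_Mapping.keys q"
  have "Poly_Mapping.keys (p + q) \<subseteq> ?A" by (rule keys_add)
  then have "coef j (p + q) = (\<Sum>m\<in>?A. (if Poly_Mapping.lookup m z = j then Poly_Mapping.single (down m) (Poly_Mapping.lookup p m) else 0)
     + (if Poly_Mapping.lookup m z = j then Poly_Mapping.single (down m) (Poly_Mapping.lookup q m) else 0))"
    by (subst coef_superset[of ?A]) (auto intro!: sum.cong simp: lookup_add single_add)
  then show ?thesis
    using coef_superset[of ?A p] coef_superset[of ?A q] by (simp add: sum.distrib)
qed

lemma coef_0 [simp]: "coef j 0 = 0"
  by (simp add: coef_def)

lemma coef_sum: "coef j (\<Sum>x\<in>A. f x) = (\<Sum>x\<in>A. coef j (f x))"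
  by (induction A rule: infinite_finite_induct) (simp_all add: coef_add)

lemma coef_single: "coef j (Poly_Mapping.single m c) =
    (if Poly_Mapping.lookup m z = j then Poly_Mapping.single (down m) c else 0)"
  using coef_superset[of "{m}" "Poly_Mapping.single m c" j] by (simp split: if_splits)

text \<open>Both sides are additive in \<open>p\<close>. Two indices \<open>j\<close> and
  \<open>j'\<close> are allowed so that the shift caused by \<open>Var z\<close> is covered as
  well.\<close>

lemma coef_linear_ext:
  assumes "\<And>m c. coef j (a * Poly_Mapping.single m c) = b * coef j' (Poly_Mapping.single m c)"
  shows "coef j (a * p) = b * coef j' p"
proof -
  let ?f = "\<lambda>m. Poly_Mapping.single m (Poly_Mapping.lookup p m)"
  have "coef j (a * (\<Sum>m\<in>Poly_Mapping.keys p. ?f m)) = b * coef j' (\<Sum>m\<in>Poly_Mapping.keys p. ?f m)"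
    by (simp only: sum_distrib_left coef_sum assms)
  then show ?thesis
    by (simp only: mpoly_expand[symmetric])
qed

lemma coef_Const_mult: "coef j (Const a * p) = Const a * coef j p"
  by (rule coef_linear_ext) (simp add: Const_mult_single coef_single)

lemma down_add: "down (m + m') = down m + down m'"
  by (rule poly_mapping_eqI) (simp add: lookup_down lookup_add)

lemma down_single_\<kappa>: "down (Poly_Mapping.single (\<kappa> i) k) = Poly_Mapping.single i k"
  by (rule poly_mapping_eqI) (simp add: lookup_down lookup_single when_def inj_\<kappa>)

lemma down_single_z: "down (Poly_Mapping.single z k) = 0"
  by (rule poly_mapping_eqI) (simp add: lookup_down lookup_single when_def)

lemma coef_Var_\<kappa>_mult: "coef j (Var (\<kappa> i) * p) = Var i * coef j p"
  by (rule coef_linear_ext)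
     (simp add: Var_mult_single coef_single lookup_add lookup_single when_def down_add down_single_\<kappa>)

lemma coef_Var_z_mult: "coef 0 (Var z * p) = 0" "coef (Suc j) (Var z * p) = coef j p"
proof -
  have "coef 0 (Var z * p) = 0 * coef 0 p"
    by (rule coef_linear_ext) (simp add: Var_mult_single coef_single lookup_add)
  then show "coef 0 (Var z * p) = 0" by simp
  have "coef (Suc j) (Var z * p) = 1 * coef j p"
    by (rule coef_linear_ext) (simp add: Var_mult_single coef_single lookup_add down_add down_single_z)
  then show "coef (Suc j) (Var z * p) = coef j p" by simp
qed

lemma coef_\<iota>_mult: "coef j (\<iota> a * p) = a * coef j p"
  by (induction a rule: mpoly_induct)
     (simp_all add: \<iota>_simps \<iota>_Const \<iota>_Var coef_Const_mult coef_Var_\<kappa>_mult mult.assoc distrib_right coef_add)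

lemma coef_power_z_mult: "coef j (Var z ^ k * p) = (if k \<le> j then coef (j - k) p else 0)"
proof (induction k arbitrary: j)
  case (Suc k)
  then show ?case
    by (cases j) (simp_all add: mult.assoc coef_Var_z_mult)
qed simp

lemma coef_1: "coef j 1 = (if j = 0 then 1 else 0)"
  using coef_single[of j 0 1] by (simp add: down_def)

lemma coef_expansion: "\<exists>N. \<forall>n\<ge>N. p = (\<Sum>j<n. Var z ^ j * \<iota> (coef j p))"
proof (induction p rule: mpoly_induct)
  case (Const c)
  have coef: "coef j (Const c) = (if j = 0 then Const c else 0)" for j
    using coef_Const_mult[of j c 1] by (simp add: coef_1)
  have "Const c = (\<Sum>j<n. Var z ^ j * \<iota> (coef j (Const c)))" if "n \<ge> 1" for n
  proof -
    obtain n' where "n = Suc n'" using \<open>n \<ge> 1\<close> by (cases n) auto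
    then show ?thesis
      by (simp add: coef sum.lessThan_Suc_shift \<iota>_Const \<iota>_simps del: sum.lessThan_Suc)
  qed
  then show ?case by blast
next
  case (Var k p)
  then obtain N where N: "\<forall>n\<ge>N. p = (\<Sum>j<n. Var z ^ j * \<iota> (coef j p))" by blast
  show ?case
  proof (cases k rule: variable_cases)
    case 1
    have "Var k * p = (\<Sum>j<n. Var z ^ j * \<iota> (coef j (Var k * p)))" if "n \<ge> Suc N" for n
    proof -
      obtain n' where n': "n = Suc n'" "n' \<ge> N" using \<open>n \<ge> Suc N\<close> by (cases n) auto
      have "(\<Sum>j<n. Var z ^ j * \<iota> (coef j (Var k * p))) = Var z * (\<Sum>j<n'. Var z ^ j * \<iota> (coef j p))"
        unfolding n'(1) sum.lessThan_Suc_shift sum_distrib_left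
        by (simp add: 1 coef_Var_z_mult \<iota>_simps mult.assoc)
      also have "(\<Sum>j<n'. Var z ^ j * \<iota> (coef j p)) = p"
        using N n'(2) by (simp only:)
      finally show ?thesis using 1 by simp
    qed
    then show ?thesis by blast
  next
    case (2 i)
    have "Var k * p = (\<Sum>j<n. Var z ^ j * \<iota> (coef j (Var k * p)))" if "n \<ge> N" for n
    proof -
      have "(\<Sum>j<n. Var z ^ j * \<iota> (coef j (Var k * p))) = Var k * (\<Sum>j<n. Var z ^ j * \<iota> (coef j p))"
        unfolding sum_distrib_left
        by (simp add: 2 coef_Var_\<kappa>_mult \<iota>_simps \<iota>_Var mult.left_commute)
      also have "(\<Sum>j<n. Var z ^ j * \<iota> (coef j p)) = p"
        using N \<open>n \<ge> N\<close> by (simp only:)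
      finally show ?thesis by simp
    qed
    then show ?thesis by blast
  qed
next
  case (add p q)
  then obtain N N' where N: "\<forall>n\<ge>N. p = (\<Sum>j<n. Var z ^ j * \<iota> (coef j p))"
    "\<forall>n\<ge>N'. q = (\<Sum>j<n. Var z ^ j * \<iota> (coef j q))" by blast
  have "p + q = (\<Sum>j<n. Var z ^ j * \<iota> (coef j (p + q)))" if "n \<ge> max N N'" for n
  proof -
    have "(\<Sum>j<n. Var z ^ j * \<iota> (coef j (p + q)))
       = (\<Sum>j<n. Var z ^ j * \<iota> (coef j p)) + (\<Sum>j<n. Var z ^ j * \<iota> (coef j q))"
      by (simp add: coef_add \<iota>_simps distrib_left sum.distrib)
    also have "(\<Sum>j<n. Var z ^ j * \<iota> (coef j p)) = p"
      using N(1) that by (simp only: max.bounded_iff)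
    also have "(\<Sum>j<n. Var z ^ j * \<iota> (coef j q)) = q"
      using N(2) that by (simp only: max.bounded_iff)
    finally show ?thesis by simp
  qed
  then show ?case by blast
qed

context
  fixes f :: "'n mpoly" and F :: "'m mpoly" and m :: nat
  assumes F: "F = \<iota> f + Var z ^ m" and m: "m > 0"
begin

lemma mp_deriv_suspension:
  "mp_deriv (\<kappa> i) F = \<iota> (mp_deriv i f)" "mp_deriv z F = of_nat m * Var z ^ (m - 1)"
  by (simp_all add: F mp_deriv_add mp_deriv_\<iota> mp_deriv_z_\<iota> mp_deriv_power mp_deriv_Var)

text \<open>The derivative by \<open>z\<close> is a multiple of \<open>Var z ^ (m - 1)\<close> and
  does not reach coefficient \<open>j < m - 1\<close>; the other derivatives are free of
  \<open>z\<close> and pass through \<open>coef j\<close>.\<close>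

lemma coef_jacobian:
  assumes "h \<in> jacobian_ideal F" "j < m - 1"
  shows "coef j h \<in> jacobian_ideal f"
proof -
  obtain a where a: "h = (\<Sum>k\<in>UNIV. a k * mp_deriv k F)"
    using assms(1) by (auto simp: jacobian_ideal_def)
  have "h = Var z ^ (m - 1) * (of_nat m * a z) + (\<Sum>i\<in>UNIV. \<iota> (mp_deriv i f) * a (\<kappa> i))"
    unfolding a sum_variables mp_deriv_suspension by (simp add: mult_ac)
  then have "coef j h = (\<Sum>i\<in>UNIV. mp_deriv i f * coef j (a (\<kappa> i)))"
    using assms(2) by (simp add: coef_add coef_sum coef_power_z_mult coef_\<iota>_mult)
  also have "\<dots> = (\<Sum>i\<in>UNIV. coef j (a (\<kappa> i)) * mp_deriv i f)"
    by (intro sum.cong refl mult.commute)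
  finally have "coef j h = (\<Sum>i\<in>UNIV. coef j (a (\<kappa> i)) * mp_deriv i f)" .
  then show ?thesis
    by (simp only: jacobian_idealI)
qed

lemma \<iota>_jacobian:
  assumes "a \<in> jacobian_ideal f"
  shows "\<iota> a \<in> jacobian_ideal F"
proof -
  obtain u where u: "a = (\<Sum>i\<in>UNIV. u i * mp_deriv i f)"
    using assms by (auto simp: jacobian_ideal_def)
  have eq: "\<iota> a = (\<Sum>i\<in>UNIV. \<iota> (u i) * mp_deriv (\<kappa> i) F)"
    by (simp add: u \<iota>_simps mp_deriv_suspension)
  show ?thesis
    unfolding eq by (intro is_ideal_sum[OF is_ideal_jacobian] is_ideal_mult[OF is_ideal_jacobian] mp_deriv_in_jacobian)
qed

lemma power_z_jacobian: "Var z ^ (m - 1) \<in> jacobian_ideal F"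
proof -
  have "Const (inverse (of_nat m)) * mp_deriv z F \<in> jacobian_ideal F"
    by (intro is_ideal_mult[OF is_ideal_jacobian] mp_deriv_in_jacobian)
  also have "Const (inverse (of_nat m)) * mp_deriv z F
      = (Const (inverse (of_nat m)) * Const (of_nat m)) * Var z ^ (m - 1)"
    by (simp add: mp_deriv_suspension Const_of_nat mult.assoc)
  also have "\<dots> = Var z ^ (m - 1)"
    using m by (simp flip: Const_mult)
  finally show ?thesis .
qed

text \<open>Terms from \<open>Var z ^ (m - 1)\<close> on lie in the ideal anyway. With
  \<open>coef_jacobian\<close>, membership is decided by the coefficients below
  \<open>m - 1\<close>, each modulo the Jacobian ideal of \<open>f\<close>.\<close>

lemma jacobian_coefI:
  assumes "\<And>j. j < m - 1 \<Longrightarrow> coef j h \<in> jacobian_ideal f"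
  shows "h \<in> jacobian_ideal F"
proof -
  obtain N where N: "\<forall>n\<ge>N. h = (\<Sum>j<n. Var z ^ j * \<iota> (coef j h))"
    using coef_expansion by blast
  have "Var z ^ j * \<iota> (coef j h) \<in> jacobian_ideal F" for j
  proof (cases "j < m - 1")
    case True
    then show ?thesis
      by (intro is_ideal_mult[OF is_ideal_jacobian] \<iota>_jacobian assms)
  next
    case False
    then have le: "m - 1 \<le> j" by simp
    have eq: "Var z ^ j * \<iota> (coef j h) = (\<iota> (coef j h) * Var z ^ (j - (m - 1))) * Var z ^ (m - 1)"
      using power_add[of "Var z :: 'm mpoly" "m - 1" "j - (m - 1)"]
      unfolding le_add_diff_inverse[OF le] by (simp only: mult_ac)
    show ?thesis
      unfolding eq by (intro is_ideal_mult[OF is_ideal_jacobian] power_z_jacobian)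
  qed
  then have "(\<Sum>j<N. Var z ^ j * \<iota> (coef j h)) \<in> jacobian_ideal F"
    by (rule is_ideal_sum[OF is_ideal_jacobian])
  moreover have "h = (\<Sum>j<N. Var z ^ j * \<iota> (coef j h))"
    using N by blast
  ultimately show ?thesis by (simp only:)
qed

text \<open>The family \<open>h j\<close> varies with \<open>j\<close> because the forms attached to
  \<open>Var z ^ j\<close> must have complementary degree for the products to share one
  degree.\<close>

lemma suspension_independent:
  assumes indep: "\<And>j x. j < m - 1 \<Longrightarrow> (\<Sum>t\<in>B. Const (x t) * h j t) \<in> jacobian_ideal f \<Longrightarrow> \<forall>t\<in>B. x t = 0"
    and mem: "(\<Sum>(j, t)\<in>{..<m - 1} \<times> B. Const (y (j, t)) * (Var z ^ j * \<iota> (h j t))) \<in> jacobian_ideal F"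
  shows "\<forall>e\<in>{..<m - 1} \<times> B. y e = 0"
proof -
  have c1: "coef j (\<iota> a) = (if j = 0 then a else 0)" for j a
    using coef_\<iota>_mult[of j a 1] by (simp add: coef_1)
  have "\<forall>t\<in>B. y (j, t) = 0" if j: "j < m - 1" for j
  proof -
    have "coef j (\<Sum>(j, t)\<in>{..<m - 1} \<times> B. Const (y (j, t)) * (Var z ^ j * \<iota> (h j t)))
       = (\<Sum>i<m - 1. \<Sum>t\<in>B. coef j (Const (y (i, t)) * (Var z ^ i * \<iota> (h i t))))"
      by (simp add: sum.cartesian_product[symmetric] coef_sum)
    also have "\<dots> = (\<Sum>i<m - 1. if i = j then (\<Sum>t\<in>B. Const (y (i, t)) * h i t) else 0)"
      by (intro sum.cong refl) (auto simp: coef_Const_mult coef_power_z_mult c1 cong: if_cong)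
    also have "\<dots> = (\<Sum>t\<in>B. Const (y (j, t)) * h j t)"
      using j by simp
    finally have "(\<Sum>t\<in>B. Const (y (j, t)) * h j t) \<in> jacobian_ideal f"
      using coef_jacobian[OF mem j] by simp
    then show ?thesis by (rule indep[OF j])
  qed
  then show ?thesis by auto
qed

lemma saturated_jacobian_suspension:
  assumes "saturated_jacobian f l m"
  shows "saturated_jacobian F (\<iota> l) m"
proof -
  interpret f: saturated_jacobian f l m by (rule assms)
  show ?thesis
  proof
    have "homogeneous (m * 1) (Var z ^ m :: 'm mpoly)"
      by (intro homogeneous_power homogeneous_Var)
    then show "homogeneous m F"
      unfolding F by (intro homogeneous_add homogeneous_\<iota> f.F(1)) simp
    show "m > 0" by (rule m)
    show "homogeneous 1 (\<iota> l)"
      by (intro homogeneous_\<iota> f.l)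
    show "\<exists>bs. (\<Prod>b\<leftarrow>bs. Var k - Const b * \<iota> l) \<in> jacobian_ideal F" for k
    proof (cases k rule: variable_cases)
      case 1
      \<comment> \<open>The new coordinate is nilpotent modulo the ideal: its integral equation has
        the root 0 with multiplicity \<open>m - 1\<close>.\<close>
      have "(\<Prod>b\<leftarrow>replicate (m - 1) 0. Var z - Const b * \<iota> l) = Var z ^ (m - 1)"
        by (induction "m - 1") (simp_all add: map_replicate prod_list_replicate)
      then show ?thesis
        unfolding 1 using power_z_jacobian by (intro exI[of _ "replicate (m - 1) 0"]) (simp only:)
    next
      case (2 i)
      obtain bs where "(\<Prod>b\<leftarrow>bs. Var i - Const b * l) \<in> jacobian_ideal f"
        using f.integral by blast
      from \<iota>_jacobian[OF this] show ?thesis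
        unfolding 2 by (intro exI[of _ bs]) (simp add: \<iota>_simps \<iota>_Var \<iota>_Const)
    qed
    show "h \<in> jacobian_ideal F" if "\<iota> l * h \<in> jacobian_ideal F" for h
    proof (rule jacobian_coefI)
      fix j assume "j < m - 1"
      from coef_jacobian[OF that this] show "coef j h \<in> jacobian_ideal f"
        unfolding coef_\<iota>_mult by (rule f.nonzerodivisor)
    qed
  qed
qed

end

end

section \<open>Dimensions\<close>

text \<open>Independence is stated for the indexed family and so includes injectivity of
  \<open>f\<close>: two equal members would satisfy the relation with coefficients 1 and -1.\<close>

lemma (in vector_space) dim_family:
  assumes "finite A" and sub: "\<And>a. a \<in> A \<Longrightarrow> f a \<in> U"
    and indep: "\<And>x. (\<Sum>a\<in>A. scale (x a) (f a)) = 0 \<Longrightarrow> \<forall>a\<in>A. x a = 0"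
    and span: "\<And>u. u \<in> U \<Longrightarrow> \<exists>x. u = (\<Sum>a\<in>A. scale (x a) (f a))"
  shows "dim U = card A"
proof -
  have inj: "inj_on f A"
  proof (rule inj_onI, rule ccontr)
    fix a b assume ab: "a \<in> A" "b \<in> A" "f a = f b" "a \<noteq> b"
    let ?x = "\<lambda>c. if c = a then 1 else if c = b then - 1 else (0 :: 'a)"
    have "(\<Sum>c\<in>A. scale (?x c) (f c)) = (\<Sum>c\<in>{a, b}. scale (?x c) (f c))"
      using assms(1) ab by (intro sum.mono_neutral_right) auto
    also have "\<dots> = 0"
      using ab by simp
    finally have "\<forall>c\<in>A. ?x c = 0"
      by (rule indep)
    then have "?x a = 0" using ab(1) by blast
    then show False by simp
  qed
  have "independent (f ` A)"
  proof (rule independent_if_scalars_zero)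
    fix x u assume *: "(\<Sum>v\<in>f ` A. scale (x v) v) = 0" "u \<in> f ` A"
    then have "(\<Sum>a\<in>A. scale (x (f a)) (f a)) = 0"
      by (simp add: sum.reindex[OF inj])
    then have "\<forall>a\<in>A. x (f a) = 0" by (rule indep)
    then show "x u = 0" using *(2) by auto
  qed (use assms(1) in auto)
  moreover have "U \<subseteq> span (f ` A)"
  proof
    fix u assume "u \<in> U"
    then obtain x where "u = (\<Sum>a\<in>A. scale (x a) (f a))" using span by blast
    then show "u \<in> span (f ` A)" by (simp add: span_sum span_scale span_base)
  qed
  moreover have "f ` A \<subseteq> U" using sub by blast
  ultimately have "card (f ` A) = dim U" by (intro basis_card_eq_dim)
  then show ?thesis by (simp add: card_image[OF inj])
qed

text \<open>A basis of \<open>J\<close> is extended to one of \<open>S\<close>, and \<open>T\<close>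
  consists of the added vectors: it is a basis of \<open>S\<close> modulo \<open>J\<close>, given by
  representatives.\<close>

lemma (in vector_space) complement_basis:
  assumes J: "subspace J" and "J \<subseteq> S" and "S \<subseteq> span A" "finite A"
  obtains T where "finite T" "T \<subseteq> S" "card T + dim J = dim S"
    "\<And>x. (\<Sum>t\<in>T. scale (x t) t) \<in> J \<Longrightarrow> \<forall>t\<in>T. x t = 0"
    "\<And>u. u \<in> S \<Longrightarrow> \<exists>x. u - (\<Sum>t\<in>T. scale (x t) t) \<in> J"
proof -
  obtain B where B: "B \<subseteq> J" "independent B" "J \<subseteq> span B" "card B = dim J"
    by (rule basis_exists[of J]) blast
  obtain C where C: "B \<subseteq> C" "C \<subseteq> S" "independent C" "S \<subseteq> span C"
    by (rule maximal_independent_subset_extend[of B S]) (use B assms(2) in blast)+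
  have fin: "finite C"
    using independent_span_bound[OF assms(4) C(3)] C(2) assms(3) by blast
  then have finB: "finite B" using C(1) finite_subset by blast
  have dimS: "card C = dim S"
    by (rule basis_card_eq_dim[OF C(2,4,3)])
  have split: "(\<Sum>v\<in>C. g v) = (\<Sum>v\<in>C - B. g v) + (\<Sum>v\<in>B. g v)" for g :: "'b \<Rightarrow> 'b"
    by (rule sum.subset_diff[OF C(1) fin])
  show thesis
  proof (rule that)
    show "finite (C - B)" "C - B \<subseteq> S" using fin C(2) by auto
    show "card (C - B) + dim J = dim S"
      using card_Diff_subset[OF finB C(1)] card_mono[OF fin C(1)] B(4) dimS by simp
    show "\<forall>t\<in>C - B. x t = 0" if mem: "(\<Sum>t\<in>C - B. scale (x t) t) \<in> J" for x
    proof -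
      have "(\<Sum>t\<in>C - B. scale (x t) t) \<in> range (\<lambda>y. \<Sum>v\<in>B. scale (y v) v)"
        using mem B(3) by (subst span_finite[OF finB, symmetric]) blast
      then obtain y where y: "(\<Sum>t\<in>C - B. scale (x t) t) = (\<Sum>v\<in>B. scale (y v) v)" by blast
      let ?w = "\<lambda>v. if v \<in> B then - y v else x v"
      have "(\<Sum>v\<in>C. scale (?w v) v) = (\<Sum>v\<in>C - B. scale (x v) v) + (\<Sum>v\<in>B. - scale (y v) v)"
        by (simp add: split)
      also have "\<dots> = 0"
        by (simp add: y sum_negf)
      finally have 0: "(\<Sum>v\<in>C. scale (?w v) v) = 0" .
      have "?w v = 0" if "v \<in> C" for v
        by (rule independentD[OF C(3) fin subset_refl 0 that])
      then show ?thesis by (metis DiffE)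
    qed
    show "\<exists>x. u - (\<Sum>t\<in>C - B. scale (x t) t) \<in> J" if "u \<in> S" for u
    proof -
      have "u \<in> range (\<lambda>y. \<Sum>v\<in>C. scale (y v) v)"
        using that C(4) by (subst span_finite[OF fin, symmetric]) blast
      then obtain y where "u = (\<Sum>v\<in>C. scale (y v) v)" by blast
      then have "u - (\<Sum>t\<in>C - B. scale (y t) t) = (\<Sum>v\<in>B. scale (y v) v)"
        by (simp add: split)
      also have "\<dots> \<in> J"
        using B(1) J by (intro subspace_sum subspace_scale) auto
      finally show ?thesis by blast
    qed
  qed
qed

text \<open>Rank-nullity relative to a subspace \<open>U\<close> of a finitely generated space,
  since the polynomial modules in which it is applied have infinite dimension.\<close>

lemma (in Vector_Spaces.linear) dim_image_kernel:
  assumes U: "vs1.subspace U" "U \<subseteq> vs1.span A" "finite A"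
  shows "vs2.dim (f ` U) + vs1.dim {u\<in>U. f u = 0} = vs1.dim U"
proof -
  let ?K = "{u\<in>U. f u = 0}"
  have K: "vs1.subspace ?K"
    using U(1) by (intro vs1.subspaceI) (auto simp: vs1.subspace_0 vs1.subspace_add vs1.subspace_scale add scale zero)
  obtain T where T: "finite T" "T \<subseteq> U" "card T + vs1.dim ?K = vs1.dim U"
    "\<And>x. (\<Sum>t\<in>T. s1 (x t) t) \<in> ?K \<Longrightarrow> \<forall>t\<in>T. x t = 0"
    "\<And>u. u \<in> U \<Longrightarrow> \<exists>x. u - (\<Sum>t\<in>T. s1 (x t) t) \<in> ?K"
    by (rule vs1.complement_basis[OF K _ U(2,3)]) auto
  have f_sum: "f (\<Sum>t\<in>T. s1 (x t) t) = (\<Sum>t\<in>T. s2 (x t) (f t))" for x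
    by (simp add: sum scale)
  have "vs2.dim (f ` U) = card T"
  proof (rule vs2.dim_family[where f = f])
    show "finite T" by (rule T(1))
    show "f a \<in> f ` U" if "a \<in> T" for a using that T(2) by blast
    show "\<forall>t\<in>T. x t = 0" if "(\<Sum>t\<in>T. s2 (x t) (f t)) = 0" for x
    proof (rule T(4))
      have "(\<Sum>t\<in>T. s1 (x t) t) \<in> U"
        using T(2) U(1) by (intro vs1.subspace_sum vs1.subspace_scale) auto
      then show "(\<Sum>t\<in>T. s1 (x t) t) \<in> ?K"
        using that by (simp add: f_sum)
    qed
    show "\<exists>x. w = (\<Sum>t\<in>T. s2 (x t) (f t))" if "w \<in> f ` U" for w
    proof -
      obtain u where u: "u \<in> U" "w = f u" using \<open>w \<in> f ` U\<close> by blast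
      obtain x where "u - (\<Sum>t\<in>T. s1 (x t) t) \<in> ?K" using T(5)[OF u(1)] by blast
      then have "f (u - (\<Sum>t\<in>T. s1 (x t) t)) = 0" by simp
      then have "w = (\<Sum>t\<in>T. s2 (x t) (f t))"
        by (simp add: u(2) diff f_sum)
      then show ?thesis by blast
    qed
  qed
  then show ?thesis using T(3) by simp
qed

section \<open>Spaces of forms and their dimensions\<close>

interpretation mpoly_vs: vector_space "\<lambda>c (p :: 'v mpoly). Const c * p"
  by unfold_locales (simp_all add: Const_add Const_mult algebra_simps)

interpretation mpoly_vec_vs: vector_space "\<lambda>c (p :: 'v mpoly ^ 'n). Const c *s p"
  by unfold_locales (simp_all add: vec_eq_iff Const_add Const_mult algebra_simps)

definition monomials :: "nat \<Rightarrow> ('v::finite \<Rightarrow>\<^sub>0 nat) set" where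
  "monomials n = {e. mdeg e = n}"

lemma finite_monomials [simp]: "finite (monomials n)"
  by (rule finite_subset[OF _ finite_mdeg_le[of n]]) (auto simp: monomials_def)

lemma sum_monomials_lookup:
  "Poly_Mapping.lookup (\<Sum>e\<in>monomials n. Const (x e) * Poly_Mapping.single e 1) m
     = (if mdeg m = n then x m else 0)"
  by (simp add: lookup_sum Const_mult_single lookup_single when_def) (simp add: monomials_def)

lemma homogeneous_sum_monomials:
  "homogeneous n p \<Longrightarrow> p = (\<Sum>e\<in>monomials n. Const (Poly_Mapping.lookup p e) * Poly_Mapping.single e 1)"
  by (rule poly_mapping_eqI) (use homogeneousD in \<open>auto simp: sum_monomials_lookup\<close>)

lemma sum_monomials_0:
  "(\<Sum>e\<in>monomials n. Const (x e) * Poly_Mapping.single e 1) = 0 \<Longrightarrow> e \<in> monomials n \<Longrightarrow> x e = 0"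
  using sum_monomials_lookup[of x n e] by (simp add: monomials_def)

lemma dim_homogeneous: "mpoly_vs.dim {p :: 'v::finite mpoly. homogeneous n p} = card (monomials n :: ('v \<Rightarrow>\<^sub>0 nat) set)"
proof (rule mpoly_vs.dim_family)
  show "Poly_Mapping.single e 1 \<in> {p. homogeneous n p}" if "e \<in> monomials n" for e :: "'v \<Rightarrow>\<^sub>0 nat"
    using that homogeneous_single[of e 1] by (simp add: monomials_def)
  show "\<forall>e\<in>monomials n. x e = 0" if "(\<Sum>e\<in>monomials n. Const (x e) * Poly_Mapping.single e 1) = 0"
    for x :: "('v \<Rightarrow>\<^sub>0 nat) \<Rightarrow> complex"
    using sum_monomials_0[OF that] by blast
  show "\<exists>x. p = (\<Sum>e\<in>monomials n. Const (x e) * Poly_Mapping.single e 1)" if "p \<in> {p. homogeneous n p}" for p :: "'v mpoly"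
    using homogeneous_sum_monomials[of n p] that by blast
qed simp

definition homogeneous_vecs :: "nat \<Rightarrow> ('v::finite mpoly ^ 'n) set" where
  "homogeneous_vecs n = {a. \<forall>i. homogeneous n (a $ i)}"

lemma subspace_homogeneous_vecs: "mpoly_vec_vs.subspace (homogeneous_vecs n)"
  by (rule mpoly_vec_vs.subspaceI) (auto simp: homogeneous_vecs_def homogeneous_add homogeneous_Const_mult)

lemma sum_vec_monomials:
  "(\<Sum>(i, e)\<in>UNIV \<times> monomials n. Const (x (i, e)) *s axis i (Poly_Mapping.single e 1)) $ k
     = (\<Sum>e\<in>monomials n. Const (x (k :: 'n::finite, e)) * Poly_Mapping.single e 1)"
proof -
  have "(\<Sum>(i, e)\<in>UNIV \<times> monomials n. Const (x (i, e)) *s axis i (Poly_Mapping.single e 1)) $ k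
    = (\<Sum>i\<in>UNIV. \<Sum>e\<in>monomials n. (Const (x (i, e)) *s axis i (Poly_Mapping.single e 1)) $ k)"
    by (simp add: sum.cartesian_product[symmetric])
  also have "\<dots> = (\<Sum>i\<in>UNIV. if i = k then (\<Sum>e\<in>monomials n. Const (x (k, e)) * Poly_Mapping.single e 1) else 0)"
    by (intro sum.cong refl) (auto simp: axis_def)
  finally show ?thesis by simp
qed

lemma homogeneous_vecs_expand:
  assumes "a \<in> homogeneous_vecs n"
  shows "a = (\<Sum>(i, e)\<in>UNIV \<times> monomials n. Const (Poly_Mapping.lookup (a $ i) e) *s axis i (Poly_Mapping.single e 1))"
proof (rule vec_eq_iff[THEN iffD2], rule allI)
  fix k
  show "a $ k = (\<Sum>(i, e)\<in>UNIV \<times> monomials n. Const (Poly_Mapping.lookup (a $ i) e) *s axis i (Poly_Mapping.single e 1)) $ k"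
    using homogeneous_sum_monomials[of n "a $ k"] assms sum_vec_monomials[of "\<lambda>(i, e). Poly_Mapping.lookup (a $ i) e" n k]
    by (simp add: homogeneous_vecs_def)
qed

lemma homogeneous_vecs_span:
  "(homogeneous_vecs n :: ('v::finite mpoly ^ 'n::finite) set) \<subseteq>
     mpoly_vec_vs.span ((\<lambda>(i, e). axis i (Poly_Mapping.single e 1)) ` (UNIV \<times> monomials n))"
proof
  fix a :: "'v mpoly ^ 'n" assume "a \<in> homogeneous_vecs n"
  note eq = homogeneous_vecs_expand[OF this]
  show "a \<in> mpoly_vec_vs.span ((\<lambda>(i, e). axis i (Poly_Mapping.single e 1)) ` (UNIV \<times> monomials n))"
    by (subst eq, intro mpoly_vec_vs.span_sum)
       (clarify, intro mpoly_vec_vs.span_scale mpoly_vec_vs.span_base, force)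
qed

lemma dim_homogeneous_vecs:
  "mpoly_vec_vs.dim (homogeneous_vecs n :: ('v::finite mpoly ^ 'n::finite) set)
     = CARD('n) * card (monomials n :: ('v \<Rightarrow>\<^sub>0 nat) set)"
proof -
  have "mpoly_vec_vs.dim (homogeneous_vecs n :: ('v mpoly ^ 'n) set)
     = card ((UNIV :: 'n set) \<times> (monomials n :: ('v \<Rightarrow>\<^sub>0 nat) set))"
  proof (rule mpoly_vec_vs.dim_family[where f = "\<lambda>(i, e). axis i (Poly_Mapping.single e 1)"])
    show "(case a of (i, e) \<Rightarrow> axis i (Poly_Mapping.single e 1)) \<in> homogeneous_vecs n"
      if "a \<in> UNIV \<times> monomials n" for a :: "'n \<times> ('v \<Rightarrow>\<^sub>0 nat)"
      using that homogeneous_single[of "snd a" 1] by (auto simp: homogeneous_vecs_def axis_def monomials_def split: prod.splits)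
    show "\<forall>a\<in>UNIV \<times> monomials n. x a = 0"
      if 0: "(\<Sum>a\<in>UNIV \<times> monomials n. Const (x a) *s (case a of (i, e) \<Rightarrow> axis i (Poly_Mapping.single e 1))) = 0"
      for x :: "'n \<times> ('v \<Rightarrow>\<^sub>0 nat) \<Rightarrow> complex"
    proof -
      have 0: "(\<Sum>(i, e)\<in>UNIV \<times> monomials n. Const (x (i, e)) *s axis i (Poly_Mapping.single e 1)) = 0"
        using 0 by (simp add: case_prod_unfold)
      have "(\<Sum>e\<in>monomials n. Const (x (k, e)) * Poly_Mapping.single e 1) = 0" for k
        using sum_vec_monomials[of x n k] unfolding 0 by simp
      from sum_monomials_0[OF this] show ?thesis by auto
    qed
    show "\<exists>x. a = (\<Sum>b\<in>UNIV \<times> monomials n. Const (x b) *s (case b of (i, e) \<Rightarrow> axis i (Poly_Mapping.single e 1)))"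
      if "a \<in> homogeneous_vecs n" for a :: "'v mpoly ^ 'n"
      using homogeneous_vecs_expand[OF that]
      by (intro exI[of _ "\<lambda>(i, e). Poly_Mapping.lookup (a $ i) e"]) (simp add: case_prod_unfold)
  qed simp
  then show ?thesis by (simp add: card_cartesian_product)
qed

text \<open>Two exponents determine the third, which gives the binomial coefficient of
  \<open>n + 2\<close> over 2; doubling keeps the formula free of division.\<close>

lemma card_monomials_3: "2 * card (monomials n :: (3 \<Rightarrow>\<^sub>0 nat) set) = (n + 1) * (n + 2)"
proof -
  let ?S = "SIGMA a:{..n}. {..n - a}"
  let ?f = "\<lambda>e :: 3 \<Rightarrow>\<^sub>0 nat. (Poly_Mapping.lookup e 1, Poly_Mapping.lookup e 2)"
  let ?g = "\<lambda>(a, b). Poly_Mapping.single 1 a + Poly_Mapping.single 2 b + Poly_Mapping.single 3 (n - a - b) :: 3 \<Rightarrow>\<^sub>0 nat"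
  have "bij_betw ?f (monomials n) ?S"
  proof (rule bij_betw_byWitness[where f' = ?g])
    show "\<forall>e\<in>monomials n. ?g (?f e) = e"
    proof (intro ballI poly_mapping_eqI)
      fix e :: "3 \<Rightarrow>\<^sub>0 nat" and k :: 3
      assume "e \<in> monomials n"
      then show "Poly_Mapping.lookup (?g (?f e)) k = Poly_Mapping.lookup e k"
        using exhaust_3[of k] by (auto simp: monomials_def mdeg_def sum_3 lookup_add lookup_single when_def)
    qed
    show "\<forall>s\<in>?S. ?f (?g s) = s"
      by (auto simp: lookup_add lookup_single when_def)
    show "?f ` monomials n \<subseteq> ?S"
      by (auto simp: monomials_def mdeg_def sum_3)
    show "?g ` ?S \<subseteq> monomials n"
      by (auto simp: monomials_def mdeg_add)
  qed
  then have "card (monomials n :: (3 \<Rightarrow>\<^sub>0 nat) set) = card ?S"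
    by (rule bij_betw_same_card)
  also have "\<dots> = (\<Sum>a\<le>n. Suc (n - a))"
    by (subst card_SigmaI) auto
  also have "\<dots> = (\<Sum>a<Suc n. Suc (Suc n - Suc a))"
    by (simp only: lessThan_Suc_atMost diff_Suc_Suc)
  also have "\<dots> = (\<Sum>a<Suc n. Suc a)"
    by (rule sum.nat_diff_reindex)
  also have "2 * \<dots> = (n + 1) * (n + 2)"
    by (induction n) auto
  finally show ?thesis .
qed

lemma dim_free_submodule:
  fixes b c :: "'v::finite mpoly ^ 'n::finite" and U :: "('v mpoly ^ 'n) set"
  assumes ind: "\<And>p q. p *s b + q *s c = 0 \<Longrightarrow> p = 0 \<and> q = 0"
    and U: "U = {p *s b + q *s c | p q. homogeneous n p \<and> homogeneous k q}"
  shows "mpoly_vec_vs.dim U = card (monomials n :: ('v \<Rightarrow>\<^sub>0 nat) set) + card (monomials k :: ('v \<Rightarrow>\<^sub>0 nat) set)"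
proof -
  let ?A = "(monomials n :: ('v \<Rightarrow>\<^sub>0 nat) set) <+> (monomials k :: ('v \<Rightarrow>\<^sub>0 nat) set)"
  let ?f = "case_sum (\<lambda>e. Poly_Mapping.single e 1 *s b) (\<lambda>e. Poly_Mapping.single e 1 *s c)"
  have sum: "(\<Sum>a\<in>?A. Const (x a) *s ?f a)
      = (\<Sum>e\<in>monomials n. Const (x (Inl e)) * Poly_Mapping.single e 1) *s b
      + (\<Sum>e\<in>monomials k. Const (x (Inr e)) * Poly_Mapping.single e 1) *s c" for x
    by (subst sum.Plus) (simp_all add: vec_eq_iff sum_distrib_right mult.assoc)
  have "mpoly_vec_vs.dim U = card ?A"
  proof (rule mpoly_vec_vs.dim_family[where f = ?f])
    show "finite ?A" by simp
    show "?f a \<in> U" if "a \<in> ?A" for a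
    proof (cases a)
      case (Inl e)
      then have "?f a = Poly_Mapping.single e 1 *s b + 0 *s c" "homogeneous n (Poly_Mapping.single e (1::complex))"
        using that homogeneous_single[of e 1] by (auto simp: monomials_def)
      then show ?thesis unfolding U using homogeneous_0 by blast
    next
      case (Inr e)
      then have "?f a = 0 *s b + Poly_Mapping.single e 1 *s c" "homogeneous k (Poly_Mapping.single e (1::complex))"
        using that homogeneous_single[of e 1] by (auto simp: monomials_def)
      then show ?thesis unfolding U using homogeneous_0 by blast
    qed
    show "\<forall>a\<in>?A. x a = 0" if "(\<Sum>a\<in>?A. Const (x a) *s ?f a) = 0" for x
    proof -
      note * = ind[OF that[unfolded sum]]
      show ?thesis
        using sum_monomials_0[OF conjunct1[OF *]] sum_monomials_0[OF conjunct2[OF *]] by auto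
    qed
    show "\<exists>x. u = (\<Sum>a\<in>?A. Const (x a) *s ?f a)" if "u \<in> U" for u
    proof -
      obtain p q where pq: "u = p *s b + q *s c" "homogeneous n p" "homogeneous k q"
        using \<open>u \<in> U\<close> unfolding U by blast
      let ?x = "case_sum (Poly_Mapping.lookup p) (Poly_Mapping.lookup q)"
      have "(\<Sum>a\<in>?A. Const (?x a) *s ?f a) = u"
        unfolding sum pq(1) using homogeneous_sum_monomials[OF pq(2)] homogeneous_sum_monomials[OF pq(3)] by simp
      then show ?thesis by (intro exI[of _ ?x]) (simp only:)
    qed
  qed
  then show ?thesis by (simp add: card_Plus)
qed

section \<open>Restriction to a line\<close>

text \<open>The form \<open>a^n p(b/a)\<close>. With the first two variables it lifts polynomials
  from a line to the plane; with \<open>l\<close> and one coordinate it produces the integral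
  equations.\<close>

definition homogenize :: "'v::finite mpoly \<Rightarrow> 'v mpoly \<Rightarrow> nat \<Rightarrow> complex poly \<Rightarrow> 'v mpoly" where
  "homogenize a b n p = (\<Sum>k\<le>n. Const (coeff p k) * a ^ (n - k) * b ^ k)"

lemma homogenize_0 [simp]: "homogenize a b n 0 = 0"
  by (simp add: homogenize_def)

lemma homogenize_add: "homogenize a b n (p + q) = homogenize a b n p + homogenize a b n q"
  by (simp only: homogenize_def coeff_add Const_add distrib_right sum.distrib)

lemma homogenize_smult: "homogenize a b n (smult c p) = Const c * homogenize a b n p"
  by (simp only: homogenize_def coeff_smult Const_mult sum_distrib_left mult.assoc)

lemma homogenize_Suc:
  assumes "degree p \<le> n"
  shows "homogenize a b (Suc n) p = a * homogenize a b n p"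
proof -
  have 0: "coeff p (Suc n) = 0" using assms by (intro coeff_eq_0) simp
  have *: "Const (coeff p k) * a ^ (Suc n - k) * b ^ k = a * (Const (coeff p k) * a ^ (n - k) * b ^ k)" if "k \<in> {..n}" for k
  proof -
    have "Suc n - k = Suc (n - k)" using that by simp
    then show ?thesis by (simp only: power_Suc mult_ac)
  qed
  have "homogenize a b (Suc n) p = (\<Sum>k\<le>n. Const (coeff p k) * a ^ (Suc n - k) * b ^ k)"
    unfolding homogenize_def by (simp add: 0)
  also have "\<dots> = (\<Sum>k\<le>n. a * (Const (coeff p k) * a ^ (n - k) * b ^ k))"
    by (rule sum.cong[OF refl *])
  finally show ?thesis by (simp only: homogenize_def sum_distrib_left)
qed

lemma homogenize_pCons_0: "homogenize a b (Suc n) (pCons 0 p) = b * homogenize a b n p"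
proof -
  have "homogenize a b (Suc n) (pCons 0 p) = (\<Sum>k\<le>n. Const (coeff p k) * a ^ (n - k) * b ^ Suc k)"
    unfolding homogenize_def by (subst sum.atMost_Suc_shift) simp
  also have "\<dots> = (\<Sum>k\<le>n. b * (Const (coeff p k) * a ^ (n - k) * b ^ k))"
    by (rule sum.cong[OF refl]) (simp only: power_Suc mult_ac)
  finally show ?thesis by (simp only: homogenize_def sum_distrib_left)
qed

lemma homogenize_power: "degree p \<le> n \<Longrightarrow> homogenize a b (k + n) p = a ^ k * homogenize a b n p"
  by (induction k) (simp_all add: homogenize_Suc mult.assoc)

lemma homogenize_prod_list:
  "homogenize a b (length xs) (\<Prod>x\<leftarrow>xs. [:- x, 1:]) = (\<Prod>x\<leftarrow>xs. b - Const x * a)"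
proof (induction xs)
  case Nil
  then show ?case by (simp add: homogenize_def)
next
  case (Cons x xs)
  let ?p = "\<Prod>x\<leftarrow>xs. [:- x, 1:]"
  have deg: "degree ?p \<le> length xs"
  proof (induction xs)
    case (Cons y ys)
    have "degree ([:- y, 1:] * (\<Prod>x\<leftarrow>ys. [:- x, 1:])) \<le> degree [:- y, 1:] + degree (\<Prod>x\<leftarrow>ys. [:- x, 1:])"
      by (rule degree_mult_le)
    then show ?case using Cons by simp
  qed simp
  have "homogenize a b (Suc (length xs)) ([:- x, 1:] * ?p)
      = Const (- x) * (a * homogenize a b (length xs) ?p) + b * homogenize a b (length xs) ?p"
    by (simp add: homogenize_add homogenize_smult homogenize_pCons_0 homogenize_Suc[OF deg] del: smult_minus_left)
  then show ?case
    by (simp add: Cons Const_uminus algebra_simps)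
qed

lemma homogeneous_homogenize:
  assumes "homogeneous 1 a" "homogeneous 1 b"
  shows "homogeneous n (homogenize a b n p)"
  unfolding homogenize_def
proof (rule homogeneous_sum)
  fix k assume "k \<in> {..n}"
  then have "0 + (n - k) * 1 + k * 1 = n" by simp
  moreover have "homogeneous (0 + (n - k) * 1 + k * 1) (Const (coeff p k) * a ^ (n - k) * b ^ k)"
    by (intro homogeneous_mult homogeneous_Const homogeneous_power assms)
  ultimately show "homogeneous n (Const (coeff p k) * a ^ (n - k) * b ^ k)" by (simp only:)
qed

section \<open>Vector algebra over commutative rings and over \<complex>[t]\<close>

definition cross :: "'a::comm_ring_1 ^ 3 \<Rightarrow> 'a ^ 3 \<Rightarrow> 'a ^ 3" where
  "cross a b = vector [a$2 * b$3 - a$3 * b$2, a$3 * b$1 - a$1 * b$3, a$1 * b$2 - a$2 * b$1]"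

definition dot :: "'a::comm_ring_1 ^ 3 \<Rightarrow> 'a ^ 3 \<Rightarrow> 'a" where
  "dot a b = (\<Sum>i\<in>UNIV. a $ i * b $ i)"

lemma cross_component [simp]:
  "cross a b $ 1 = a$2 * b$3 - a$3 * b$2" "cross a b $ 2 = a$3 * b$1 - a$1 * b$3" "cross a b $ 3 = a$1 * b$2 - a$2 * b$1"
  by (simp_all add: cross_def)

lemma dot_3: "dot a b = a$1 * b$1 + a$2 * b$2 + a$3 * b$3"
  by (simp add: dot_def sum_3)

text \<open>A vector orthogonal to \<open>a\<close> and \<open>b\<close> is parallel to their cross
  product. Parallelism is expressed by the 2 by 2 minors, which makes sense without
  division.\<close>

lemma cross_parallel:
  assumes "dot a u = 0" "dot b u = 0"
  shows "cross a b $ i * u $ j = cross a b $ j * u $ i"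
proof -
  have *: "(a$2 * b$3 - a$3 * b$2) * u$2 - (a$3 * b$1 - a$1 * b$3) * u$1 = b$3 * dot a u - a$3 * dot b u"
    "(a$2 * b$3 - a$3 * b$2) * u$3 - (a$1 * b$2 - a$2 * b$1) * u$1 = a$2 * dot b u - b$2 * dot a u"
    "(a$3 * b$1 - a$1 * b$3) * u$3 - (a$1 * b$2 - a$2 * b$1) * u$2 = b$1 * dot a u - a$1 * dot b u"
    by (simp_all add: dot_3 algebra_simps)
  show ?thesis
    using exhaust_3[of i] exhaust_3[of j] * assms by (auto simp: algebra_simps)
qed

text \<open>The Bezout relation \<open>dot c u = 1\<close> turns proportionality into an actual
  multiple, with factor \<open>dot c w\<close>.\<close>

lemma parallel_primitive:
  fixes w u c :: "'a::comm_ring_1 ^ 3"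
  assumes "\<And>i j. w $ i * u $ j = w $ j * u $ i" "dot c u = 1"
  shows "w = dot c w *s u"
proof (rule vec_eq_iff[THEN iffD2], rule allI)
  fix j
  have "w $ j = dot c u * w $ j" by (simp add: assms(2))
  also have "\<dots> = (\<Sum>i\<in>UNIV. c $ i * (w $ j * u $ i))"
    unfolding dot_def sum_distrib_right by (intro sum.cong refl) (simp only: mult_ac)
  also have "\<dots> = (\<Sum>i\<in>UNIV. c $ i * (w $ i * u $ j))"
    by (simp only: assms(1))
  also have "\<dots> = (dot c w *s u) $ j"
    unfolding vector_smult_component dot_def sum_distrib_right by (intro sum.cong refl) (simp only: mult_ac)
  finally show "w $ j = (dot c w *s u) $ j" .
qed

text \<open>Over a field a nonzero \<open>a\<close> would be parallel to both \<open>b\<close> and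
  \<open>c\<close>, forcing \<open>cross c b = 0\<close>. The nine identities express each product
  through the given zero entries and so hold in any commutative ring.\<close>

lemma cross_dot_cancel:
  fixes a b c :: "'a::comm_ring_1 ^ 3"
  assumes "cross a b = 0" "cross c a = 0"
  shows "a $ i * cross c b $ k = 0"
proof -
  have "a$1 * cross c b $ 1 = c$1 * cross a b $ 1 - cross c a $ 3 * b$3 - cross c a $ 2 * b$2"
    "a$2 * cross c b $ 1 = c$2 * cross a b $ 1 + cross c a $ 1 * b$2"
    "a$3 * cross c b $ 1 = c$3 * cross a b $ 1 + cross c a $ 1 * b$3"
    "a$1 * cross c b $ 2 = c$1 * cross a b $ 2 + cross c a $ 2 * b$1"
    "a$2 * cross c b $ 2 = c$2 * cross a b $ 2 - cross c a $ 1 * b$1 - cross c a $ 3 * b$3"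
    "a$3 * cross c b $ 2 = c$3 * cross a b $ 2 + cross c a $ 2 * b$3"
    "a$1 * cross c b $ 3 = c$1 * cross a b $ 3 + cross c a $ 3 * b$1"
    "a$2 * cross c b $ 3 = c$2 * cross a b $ 3 + cross c a $ 3 * b$2"
    "a$3 * cross c b $ 3 = c$3 * cross a b $ 3 - cross c a $ 2 * b$2 - cross c a $ 1 * b$1"
    by (simp_all add: algebra_simps)
  then show ?thesis
    using exhaust_3[of i] exhaust_3[of k] assms by (auto simp del: cross_component)
qed

text \<open>The greatest common divisor of the entries is a combination of them. A nonconstant one
  would have a complex root common to all entries.\<close>

lemma primitive_bezout:
  fixes u :: "complex poly ^ 3"
  assumes "\<And>t. \<exists>i. poly (u $ i) t \<noteq> 0"
  obtains c where "dot c u = 1"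
proof -
  define g where "g = gcd (u $ 2) (u $ 3)"
  define d where "d = gcd (u $ 1) g"
  obtain a b where ab: "a * u $ 2 + b * u $ 3 = g"
    using bezout_coefficients_fst_snd[of "u $ 2" "u $ 3"] unfolding g_def by blast
  obtain a' b' where ab': "a' * u $ 1 + b' * g = d"
    using bezout_coefficients_fst_snd[of "u $ 1" g] unfolding d_def by blast
  have "d dvd u $ i" for i
  proof -
    have "d dvd u $ 1" "d dvd g" "g dvd u $ 2" "g dvd u $ 3"
      unfolding d_def g_def by (rule gcd_dvd1 gcd_dvd2)+
    then show ?thesis using exhaust_3[of i] dvd_trans by auto
  qed
  have "degree d = 0"
  proof (rule ccontr)
    assume "degree d \<noteq> 0"
    then obtain t where t: "poly d t = 0"
      using fundamental_theorem_of_algebra[of d] constant_degree[of d] by auto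
    obtain i where "poly (u $ i) t \<noteq> 0" using assms by blast
    moreover have "poly d t dvd poly (u $ i) t"
      using \<open>d dvd u $ i\<close> by (auto simp: dvd_def)
    ultimately show False using t by simp
  qed
  moreover have "d \<noteq> 0"
  proof
    assume "d = 0"
    obtain i where "poly (u $ i) 0 \<noteq> 0" using assms by blast
    then show False using \<open>d dvd u $ i\<close> \<open>d = 0\<close> by simp
  qed
  ultimately obtain \<gamma> where \<gamma>: "d = [:\<gamma>:]" "\<gamma> \<noteq> 0"
    by (metis degree_eq_zeroE pCons_0_0)
  define c :: "complex poly ^ 3" where "c = [:inverse \<gamma>:] *s vector [a', b' * a, b' * b]"
  have "dot c u = [:inverse \<gamma>:] * (a' * u $ 1 + b' * (a * u $ 2 + b * u $ 3))"
    by (simp only: dot_3 c_def vector_smult_component vector_3 distrib_left mult.assoc add.assoc)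
  also have "\<dots> = 1"
    using \<gamma> by (simp add: ab ab')
  finally show thesis by (rule that)
qed

context
  fixes \<alpha> \<beta> :: complex
begin

definition line :: "3 mpoly" where
  "line = Var 3 - Const \<alpha> * Var 1 - Const \<beta> * Var 2"

text \<open>Restriction to the line, parametrized by \<open>(1, t, \<alpha> + \<beta> t)\<close>.
  The remaining point \<open>(0, 1, \<beta>)\<close> corresponds to \<open>t\<close> at
  infinity.\<close>

definition restrict :: "3 mpoly \<Rightarrow> complex poly" where
  "restrict = mp_eval (\<lambda>c. [:c:]) (vector [1, [:0, 1:], [:\<alpha>, \<beta>:]])"

lemma ring_morphism_pconst: "ring_morphism (\<lambda>c :: complex. [:c:])"
  by (simp add: ring_morphism_def one_pCons)

lemma ring_morphism_restrict: "ring_morphism restrict"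
  unfolding restrict_def by (rule ring_morphism_mp_eval[OF ring_morphism_pconst])

lemmas restrict_simps = ring_morphism_simps[OF ring_morphism_restrict]

lemma restrict_Const: "restrict (Const c) = [:c:]"
  unfolding restrict_def by (rule mp_eval_Const[OF ring_morphism_pconst])

lemma restrict_Var: "restrict (Var 1) = 1" "restrict (Var 2) = [:0, 1:]" "restrict (Var 3) = [:\<alpha>, \<beta>:]"
  unfolding restrict_def by (simp_all add: mp_eval_Var[OF ring_morphism_pconst])

lemma restrict_line: "restrict line = 0"
  by (simp add: line_def restrict_simps restrict_Const restrict_Var)

lemma homogeneous_line: "homogeneous 1 line"
  unfolding line_def by (intro homogeneous_diff homogeneous_Const_mult homogeneous_Var)

lemma line_nonzero: "line \<noteq> 0"
proof
  assume "line = 0"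
  then have "mp_eval id (vector [0, 0, 1] :: complex ^ 3) line = 0" by simp
  then show False
    by (simp add: line_def id_def mp_eval_simps)
qed

lemma poly_restrict: "poly (restrict h) t = mp_eval id (vector [1, t, \<alpha> + \<beta> * t]) h"
proof (induction h rule: mpoly_induct)
  case (Var i p)
  then show ?case
    using exhaust_3[of i]
    by (auto simp: restrict_simps restrict_Var id_def mp_eval_simps algebra_simps)
qed (simp_all add: restrict_simps restrict_Const id_def mp_eval_simps)

text \<open>The degree drops exactly when the form vanishes at the point at infinity. The third
  claim identifies the kernel of restriction on forms: a form restricting to 0 is divisible by
  \<open>line\<close>. The claims are proved jointly because the third uses the degree
  bound.\<close>

lemma restrict_homogeneous:
  assumes "homogeneous n h"
  shows "degree (restrict h) \<le> n" (is "?A n h")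
    and "coeff (restrict h) n = mp_eval id (vector [0, 1, \<beta>]) h" (is "?B n h")
    and "line dvd h - homogenize (Var 1) (Var 2) n (restrict h)" (is "?C n h")
proof -
  have "?A n h \<and> ?B n h \<and> ?C n h"
    using assms
  proof (induction rule: homogeneous_induct)
    case (Const c)
    then show ?case
      by (simp add: restrict_Const id_def mp_eval_simps homogenize_def)
  next
    case (Var i n p)
    let ?p = "restrict p" and ?H = "homogenize (Var 1) (Var 2)"
    note deg = conjunct1[OF Var(2)] and co = conjunct1[OF conjunct2[OF Var(2)]]
      and dvd = conjunct2[OF conjunct2[OF Var(2)]]
    have co': "coeff ?p (Suc n) = 0" using deg by (intro coeff_eq_0) simp
    consider "i = 1" | "i = 2" | "i = 3" using exhaust_3[of i] by blast
    then show ?case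
    proof cases
      case 1
      then have "restrict (Var i * p) = ?p" by (simp add: restrict_simps restrict_Var)
      moreover have "line dvd Var 1 * (p - ?H n ?p)" using dvd by simp
      ultimately show ?thesis
        using 1 deg co' by (simp add: homogenize_Suc[OF deg] right_diff_distrib id_def mp_eval_simps)
    next
      case 2
      then have r: "restrict (Var i * p) = pCons 0 ?p" by (simp add: restrict_simps restrict_Var)
      have A: "degree (restrict (Var i * p)) \<le> Suc n"
        unfolding r using deg by (intro le_trans[OF degree_pCons_le]) simp
      have B: "coeff (restrict (Var i * p)) (Suc n) = mp_eval id (vector [0, 1, \<beta>]) (Var i * p)"
        unfolding r by (simp only: coeff_pCons_Suc co 2 mp_eval_mult[OF ring_morphism_id] mp_eval_Var[OF ring_morphism_id]
            vector_3 mult_1_left)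
      have "line dvd Var 2 * (p - ?H n ?p)" using dvd by simp
      then have C: "line dvd Var i * p - ?H (Suc n) (restrict (Var i * p))"
        unfolding r unfolding 2 by (simp only: homogenize_pCons_0 right_diff_distrib)
      show ?thesis by (rule conjI[OF A conjI[OF B C]])
    next
      case 3
      then have r: "restrict (Var i * p) = smult \<alpha> ?p + pCons 0 (smult \<beta> ?p)"
        by (simp add: restrict_simps restrict_Var)
      have A: "degree (restrict (Var i * p)) \<le> Suc n"
        unfolding r using deg by (intro degree_add_le) (auto intro: le_trans[OF degree_smult_le] le_trans[OF degree_pCons_le])
      have B: "coeff (restrict (Var i * p)) (Suc n) = mp_eval id (vector [0, 1, \<beta>]) (Var i * p)"
        unfolding r unfolding 3 coeff_add coeff_smult coeff_pCons_Suc co co' mp_eval_mult[OF ring_morphism_id]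
          mp_eval_Var[OF ring_morphism_id] by simp
      have "Var i * p - ?H (Suc n) (smult \<alpha> ?p + pCons 0 (smult \<beta> ?p))
         = Var 3 * (p - ?H n ?p) + line * ?H n ?p"
        using 3 by (simp add: homogenize_add homogenize_smult homogenize_pCons_0 homogenize_Suc[OF deg] line_def algebra_simps)
      then have C: "line dvd Var i * p - ?H (Suc n) (restrict (Var i * p))"
        unfolding r using dvd by (simp only: dvd_add dvd_mult dvd_triv_left)
      show ?thesis by (rule conjI[OF A conjI[OF B C]])
    qed
  next
    case (add n p q)
    have "line dvd (p - homogenize (Var 1) (Var 2) n (restrict p)) + (q - homogenize (Var 1) (Var 2) n (restrict q))"
      using add by (intro dvd_add) auto
    then show ?case
      using add by (simp add: restrict_simps degree_add_le id_def mp_eval_simps homogenize_add algebra_simps)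
  qed (simp add: restrict_simps)
  then show "?A n h" "?B n h" "?C n h" by auto
qed

lemma restrict_homogenize:
  assumes "degree p \<le> n"
  shows "restrict (homogenize (Var 1) (Var 2) n p) = p"
proof -
  have "restrict (homogenize (Var 1) (Var 2) n p) = (\<Sum>k\<le>n. monom (coeff p k) k)"
    by (simp add: homogenize_def restrict_simps restrict_Const restrict_Var monom_altdef)
  then show ?thesis using poly_as_sum_of_monoms'[OF assms] by simp
qed

end

section \<open>Free curves\<close>

lemma cross_combination:
  "cross (p *s a + q *s b) (p' *s a + q' *s b) = (p * q' - q * p') *s cross a (b :: 'a::comm_ring_1 ^ 3)"
  by (simp add: vec_eq_iff forall_3 algebra_simps)

text \<open>The vectors are the Koszul relations, the trivial syzygies of \<open>g\<close>.\<close>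

lemma cross_koszul:
  fixes g :: "'a::comm_ring_1 ^ 3"
  shows "cross (vector [- g$3, 0, g$1]) (vector [g$2, - g$1, 0]) = g$1 *s g"
    "cross (vector [g$2, - g$1, 0]) (vector [0, g$3, - g$2]) = g$2 *s g"
    "cross (vector [0, g$3, - g$2]) (vector [- g$3, 0, g$1]) = g$3 *s g"
  by (simp_all add: vec_eq_iff forall_3 vector_3)

lemma homogeneous_cross:
  fixes a b :: "'v::finite mpoly ^ 3"
  assumes "\<And>i. homogeneous n (a $ i)" "\<And>i. homogeneous k (b $ i)"
  shows "homogeneous (n + k) (cross a b $ i)"
  using exhaust_3[of i] assms by (auto intro!: homogeneous_diff homogeneous_mult)

text \<open>The last two assumptions together say that the line carries no singular point:
  \<open>smooth\<close> treats its points with first coordinate 1, \<open>smooth_infinity\<close>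
  the remaining one.\<close>

locale free_curve_line =
  fixes f :: "3 mpoly" and b c :: "3 mpoly ^ 3" and m d1 d2 :: nat and \<alpha> \<beta> :: complex
  assumes f: "homogeneous m f" "m > 0"
    and b: "\<And>i. homogeneous d1 (b $ i)" and c: "\<And>i. homogeneous d2 (c $ i)"
    and independent: "\<And>p q. p *s b + q *s c = 0 \<Longrightarrow> p = 0 \<and> q = 0"
    and AR: "AR f = {p *s b + q *s c | p q. True}"
    and smooth: "\<And>t. \<exists>i. mp_eval id (vector [1, t, \<alpha> + \<beta> * t]) (mp_deriv i f) \<noteq> 0"
    and smooth_infinity: "\<exists>i. mp_eval id (vector [0, 1, \<beta>]) (mp_deriv i f) \<noteq> 0"
begin

abbreviation "J \<equiv> jacobian_ideal f"

definition g :: "3 mpoly ^ 3" where "g = (\<chi> i. mp_deriv i f)"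

abbreviation "l \<equiv> line \<alpha> \<beta>"

abbreviation "r \<equiv> restrict \<alpha> \<beta>"

definition rv :: "3 mpoly ^ 3 \<Rightarrow> complex poly ^ 3" where "rv a = (\<chi> i. r (a $ i))"

lemma rv_component [simp]: "rv a $ i = r (a $ i)"
  by (simp add: rv_def)

lemma rv_cross: "rv (cross a a') = cross (rv a) (rv a')"
  by (simp add: vec_eq_iff forall_3 restrict_simps)

lemma rv_dot: "r (dot a a') = dot (rv a) (rv a')"
  by (simp add: dot_3 restrict_simps)

lemma homogeneous_g: "homogeneous (m - 1) (g $ i)"
  unfolding g_def vec_lambda_beta by (rule homogeneous_mp_deriv[OF f(1)])

lemma AR_iff: "a \<in> AR f \<longleftrightarrow> dot a g = 0"
  by (simp add: AR_def dot_def g_def)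

lemma dot_b: "dot b g = 0" and dot_c: "dot c g = 0"
proof -
  have "b = 1 *s b + 0 *s c" "c = 0 *s b + 1 *s c"
    by (simp_all add: vec_eq_iff)
  then have "b \<in> AR f" "c \<in> AR f"
    unfolding AR by blast+
  then show "dot b g = 0" "dot c g = 0" by (simp_all only: AR_iff)
qed

lemma AR_combination:
  assumes "dot a g = 0"
  obtains p q where "a = p *s b + q *s c"
proof -
  have "a \<in> AR f" using assms by (simp only: AR_iff)
  then show thesis unfolding AR using that by blast
qed

lemma J_iff: "h \<in> J \<longleftrightarrow> (\<exists>a. h = dot a g)"
proof
  assume "h \<in> J"
  then obtain u where "h = (\<Sum>i\<in>UNIV. u i * mp_deriv i f)" by (auto simp: jacobian_ideal_def)
  then have "h = dot (\<chi> i. u i) g" by (simp add: dot_def g_def)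
  then show "\<exists>a. h = dot a g" by blast
next
  assume "\<exists>a. h = dot a g"
  then obtain a where a: "h = dot a g" by blast
  show "h \<in> J" unfolding a dot_def g_def using jacobian_idealI[of "\<lambda>i. a $ i" f] by simp
qed

abbreviation "P \<equiv> cross b c"

text \<open>The Koszul relations are combinations of \<open>b\<close> and \<open>c\<close>, so the
  cross product of two of them is a 2 by 2 determinant times \<open>P\<close>; by
  \<open>cross_koszul\<close> it is also an entry of \<open>g\<close> times
  \<open>g\<close>.\<close>

lemma koszul:
  obtains D where "\<And>i j. g $ i * g $ j = D i * P $ j"
proof -
  have k: "dot (vector [0, g$3, - g$2]) g = 0" "dot (vector [- g$3, 0, g$1]) g = 0" "dot (vector [g$2, - g$1, 0]) g = 0"
    by (simp_all add: dot_3 vector_3)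
  obtain p1 q1 p2 q2 p3 q3 where k': "vector [0, g$3, - g$2] = p1 *s b + q1 *s c"
    "vector [- g$3, 0, g$1] = p2 *s b + q2 *s c" "vector [g$2, - g$1, 0] = p3 *s b + q3 *s c"
    using AR_combination[OF k(1)] AR_combination[OF k(2)] AR_combination[OF k(3)] by metis
  have e: "g$1 *s g = (p2 * q3 - q2 * p3) *s P" "g$2 *s g = (p3 * q1 - q3 * p1) *s P" "g$3 *s g = (p1 * q2 - q1 * p2) *s P"
    unfolding cross_koszul[symmetric] k' by (rule cross_combination)+
  define D where "D i = (if i = 1 then p2 * q3 - q2 * p3 else if i = 2 then p3 * q1 - q3 * p1 else p1 * q2 - q1 * p2)"
    for i :: 3
  have "g $ i *s g = D i *s P" for i
    using exhaust_3[of i] e by (auto simp: D_def)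
  then have "g $ i * g $ j = D i * P $ j" for i j
    by (metis vector_smult_component)
  then show thesis by (rule that)
qed

lemma rv_g_primitive: obtains a where "dot a (rv g) = 1"
proof (rule primitive_bezout)
  show "\<exists>i. poly (rv g $ i) t \<noteq> 0" for t
    using smooth[of t] by (simp only: rv_component poly_restrict) (simp only: g_def vec_lambda_beta)
qed (rule that)

text \<open>
  Saito's criterion along the line: by the Koszul relations, \<open>b \<times> c\<close> divides the gradient, whose
  entries are coprime there.
\<close>

lemma saito:
  obtains \<gamma> where "\<gamma> \<noteq> 0" "rv P = [:\<gamma>:] *s rv g"
proof -
  obtain a where a: "dot a (rv g) = 1" by (rule rv_g_primitive)
  obtain D where D: "\<And>i j. g $ i * g $ j = D i * P $ j" by (rule koszul) blast
  define s where "s = dot a (rv P)"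
  have "rv P $ i * rv g $ j = rv P $ j * rv g $ i" for i j
    unfolding rv_component using cross_parallel[OF dot_b dot_c, of i j] by (simp only: ring_morphism_mult[OF ring_morphism_restrict, symmetric])
  then have P: "rv P = s *s rv g"
    unfolding s_def by (rule parallel_primitive[OF _ a])
  \<comment> \<open>Weighted by the Bezout coefficients \<open>a\<close>, the products of the
    entries \<open>i\<close> and \<open>j\<close> of \<open>rv g\<close> sum to entry
    \<open>i\<close> alone; each is a multiple of an entry of \<open>rv P\<close> and thus of
    \<open>s\<close>.\<close>
  have dvd: "s dvd rv g $ i" for i
  proof -
    have "rv g $ i = dot a (rv g) * rv g $ i" by (simp only: a mult_1_left)
    also have "\<dots> = (\<Sum>j\<in>UNIV. a $ j * (r (g $ i) * r (g $ j)))"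
      unfolding dot_def sum_distrib_right by (intro sum.cong refl) (simp only: rv_component mult_ac)
    also have "\<dots> = (\<Sum>j\<in>UNIV. s * (r (D i) * (a $ j * rv g $ j)))"
    proof (intro sum.cong refl)
      fix j
      have "r (g $ i) * r (g $ j) = r (D i) * rv P $ j"
        by (simp only: rv_component ring_morphism_mult[OF ring_morphism_restrict, symmetric] D)
      then show "a $ j * (r (g $ i) * r (g $ j)) = s * (r (D i) * (a $ j * rv g $ j))"
        by (simp only: P vector_smult_component mult_ac)
    qed
    also have "s dvd \<dots>" by (intro dvd_sum dvd_triv_left)
    finally show ?thesis .
  qed
  have "s dvd dot a (rv g)"
    unfolding dot_def by (intro dvd_sum dvd_mult dvd)
  then have "s dvd 1" by (simp only: a)
  then obtain \<gamma> where \<gamma>: "s = [:\<gamma>:]" unfolding is_unit_poly_iff by blast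
  with \<open>s dvd 1\<close> have "\<gamma> \<noteq> 0" by auto
  then show thesis using that[of \<gamma>] P unfolding \<gamma> by blast
qed

lemma degree_restrict:
  assumes "homogeneous n h" "mp_eval id (vector [0, 1, \<beta>]) h \<noteq> 0"
  shows "degree (r h) = n"
  using restrict_homogeneous(1,2)[OF assms(1), of \<alpha> \<beta>] assms(2) le_degree[of "r h" n] by simp

text \<open>An entry of \<open>g\<close> that is nonzero at infinity keeps its full degree
  \<open>m - 1\<close> on the line. The relation of \<open>koszul\<close> makes the same entry of
  \<open>P\<close> nonzero at infinity, so it keeps degree \<open>d1 + d2\<close>, and
  \<open>saito\<close> equates the two.\<close>

lemma degree_P:
  obtains i where "degree (rv P $ i) = d1 + d2" "rv P $ i \<noteq> 0" and "d1 + d2 = m - 1"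
proof -
  obtain D where D: "\<And>i j. g $ i * g $ j = D i * P $ j" by (rule koszul) blast
  obtain \<gamma> where \<gamma>: "\<gamma> \<noteq> 0" "rv P = [:\<gamma>:] *s rv g" by (rule saito)
  obtain i where i: "mp_eval id (vector [0, 1, \<beta>]) (g $ i) \<noteq> 0"
    using smooth_infinity by (auto simp only: g_def vec_lambda_beta)
  have "mp_eval id (vector [0, 1, \<beta>]) (g $ i) * mp_eval id (vector [0, 1, \<beta>]) (g $ i)
      = mp_eval id (vector [0, 1, \<beta>]) (D i) * mp_eval id (vector [0, 1, \<beta>]) (P $ i)"
    by (simp only: mp_eval_mult[OF ring_morphism_id, symmetric] D)
  then have "mp_eval id (vector [0, 1, \<beta>]) (P $ i) \<noteq> 0"
    using i by auto
  then have 1: "degree (rv P $ i) = d1 + d2"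
    unfolding rv_component by (rule degree_restrict[OF homogeneous_cross[OF b c]])
  have 2: "degree (rv g $ i) = m - 1"
    unfolding rv_component by (rule degree_restrict[OF homogeneous_g i])
  have 3: "degree (rv P $ i) = degree (rv g $ i)"
    using \<gamma>(1) by (simp add: \<gamma>(2) del: rv_component)
  have "coeff (r (g $ i)) (m - 1) \<noteq> 0"
    using restrict_homogeneous(2)[OF homogeneous_g] i by simp
  then have "rv P $ i \<noteq> 0"
    using \<gamma> by (auto simp del: rv_component) (auto simp: rv_def)
  then show thesis using that 1 2 3 by simp
qed

lemma exponents: "d1 + d2 = m - 1"
  by (rule degree_P)

lemma cancel_P:
  assumes "cross a (rv c) = 0" "cross (rv b) a = 0"
  shows "a = 0"
proof -
  obtain i where i: "rv P $ i \<noteq> 0" by (rule degree_P)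
  have "a $ k * rv P $ i = 0" for k
    using cross_dot_cancel[OF assms, of k i] by (simp only: rv_cross)
  then have "a $ k = 0" for k using i by (metis mult_eq_0_iff)
  then show ?thesis by (simp add: vec_eq_iff)
qed

text \<open>Such a cross product is a multiple of \<open>rv g\<close>, which on the line differs
  from \<open>rv P\<close> by a nonzero constant. The factor \<open>p\<close> is a numerator
  quotient in Cramer's rule.\<close>

lemma multiple_of_P:
  assumes "dot a (rv g) = 0" "dot a' (rv g) = 0"
  obtains p where "cross a a' = p *s rv P"
proof -
  obtain e where e: "dot e (rv g) = 1" by (rule rv_g_primitive)
  obtain \<gamma> where \<gamma>: "\<gamma> \<noteq> 0" "rv P = [:\<gamma>:] *s rv g" by (rule saito)
  have "cross a a' = dot e (cross a a') *s rv g"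
    by (rule parallel_primitive[OF cross_parallel[OF assms] e])
  also have "rv g = [:inverse \<gamma>:] *s rv P"
    using \<gamma>(1) by (simp add: \<gamma>(2) vec_eq_iff del: rv_component)
  finally have "cross a a' = (dot e (cross a a') * [:inverse \<gamma>:]) *s rv P"
    by (simp only: vector_smult_assoc)
  then show thesis by (rule that)
qed

text \<open>Comparing degrees in an entry where \<open>rv P\<close> has degree
  \<open>d1 + d2\<close> gives \<open>degree p + d' \<le> n\<close>. The conclusion speaks of
  \<open>h * x\<close> rather than of \<open>h\<close> to include \<open>p = 0\<close>, where
  \<open>n\<close> may be smaller than \<open>d'\<close>.\<close>

lemma lift_coefficient:
  assumes "cross a a' = p *s rv P" and "\<And>i. degree (cross a a' $ i) \<le> n + d" and "d' + d = d1 + d2"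
  obtains h where "r h = p" "\<And>x. homogeneous d' x \<Longrightarrow> homogeneous n (h * x)"
proof (cases "p = 0")
  case True
  show thesis by (rule that[of 0]) (simp_all add: True restrict_simps)
next
  case False
  obtain i where i: "degree (rv P $ i) = d1 + d2" "rv P $ i \<noteq> 0" by (rule degree_P)
  have "degree p + (d1 + d2) = degree (p * rv P $ i)"
    using False i by (simp add: degree_mult_eq)
  also have "\<dots> \<le> n + d"
    using assms(2)[of i] by (simp add: assms(1))
  finally have le: "degree p + d' \<le> n" using assms(3) by simp
  show thesis
  proof (rule that)
    show "r (homogenize (Var 1) (Var 2) (n - d') p) = p"
      using le by (intro restrict_homogenize) simp
    show "homogeneous n (homogenize (Var 1) (Var 2) (n - d') p * x)" if "homogeneous d' x" for x
      using homogeneous_mult[OF homogeneous_homogenize[OF homogeneous_Var homogeneous_Var] that, of "n - d'" 1 2 p] le by simp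
  qed
qed

lemma restrict_0_dvd:
  assumes "homogeneous n h" "r h = 0"
  shows "l dvd h"
  using restrict_homogeneous(3)[OF assms(1), of \<alpha> \<beta>] assms(2) by simp

text \<open>Write \<open>l * h = dot a g\<close>. On the line, \<open>a\<close> is a syzygy of the
  gradient and hence a combination of \<open>b\<close> and \<open>c\<close>. Subtracting a lift of
  this combination does not change \<open>dot a g\<close> and leaves a vector that vanishes on the
  line, so it is divisible by \<open>l\<close>, and \<open>l\<close> cancels.\<close>

lemma nonzerodivisor_homogeneous:
  assumes h: "homogeneous n h" and lh: "l * h \<in> J"
  shows "h \<in> J"
proof -
  obtain a0 where a0: "l * h = dot a0 g" using lh J_iff by blast
  have "homogeneous (Suc n) (l * h)"
    using homogeneous_mult[OF homogeneous_line h] by simp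
  then have "l * h = hcomp (Suc n) (l * h)"
    by (simp add: hcomp_homogeneous)
  also have "\<dots> = (\<Sum>i\<in>UNIV. hcomp (Suc n) (a0 $ i * g $ i))"
    unfolding a0 dot_def by (rule hcomp_sum)
  finally have lh': "l * h = (\<Sum>i\<in>UNIV. if m - 1 \<le> Suc n then hcomp (Suc n - (m - 1)) (a0 $ i) * g $ i else 0)"
    by (simp only: hcomp_mult[OF homogeneous_g])
  show ?thesis
  proof (cases "m - 1 \<le> Suc n")
    case False
    then have "l * h = 0" using lh' by simp
    then have "h = 0" using line_nonzero[of \<alpha> \<beta>] by simp
    then show ?thesis using is_ideal_0[OF is_ideal_jacobian] by simp
  next
    case True
    define n' where "n' = Suc n - (m - 1)"
    define a where "a = (\<chi> i. hcomp n' (a0 $ i))"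
    have a: "homogeneous n' (a $ i)" for i by (simp add: a_def)
    have ag: "l * h = dot a g"
      using lh' True by (simp add: dot_def a_def n'_def)
    have "r (l * h) = 0"
      by (simp only: ring_morphism_mult[OF ring_morphism_restrict] restrict_line mult_zero_left)
    then have da: "dot (rv a) (rv g) = 0" by (simp only: ag rv_dot)
    have db: "dot (rv b) (rv g) = 0" "dot (rv c) (rv g) = 0"
      by (simp_all only: rv_dot[symmetric] dot_b dot_c ring_morphism_0[OF ring_morphism_restrict])
    \<comment> \<open>Cramer's rule: if \<open>rv a = p *s rv b + q *s rv c\<close>, then crossing
      with \<open>rv c\<close> and \<open>rv b\<close> isolates \<open>p\<close> and
      \<open>q\<close>.\<close>
    obtain p where p: "cross (rv a) (rv c) = p *s rv P" by (rule multiple_of_P[OF da db(2)])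
    obtain q where q: "cross (rv b) (rv a) = q *s rv P" by (rule multiple_of_P[OF db(1) da])
    have "degree (cross (rv a) (rv c) $ i) \<le> n' + d2" for i
      unfolding rv_cross[symmetric] rv_component by (rule restrict_homogeneous(1)[OF homogeneous_cross[OF a c]])
    then obtain p' where p': "r p' = p" "\<And>x. homogeneous d1 x \<Longrightarrow> homogeneous n' (p' * x)"
      by (rule lift_coefficient[OF p, where d' = d1]) auto
    have "degree (cross (rv b) (rv a) $ i) \<le> n' + d1" for i
      unfolding rv_cross[symmetric] rv_component using restrict_homogeneous(1)[OF homogeneous_cross[OF b a]]
      by (simp only: add.commute)
    then obtain q' where q': "r q' = q" "\<And>x. homogeneous d2 x \<Longrightarrow> homogeneous n' (q' * x)"
      by (rule lift_coefficient[OF q, where d' = d2]) auto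
    define e where "e = a - p' *s b - q' *s c"
    have e: "homogeneous n' (e $ i)" for i
      unfolding e_def vector_minus_component vector_smult_component
      by (intro homogeneous_diff a p'(2) q'(2) b c)
    have rve: "rv e = rv a - p *s rv b - q *s rv c"
      by (simp add: vec_eq_iff e_def restrict_simps p' q')
    have "cross (rv e) (rv c) = cross (rv a) (rv c) - p *s cross (rv b) (rv c)"
      unfolding rve by (simp add: vec_eq_iff forall_3 algebra_simps)
    then have 1: "cross (rv e) (rv c) = 0"
      by (simp only: p rv_cross diff_self)
    have "cross (rv b) (rv e) = cross (rv b) (rv a) - q *s cross (rv b) (rv c)"
      unfolding rve by (simp add: vec_eq_iff forall_3 algebra_simps)
    then have 2: "cross (rv b) (rv e) = 0"
      by (simp only: q rv_cross diff_self)
    \<comment> \<open>A vector parallel to both \<open>rv b\<close> and \<open>rv c\<close> vanishes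
      because their cross product \<open>rv P\<close> does not.\<close>
    have "rv e = 0" by (rule cancel_P[OF 1 2])
    then have "r (e $ i) = 0" for i by (metis rv_component zero_index)
    then have "l dvd e $ i" for i by (intro restrict_0_dvd[OF e])
    then have "\<forall>i. \<exists>x. e $ i = l * x" by (auto simp: dvd_def)
    then obtain x where x: "\<And>i. e $ i = l * x i" unfolding choice_iff by blast
    have "dot e g = dot a g - p' * dot b g - q' * dot c g"
      by (simp add: e_def dot_3 algebra_simps)
    then have "l * h = dot e g"
      by (simp add: ag dot_b dot_c)
    also have "\<dots> = l * dot (\<chi> i. x i) g"
      by (simp add: dot_3 x algebra_simps)
    finally have "h = dot (\<chi> i. x i) g"
      using line_nonzero[of \<alpha> \<beta>] by simp
    then show ?thesis using J_iff by blast
  qed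
qed

lemma nonzerodivisor:
  assumes "l * h \<in> J"
  shows "h \<in> J"
proof -
  have "hcomp n h \<in> J" for n
  proof (rule nonzerodivisor_homogeneous[of n])
    have "hcomp (Suc n) (h * l) = hcomp n h * l"
      using hcomp_mult[OF homogeneous_line, of "Suc n" h \<alpha> \<beta>] by simp
    then have "l * hcomp n h = hcomp (Suc n) (l * h)"
      by (simp only: mult.commute)
    then show "l * hcomp n h \<in> J"
      using hcomp_jacobian[OF f(1) assms] by simp
  qed simp
  moreover obtain N where "h = (\<Sum>n<N. hcomp n h)" by (rule obtain_hcomp_bound)
  ultimately show ?thesis
    using is_ideal_sum[OF is_ideal_jacobian, of "{..<N}" "\<lambda>n. hcomp n h" f] by simp
qed

text \<open>Writing the degree as \<open>n + (d1 + d2)\<close> lets the coefficients of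
  \<open>b\<close> and \<open>c\<close> have degrees \<open>n + d2\<close> and
  \<open>n + d1\<close>, without subtraction.\<close>

lemma dim_AR:
  "mpoly_vec_vs.dim {a \<in> homogeneous_vecs (n + (d1 + d2)). dot a g = 0}
     = card (monomials (n + d2) :: (3 \<Rightarrow>\<^sub>0 nat) set) + card (monomials (n + d1) :: (3 \<Rightarrow>\<^sub>0 nat) set)"
proof (rule dim_free_submodule)
  show "p = 0 \<and> q = 0" if "p *s b + q *s c = 0" for p q
    using that by (rule independent)
  show "{a \<in> homogeneous_vecs (n + (d1 + d2)). dot a g = 0}
     = {p *s b + q *s c | p q. homogeneous (n + d2) p \<and> homogeneous (n + d1) q}" (is "?A = ?B")
  proof (intro equalityI subsetI)
    fix a assume "a \<in> ?A"
    then have a: "\<And>i. homogeneous (n + (d1 + d2)) (a $ i)" and 0: "dot a g = 0"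
      by (auto simp: homogeneous_vecs_def)
    obtain p q where pq: "a = p *s b + q *s c" by (rule AR_combination[OF 0])
    have "a $ i = hcomp (n + d2) p * b $ i + hcomp (n + d1) q * c $ i" for i
    proof -
      have "a $ i = hcomp (n + (d1 + d2)) (a $ i)"
        using hcomp_homogeneous[OF a[of i], of "n + (d1 + d2)"] by simp
      also have "\<dots> = hcomp (n + (d1 + d2)) (p * b $ i) + hcomp (n + (d1 + d2)) (q * c $ i)"
        by (simp only: pq vector_add_component vector_smult_component hcomp_add)
      finally show ?thesis
        by (simp add: hcomp_mult[OF b] hcomp_mult[OF c])
    qed
    then have "a = hcomp (n + d2) p *s b + hcomp (n + d1) q *s c"
      by (simp add: vec_eq_iff)
    then show "a \<in> ?B" using homogeneous_hcomp by blast
  next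
    fix a assume "a \<in> ?B"
    then obtain p q where pq: "a = p *s b + q *s c" "homogeneous (n + d2) p" "homogeneous (n + d1) q" by blast
    have e: "n + d2 + d1 = n + (d1 + d2)" "n + d1 + d2 = n + (d1 + d2)" by simp_all
    have "homogeneous (n + (d1 + d2)) (a $ i)" for i
      unfolding pq vector_add_component vector_smult_component
      using homogeneous_mult[OF pq(2) b[of i]] homogeneous_mult[OF pq(3) c[of i]] unfolding e
      by (rule homogeneous_add)
    moreover have "a \<in> AR f" unfolding AR using pq(1) by blast
    ultimately show "a \<in> ?A" by (simp add: homogeneous_vecs_def AR_iff)
  qed
qed

lemma linear_dot: "Vector_Spaces.linear (\<lambda>c a. Const c *s a) (\<lambda>c p. Const c * p) (\<lambda>a. dot a g)"
  by unfold_locales (simp_all add: dot_3 Const_add Const_mult algebra_simps)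

text \<open>Rank-nullity for \<open>dot a g\<close>, which raises the degree by
  \<open>m - 1 = d1 + d2\<close> and has the syzygies as kernel.\<close>

lemma dim_jacobian:
  "mpoly_vs.dim {h \<in> J. homogeneous (n + 2 * (d1 + d2)) h}
     + mpoly_vec_vs.dim {a \<in> homogeneous_vecs (n + (d1 + d2)). dot a g = 0}
   = 3 * card (monomials (n + (d1 + d2)) :: (3 \<Rightarrow>\<^sub>0 nat) set)"
proof -
  let ?n = "n + (d1 + d2)"
  have deg: "?n + (m - 1) = n + 2 * (d1 + d2)" using exponents by simp
  have "(\<lambda>a. dot a g) ` homogeneous_vecs ?n = {h \<in> J. homogeneous (n + 2 * (d1 + d2)) h}" (is "?L = ?R")
  proof (intro equalityI subsetI)
    fix h assume "h \<in> ?L"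
    then obtain a :: "3 mpoly ^ 3" where a: "h = dot a g" "\<And>i. homogeneous ?n (a $ i)" by (auto simp: homogeneous_vecs_def)
    have "homogeneous (?n + (m - 1)) h"
      unfolding a(1) dot_def by (intro homogeneous_sum homogeneous_mult a(2) homogeneous_g)
    then show "h \<in> ?R" using a(1) unfolding deg by (auto simp: J_iff)
  next
    fix h assume "h \<in> ?R"
    then obtain a where a: "h = dot a g" and h: "homogeneous (n + 2 * (d1 + d2)) h" using J_iff by blast
    have "h = hcomp (?n + (m - 1)) (dot a g)"
      using hcomp_homogeneous[OF h, of "?n + (m - 1)"] unfolding deg by (simp add: a)
    also have "\<dots> = dot (\<chi> i. hcomp ?n (a $ i)) g"
      unfolding dot_def hcomp_sum hcomp_mult[OF homogeneous_g] by simp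
    finally show "h \<in> ?L"
      by (rule image_eqI) (simp add: homogeneous_vecs_def)
  qed
  then show ?thesis
    using linear.dim_image_kernel[OF linear_dot subspace_homogeneous_vecs homogeneous_vecs_span, of ?n]
    by (simp add: dim_homogeneous_vecs)
qed

text \<open>The Hilbert function of the quotient by \<open>J\<close>, from degree
  \<open>2 * (d1 + d2)\<close> on: the alternating sum of the four monomial counts is
  \<open>(d1 + d2)\<^sup>2 - d1 * d2\<close>, independent of \<open>n\<close>. The set
  \<open>T\<close> represents a basis of the graded piece.\<close>

lemma complement_of_jacobian:
  obtains T where "finite T" "card T + d1 * d2 = (m - 1)\<^sup>2"
    "\<And>t. t \<in> T \<Longrightarrow> homogeneous (n + 2 * (d1 + d2)) t"
    "\<And>x. (\<Sum>t\<in>T. Const (x t) * t) \<in> J \<Longrightarrow> \<forall>t\<in>T. x t = 0"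
    "\<And>u. homogeneous (n + 2 * (d1 + d2)) u \<Longrightarrow> \<exists>x. u - (\<Sum>t\<in>T. Const (x t) * t) \<in> J"
proof -
  let ?N = "n + 2 * (d1 + d2)"
  let ?S = "{p :: 3 mpoly. homogeneous ?N p}"
  let ?J = "{h \<in> J. homogeneous ?N h}"
  have sub: "mpoly_vs.subspace ?J"
    by (rule mpoly_vs.subspaceI)
       (auto simp: is_ideal_0[OF is_ideal_jacobian] is_ideal_add[OF is_ideal_jacobian]
          is_ideal_mult[OF is_ideal_jacobian] homogeneous_add homogeneous_Const_mult)
  have span: "?S \<subseteq> mpoly_vs.span ((\<lambda>e. Poly_Mapping.single e 1) ` monomials ?N)"
  proof
    fix p :: "3 mpoly" assume "p \<in> ?S"
    then have eq: "p = (\<Sum>e\<in>monomials ?N. Const (Poly_Mapping.lookup p e) * Poly_Mapping.single e 1)"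
      by (intro homogeneous_sum_monomials) simp
    show "p \<in> mpoly_vs.span ((\<lambda>e. Poly_Mapping.single e 1) ` monomials ?N)"
      by (subst eq, intro mpoly_vs.span_sum) (intro mpoly_vs.span_scale mpoly_vs.span_base, blast)
  qed
  obtain T where T: "finite T" "T \<subseteq> ?S" "card T + mpoly_vs.dim ?J = mpoly_vs.dim ?S"
    "\<And>x. (\<Sum>t\<in>T. Const (x t) * t) \<in> ?J \<Longrightarrow> \<forall>t\<in>T. x t = 0"
    "\<And>u. u \<in> ?S \<Longrightarrow> \<exists>x. u - (\<Sum>t\<in>T. Const (x t) * t) \<in> ?J"
    by (rule mpoly_vs.complement_basis[OF sub _ span]) auto
  let ?c = "\<lambda>k. card (monomials k :: (3 \<Rightarrow>\<^sub>0 nat) set)"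
  have "mpoly_vs.dim ?J + (?c (n + d2) + ?c (n + d1)) = 3 * ?c (n + (d1 + d2))"
    using dim_jacobian[of n] by (simp only: dim_AR)
  moreover have "card T + mpoly_vs.dim ?J = ?c ?N"
    using T(3) by (simp only: dim_homogeneous)
  ultimately have "2 * card T + 3 * (2 * ?c (n + (d1 + d2))) = 2 * ?c ?N + 2 * ?c (n + d2) + 2 * ?c (n + d1)"
    by linarith
  then have "2 * card T + 3 * ((n + (d1 + d2) + 1) * (n + (d1 + d2) + 2))
     = (?N + 1) * (?N + 2) + (n + d2 + 1) * (n + d2 + 2) + (n + d1 + 1) * (n + d1 + 2)"
    unfolding card_monomials_3 by simp
  then have "card T + d1 * d2 = (d1 + d2)\<^sup>2"
    by (simp add: power2_eq_square algebra_simps)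
  then have card: "card T + d1 * d2 = (m - 1)\<^sup>2"
    by (simp only: exponents)
  have hom: "homogeneous ?N (\<Sum>t\<in>T. Const (x t) * t)" for x
    using T(2) by (intro homogeneous_sum homogeneous_Const_mult) auto
  show thesis
  proof (rule that[OF T(1) card])
    show "homogeneous ?N t" if "t \<in> T" for t using that T(2) by auto
    show "\<forall>t\<in>T. x t = 0" if "(\<Sum>t\<in>T. Const (x t) * t) \<in> J" for x
      using that hom[of x] by (intro T(4)) simp
    show "\<exists>x. u - (\<Sum>t\<in>T. Const (x t) * t) \<in> J" if "homogeneous ?N u" for u
      using T(5)[of u] that by blast
  qed
qed

text \<open>The \<open>n + 1\<close> forms \<open>l ^ (n - j) * Var i ^ j\<close> outnumber a basis
  of their graded piece modulo \<open>J\<close>. A dependence among them is the homogenization of a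
  univariate polynomial, which splits over \<complex>.\<close>

lemma integral: "\<exists>bs. (\<Prod>b\<leftarrow>bs. Var i - Const b * l) \<in> J"
proof -
  \<comment> \<open>The first summand bounds \<open>card T\<close>, so that there are more forms
    than basis elements; the second puts the degree in the range of
    \<open>complement_of_jacobian\<close>.\<close>
  define n where "n = (m - 1)\<^sup>2 + 2 * (d1 + d2)"
  obtain T where T: "finite T" "card T + d1 * d2 = (m - 1)\<^sup>2"
    "\<And>u. homogeneous n u \<Longrightarrow> \<exists>x. u - (\<Sum>t\<in>T. Const (x t) * t) \<in> J"
    unfolding n_def by (rule complement_of_jacobian[of "(m - 1)\<^sup>2"]) blast
  define u where "u j = l ^ (n - j) * Var i ^ j" for j
  have hu: "homogeneous n (u j)" if "j \<le> n" for j
  proof -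
    have "homogeneous ((n - j) * 1 + j * 1) (u j)"
      unfolding u_def by (intro homogeneous_mult homogeneous_power homogeneous_line homogeneous_Var)
    then show ?thesis using that by simp
  qed
  have "\<forall>j. \<exists>x. j \<le> n \<longrightarrow> u j - (\<Sum>t\<in>T. Const (x t) * t) \<in> J"
    using T(3)[OF hu] by blast
  then have "\<exists>y. \<forall>j. j \<le> n \<longrightarrow> u j - (\<Sum>t\<in>T. Const (y j t) * t) \<in> J"
    unfolding choice_iff .
  then obtain y where y: "\<And>j. j \<le> n \<Longrightarrow> u j - (\<Sum>t\<in>T. Const (y j t) * t) \<in> J" by blast
  have "card T < card {..n}" using T(2) by (simp add: n_def)
  then obtain x where x: "\<exists>j\<in>{..n}. x j \<noteq> 0" "\<And>t. t \<in> T \<Longrightarrow> (\<Sum>j\<in>{..n}. x j * y j t) = 0"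
    by (rule underdetermined_system[OF T(1) finite_atMost, where c = "\<lambda>t j. y j t"]) blast
  define q where "q = (\<Sum>j\<le>n. monom (x j) j)"
  have coeff_q: "coeff q k = x k" if "k \<le> n" for k
    using that by (simp add: q_def coeff_sum)
  have "q \<noteq> 0" using x(1) coeff_q by auto
  have deg: "degree q \<le> n"
    unfolding q_def by (intro degree_sum_le) (auto intro: le_trans[OF degree_monom_le])
  have "(\<Sum>j\<le>n. Const (x j) * (\<Sum>t\<in>T. Const (y j t) * t)) = (\<Sum>j\<le>n. \<Sum>t\<in>T. Const (x j * y j t) * t)"
    by (simp only: sum_distrib_left Const_mult mult.assoc)
  also have "\<dots> = (\<Sum>t\<in>T. \<Sum>j\<le>n. Const (x j * y j t) * t)"
    by (rule sum.swap)
  also have "\<dots> = (\<Sum>t\<in>T. Const (\<Sum>j\<le>n. x j * y j t) * t)"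
    by (simp only: ring_morphism_sum[OF ring_morphism_Const] sum_distrib_right)
  also have "\<dots> = 0"
    by (rule sum.neutral) (simp add: x(2))
  finally have zero: "(\<Sum>j\<le>n. Const (x j) * (\<Sum>t\<in>T. Const (y j t) * t)) = 0" .
  have "homogenize l (Var i) n q = (\<Sum>j\<le>n. Const (x j) * u j)"
    unfolding homogenize_def by (rule sum.cong) (simp_all add: coeff_q u_def mult.assoc)
  also have "\<dots> = (\<Sum>j\<le>n. Const (x j) * (u j - (\<Sum>t\<in>T. Const (y j t) * t)))"
    by (simp only: right_diff_distrib sum_subtractf zero diff_zero)
  also have "\<dots> \<in> J"
    by (intro is_ideal_sum[OF is_ideal_jacobian] is_ideal_mult[OF is_ideal_jacobian] y) simp
  finally have mem: "homogenize l (Var i) n q \<in> J" .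
  obtain A where A: "size A = degree q" "q = smult (lead_coeff q) (\<Prod>b\<in>#A. [:- b, 1:])"
    using alg_closed_imp_factorization[OF \<open>q \<noteq> 0\<close>] by blast
  obtain bs where bs: "mset bs = A" using ex_mset by blast
  have len: "length bs = degree q" using A(1) bs by (metis size_mset)
  have q: "q = smult (lead_coeff q) (\<Prod>b\<leftarrow>bs. [:- b, 1:])"
    using A(2) by (simp only: bs[symmetric] mset_map[symmetric] prod_mset_prod_list)
  have "degree (\<Prod>b\<leftarrow>bs. [:- b, 1:]) = degree q"
    using arg_cong[OF q, of degree] \<open>q \<noteq> 0\<close> by (simp only: degree_smult_eq leading_coeff_0_iff if_False)
  then have deg': "degree (\<Prod>b\<leftarrow>bs. [:- b, 1:]) \<le> length bs" by (simp only: len)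
  \<comment> \<open>If the dependence \<open>q\<close> has degree less than \<open>n\<close>, its
    homogenization carries the factor \<open>l ^ k\<close>, which is cancelled at the end.\<close>
  define k where "k = n - degree q"
  have n: "n = k + length bs" using deg by (simp add: k_def len)
  let ?Q = "\<Prod>b\<leftarrow>bs. Var i - Const b * l"
  have "homogenize l (Var i) n q = Const (lead_coeff q) * homogenize l (Var i) n (\<Prod>b\<leftarrow>bs. [:- b, 1:])"
    by (subst q) (rule homogenize_smult)
  also have "\<dots> = Const (lead_coeff q) * (l ^ k * ?Q)"
    unfolding n homogenize_power[OF deg'] homogenize_prod_list ..
  finally have "Const (inverse (lead_coeff q)) * (Const (lead_coeff q) * (l ^ k * ?Q)) \<in> J"
    using is_ideal_mult[OF is_ideal_jacobian mem] by (simp only:)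
  also have "Const (inverse (lead_coeff q)) * (Const (lead_coeff q) * (l ^ k * ?Q))
      = Const (inverse (lead_coeff q) * lead_coeff q) * (l ^ k * ?Q)"
    by (simp only: Const_mult mult.assoc)
  also have "\<dots> = l ^ k * ?Q"
    using \<open>q \<noteq> 0\<close> by simp
  finally have "l ^ k * ?Q \<in> J" .
  then have "?Q \<in> J"
    by (induction k) (auto simp: mult.assoc intro: nonzerodivisor)
  then show ?thesis by blast
qed

theorem saturated: "saturated_jacobian f l m"
  by unfold_locales (rule f homogeneous_line integral nonzerodivisor; assumption?)+

end

section \<open>Singular points of arrangements\<close>

text \<open>Isolating neighbourhoods can be taken from a countable basis, and distinct points then
  receive distinct basis sets.\<close>

lemma countable_discrete:
  fixes S :: "'a::second_countable_topology set"
  assumes "discrete S"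
  shows "countable S"
proof -
  obtain B :: "'a set set" where B: "countable B" "topological_basis B"
    using ex_countable_basis by blast
  have "\<exists>U\<in>B. U \<inter> S = {x}" if x: "x \<in> S" for x
  proof -
    obtain T where T: "open T" "T \<inter> S = {x}"
      using discreteD[OF assms x] unfolding isolated_in_def by blast
    then have "x \<in> T" by blast
    with B(2) T(1) obtain U where "U \<in> B" "x \<in> U" "U \<subseteq> T"
      by (rule topological_basisE)
    then have "U \<in> B" "U \<inter> S = {x}" using T(2) x by auto
    then show ?thesis by blast
  qed
  then have "\<forall>x. \<exists>U. x \<in> S \<longrightarrow> U \<in> B \<and> U \<inter> S = {x}" by blast
  then obtain U where U: "\<And>x. x \<in> S \<Longrightarrow> U x \<in> B \<and> U x \<inter> S = {x}"
    unfolding choice_iff by blast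
  have "inj_on U S"
  proof (rule inj_onI)
    fix x y assume xy: "x \<in> S" "y \<in> S" "U x = U y"
    have "{x} = U x \<inter> S" using U[OF xy(1)] by blast
    also have "\<dots> = U y \<inter> S" by (simp only: xy(3))
    also have "\<dots> = {y}" using U[OF xy(2)] by blast
    finally show "x = y" by simp
  qed
  moreover have "countable (U ` S)"
    using U by (intro countable_subset[OF _ B(1)]) blast
  ultimately show ?thesis by (rule countable_image_inj_on[rotated])
qed

lemma mp_eval_has_derivative:
  fixes y :: "complex ^ 'v::finite"
  shows "((\<lambda>x. mp_eval id x p) has_derivative (\<lambda>v. \<Sum>i\<in>UNIV. mp_eval id y (mp_deriv i p) * v $ i)) (at y)"
proof (induction p rule: mpoly_induct)
  case (Const c)
  show ?case by (simp add: mp_eval_Const[OF ring_morphism_id])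
next
  case (Var k p)
  have "((\<lambda>x. x $ k) has_derivative (\<lambda>v. v $ k)) (at y)"
    by (rule bounded_linear.has_derivative[OF bounded_linear_vec_nth has_derivative_ident])
  from has_derivative_mult[OF this Var]
  have *: "((\<lambda>x. x $ k * mp_eval id x p) has_derivative
     (\<lambda>v. y $ k * (\<Sum>i\<in>UNIV. mp_eval id y (mp_deriv i p) * v $ i) + v $ k * mp_eval id y p)) (at y)" .
  have eq: "(\<Sum>i\<in>UNIV. mp_eval id y (mp_deriv i (Var k * p)) * v $ i)
     = y $ k * (\<Sum>i\<in>UNIV. mp_eval id y (mp_deriv i p) * v $ i) + v $ k * mp_eval id y p" for v
  proof -
    have "(\<Sum>i\<in>UNIV. mp_eval id y (mp_deriv i (Var k * p)) * v $ i)
      = (\<Sum>i\<in>UNIV. (if i = k then v $ k * mp_eval id y p else 0) + y $ k * (mp_eval id y (mp_deriv i p) * v $ i))"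
    proof (rule sum.cong[OF refl])
      fix i
      show "mp_eval id y (mp_deriv i (Var k * p)) * v $ i
        = (if i = k then v $ k * mp_eval id y p else 0) + y $ k * (mp_eval id y (mp_deriv i p) * v $ i)"
        unfolding mp_deriv_Var_mult mp_eval_add[OF ring_morphism_id] mp_eval_mult[OF ring_morphism_id]
          mp_eval_Var[OF ring_morphism_id] distrib_right
        by (cases "i = k") simp_all
    qed
    then show ?thesis by (simp add: sum.distrib sum_distrib_left)
  qed
  show ?case
    unfolding eq mp_eval_mult[OF ring_morphism_id] mp_eval_Var[OF ring_morphism_id] by (rule *)
next
  case (add p q)
  from has_derivative_add[OF add] show ?case
    unfolding mp_deriv_add mp_eval_add[OF ring_morphism_id] distrib_right sum.distrib .
qed

text \<open>The condition on \<open>v\<close> says that the map \<open>\<Phi>\<close> formed by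
  \<open>g\<close>, \<open>h\<close> and the coordinate \<open>i\<close> has injective derivative at
  \<open>y\<close>. An injective linear map is bounded below, so \<open>\<Phi>\<close> cannot repeat
  its value near \<open>y\<close>, while it is constant on \<open>Z\<close>.\<close>

lemma isolated_common_zero:
  fixes g h :: "3 mpoly" and i :: 3
  defines "Z \<equiv> {y :: complex ^ 3. mp_eval id y g = 0 \<and> mp_eval id y h = 0 \<and> y $ i = 1 \<and>
     (\<forall>v. (\<Sum>j\<in>UNIV. mp_eval id y (mp_deriv j g) * v $ j) = 0 \<longrightarrow>
          (\<Sum>j\<in>UNIV. mp_eval id y (mp_deriv j h) * v $ j) = 0 \<longrightarrow> v $ i = 0 \<longrightarrow> v = 0)}"
  shows "countable Z"
proof (rule countable_discrete, rule discreteI)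
  fix y assume y: "y \<in> Z"
  define \<Phi> where "\<Phi> x = (mp_eval id x g, mp_eval id x h, x $ i)" for x :: "complex ^ 3"
  define D where "D v = (\<Sum>j\<in>UNIV. mp_eval id y (mp_deriv j g) * v $ j,
     \<Sum>j\<in>UNIV. mp_eval id y (mp_deriv j h) * v $ j, v $ i)" for v :: "complex ^ 3"
  have "(\<Phi> has_derivative D) (at y)"
    unfolding \<Phi>_def[abs_def] D_def[abs_def]
    by (intro has_derivative_Pair mp_eval_has_derivative)
       (rule bounded_linear.has_derivative[OF bounded_linear_vec_nth has_derivative_ident])
  then have D: "bounded_linear D"
    and approx: "\<And>e. e > 0 \<Longrightarrow> \<exists>d>0. \<forall>x. norm (x - y) < d \<longrightarrow> norm (\<Phi> x - \<Phi> y - D (x - y)) \<le> e * norm (x - y)"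
    unfolding has_derivative_at_alt by blast+
  have lin: "linear D" using D by (rule bounded_linear.linear)
  have "v = 0" if "D v = 0" for v
    using y that unfolding Z_def D_def by (simp add: zero_prod_def)
  then have "inj D" unfolding linear_injective_0[OF lin] by blast
  then obtain B where B: "B > 0" "\<And>x. B * norm x \<le> norm (D x)"
    using linear_inj_bounded_below_pos[OF lin] by blast
  \<comment> \<open>With \<open>B\<close> the lower bound of the derivative, a linearization error
    of \<open>B / 2\<close> contradicts equal values of \<open>\<Phi>\<close> at two distinct
    points.\<close>
  then obtain d where d: "d > 0" "\<And>x. norm (x - y) < d \<Longrightarrow> norm (\<Phi> x - \<Phi> y - D (x - y)) \<le> B / 2 * norm (x - y)"
    using approx[of "B / 2"] by auto
  have "x = y" if x: "x \<in> Z" "norm (x - y) < d" for x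
  proof -
    have "\<Phi> x = \<Phi> y" using x(1) y unfolding Z_def \<Phi>_def by simp
    then have "norm (D (x - y)) \<le> B / 2 * norm (x - y)"
      using d(2)[OF x(2)] by simp
    with B(2)[of "x - y"] have "B * norm (x - y) \<le> B / 2 * norm (x - y)" by linarith
    then have "norm (x - y) \<le> 0" using B(1) by simp
    then show ?thesis by simp
  qed
  then have "ball y d \<inter> Z = {y}"
    using y d(1) by (auto simp: dist_norm norm_minus_commute)
  then show "y isolated_in Z"
    using y by (intro isolated_inI[of _ _ "ball y d"]) auto
qed

text \<open>By Euler's identity both gradients are orthogonal to the point \<open>x\<close> as well
  as to \<open>v\<close>. Were \<open>v\<close> not parallel to \<open>x\<close>, both would be
  nonzero multiples of their cross product, and the tangent spaces would agree.\<close>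

lemma transversal_kernel:
  assumes g: "homogeneous n g" and h: "homogeneous k h" and p: "transversal_at g h p"
    and v: "(\<Sum>j\<in>UNIV. mp_eval id (rep_proj p) (mp_deriv j g) * v $ j) = 0"
           "(\<Sum>j\<in>UNIV. mp_eval id (rep_proj p) (mp_deriv j h) * v $ j) = 0"
  shows "cross (rep_proj p) v = 0"
proof (rule ccontr)
  let ?x = "rep_proj p"
  define a where "a = (\<chi> j. mp_eval id ?x (mp_deriv j g))"
  define b where "b = (\<chi> j. mp_eval id ?x (mp_deriv j h))"
  assume "cross ?x v \<noteq> 0"
  then obtain i where i: "cross ?x v $ i \<noteq> 0" by (auto simp: vec_eq_iff)
  have z: "mp_eval id ?x g = 0" "mp_eval id ?x h = 0"
    and ns: "p \<notin> sing_locus g" "p \<notin> sing_locus h" "p \<in> zero_locus g" "p \<in> zero_locus h"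
    and ne: "tangent_space g p \<noteq> tangent_space h p"
    using p by (auto simp: transversal_at_def zero_locus_def)
  have par: "u = (u $ i / cross ?x v $ i) *s cross ?x v" if "dot ?x u = 0" "dot v u = 0" for u :: "complex ^ 3"
    using cross_parallel[OF that, of i] i by (simp add: vec_eq_iff field_simps)
  have xa: "dot ?x a = 0" "dot ?x b = 0"
    using euler_identity_eval[OF g, of ?x] euler_identity_eval[OF h, of ?x] z by (simp_all add: dot_def a_def b_def)
  have va: "dot v a = 0" "dot v b = 0"
    using v by (simp_all add: dot_def a_def b_def mult.commute)
  define s where "s = a $ i / cross ?x v $ i"
  define t where "t = b $ i / cross ?x v $ i"
  have ab: "a = s *s cross ?x v" "b = t *s cross ?x v"
    unfolding s_def t_def by (rule par[OF xa(1) va(1)], rule par[OF xa(2) va(2)])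
  have "a \<noteq> 0" "b \<noteq> 0"
    using ns by (auto simp: sing_locus_def a_def b_def vec_eq_iff)
  then have nz: "s \<noteq> 0" "t \<noteq> 0" using ab by auto
  have "dot a u = 0 \<longleftrightarrow> dot b u = 0" for u
  proof -
    have "dot a u = s * dot (cross ?x v) u" "dot b u = t * dot (cross ?x v) u"
      by (simp_all only: ab dot_def vector_smult_component sum_distrib_left mult.assoc)
    then show ?thesis using nz by simp
  qed
  then have "tangent_space g p = tangent_space h p"
    unfolding tangent_space_def by (simp add: dot_def a_def b_def)
  then show False using ne by simp
qed

text \<open>Scaling a coordinate \<open>i\<close> to 1 places the point in one of three countable
  sets: a common tangent vector is parallel to the point, hence 0 once its coordinate
  \<open>i\<close> vanishes.\<close>

lemma countable_transversal:
  assumes g: "homogeneous n g" and h: "homogeneous k h"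
  shows "countable {p. transversal_at g h p}"
proof -
  define Z where "Z i = {y :: complex ^ 3. mp_eval id y g = 0 \<and> mp_eval id y h = 0 \<and> y $ i = 1 \<and>
     (\<forall>v. (\<Sum>j\<in>UNIV. mp_eval id y (mp_deriv j g) * v $ j) = 0 \<longrightarrow>
          (\<Sum>j\<in>UNIV. mp_eval id y (mp_deriv j h) * v $ j) = 0 \<longrightarrow> v $ i = 0 \<longrightarrow> v = 0)}" for i :: 3
  have "{p. transversal_at g h p} \<subseteq> (\<Union>i. abs_proj ` Z i)"
  proof
    fix p assume "p \<in> {p. transversal_at g h p}"
    then have p: "transversal_at g h p" by simp
    let ?x = "rep_proj p"
    obtain i where i: "?x $ i \<noteq> 0" using rep_proj_nonzero[of p] by (auto simp: vec_eq_iff simp del: rep_proj_nonzero)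
    define c where "c = inverse (?x $ i)"
    have c: "c \<noteq> 0" using i by (simp add: c_def)
    let ?y = "c *s ?x"
    have y: "?y $ i = 1" using i by (simp add: c_def)
    then have "?y \<noteq> 0" by auto
    then have abs: "abs_proj ?y = p"
      using abs_proj_eq_iff[of ?x ?y] by auto
    have z: "mp_eval id ?x g = 0" "mp_eval id ?x h = 0"
      using p by (auto simp: transversal_at_def zero_locus_def)
    have scale: "(\<Sum>j\<in>UNIV. mp_eval id ?x (mp_deriv j q) * v $ j) = 0"
      if "homogeneous n q" "(\<Sum>j\<in>UNIV. mp_eval id ?y (mp_deriv j q) * v $ j) = 0" for n q v
    proof -
      have "c ^ (n - 1) * (\<Sum>j\<in>UNIV. mp_eval id ?x (mp_deriv j q) * v $ j) = 0"
        using that(2) unfolding mp_eval_scale[OF homogeneous_mp_deriv[OF that(1)]]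
        by (simp only: sum_distrib_left mult.assoc)
      then show ?thesis using c by simp
    qed
    have "v = 0" if v: "(\<Sum>j\<in>UNIV. mp_eval id ?y (mp_deriv j g) * v $ j) = 0"
        "(\<Sum>j\<in>UNIV. mp_eval id ?y (mp_deriv j h) * v $ j) = 0" "v $ i = 0" for v
    proof -
      have "cross ?x v = 0"
        by (rule transversal_kernel[OF g h p scale[OF g v(1)] scale[OF h v(2)]])
      then have "?x$2 * v$3 = ?x$3 * v$2" "?x$3 * v$1 = ?x$1 * v$3" "?x$1 * v$2 = ?x$2 * v$1"
        by (simp_all add: vec_eq_iff forall_3)
      then show ?thesis
        using exhaust_3[of i] i v(3) by (auto simp: vec_eq_iff forall_3)
    qed
    then have "?y \<in> Z i"
      unfolding Z_def using y by (simp only: mem_Collect_eq mp_eval_scale[OF g] mp_eval_scale[OF h] z mult_zero_right) blast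
    then have "p \<in> abs_proj ` Z i" using abs by (metis image_eqI)
    then show "p \<in> (\<Union>i. abs_proj ` Z i)" by blast
  qed
  moreover have "countable (\<Union>i. abs_proj ` Z i)"
    unfolding Z_def using isolated_common_zero by (intro countable_UN countable_image) auto
  ultimately show ?thesis by (rule countable_subset)
qed

lemma countable_ordinary:
  assumes "finite K" and hom: "\<And>g. g \<in> K \<Longrightarrow> \<exists>n. homogeneous n g"
    and ordinary: "\<forall>p\<in>S. \<exists>r. ordinary_point K p r"
  shows "countable S"
proof -
  have "S \<subseteq> (\<Union>(g, h)\<in>K \<times> K. {p. transversal_at g h p})"
  proof
    fix p assume "p \<in> S"
    then obtain r where r: "2 \<le> r" "card {g\<in>K. p \<in> zero_locus g} = r"
      and pw: "pairwise (\<lambda>g h. transversal_at g h p) {g\<in>K. p \<in> zero_locus g}"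
      using ordinary unfolding ordinary_point_def by blast
    then have "\<exists>g h. g \<in> {g\<in>K. p \<in> zero_locus g} \<and> h \<in> {g\<in>K. p \<in> zero_locus g} \<and> g \<noteq> h"
      by (metis (no_types, lifting) One_nat_def Suc_1 card_le_Suc0_iff_eq card.infinite not_less_eq_eq zero_le)
    then obtain g h where "g \<in> K" "h \<in> K" "transversal_at g h p"
      using pw unfolding pairwise_def by blast
    then show "p \<in> (\<Union>(g, h)\<in>K \<times> K. {p. transversal_at g h p})" by blast
  qed
  moreover have "countable (\<Union>(g, h)\<in>K \<times> K. {p. transversal_at g h p})"
  proof (rule countable_UN)
    show "countable (K \<times> K)" using assms(1) by (simp add: countable_finite)
    fix x assume "x \<in> K \<times> K"
    then obtain g h where x: "x = (g, h)" "g \<in> K" "h \<in> K" by blast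
    obtain n where n: "homogeneous n g" using hom[OF x(2)] by blast
    obtain k where k: "homogeneous k h" using hom[OF x(3)] by blast
    show "countable (case x of (g, h) \<Rightarrow> {p. transversal_at g h p})"
      using countable_transversal[OF n k] by (simp add: x(1))
  qed
  ultimately show ?thesis by (rule countable_subset)
qed

text \<open>
  A point lies on the line \<open>z = \<alpha> x + \<alpha>\<^sup>2 y\<close> for at most two \<open>\<alpha>\<close>, so the lines of this family that meet a
  countable set are countable in number.
\<close>

lemma line_avoiding_countable:
  fixes S :: "3 proj set"
  assumes "countable S"
  obtains \<alpha> :: complex where "\<And>x. x \<noteq> 0 \<Longrightarrow> x $ 3 = \<alpha> * x $ 1 + \<alpha>\<^sup>2 * x $ 2 \<Longrightarrow> abs_proj x \<notin> S"
proof -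
  define A where "A p = {\<alpha> :: complex. poly [:- rep_proj p $ 3, rep_proj p $ 1, rep_proj p $ 2:] \<alpha> = 0}" for p :: "3 proj"
  have "finite (A p)" for p
  proof -
    have "[:- rep_proj p $ 3, rep_proj p $ 1, rep_proj p $ 2:] \<noteq> 0"
      using rep_proj_nonzero[of p] by (auto simp: vec_eq_iff forall_3 simp del: rep_proj_nonzero)
    then show ?thesis unfolding A_def by (rule poly_roots_finite)
  qed
  then have "countable (\<Union>p\<in>S. A p)"
    using assms by (intro countable_UN) (auto intro: countable_finite)
  then have "(\<Union>p\<in>S. A p) \<noteq> UNIV"
    using uncountable_UNIV_complex by auto
  then obtain \<alpha> where \<alpha>: "\<And>p. p \<in> S \<Longrightarrow> \<alpha> \<notin> A p" by blast
  show thesis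
  proof (rule that[of \<alpha>], rule notI)
    fix x :: "complex ^ 3" assume x: "x \<noteq> 0" "x $ 3 = \<alpha> * x $ 1 + \<alpha>\<^sup>2 * x $ 2" "abs_proj x \<in> S"
    obtain c where c: "rep_proj (abs_proj x) = c *s x" by (rule rep_abs_proj[OF x(1)])
    have "\<alpha> \<in> A (abs_proj x)"
      unfolding A_def c by (simp add: x(2) power2_eq_square algebra_simps)
    then show False using \<alpha>[OF x(3)] by blast
  qed
qed

lemma free_curve_basis:
  assumes "free_curve f"
  obtains b c :: "3 mpoly ^ 3" and d1 d2 where "\<And>i. homogeneous d1 (b $ i)" "\<And>i. homogeneous d2 (c $ i)"
    "\<And>p q. p *s b + q *s c = 0 \<Longrightarrow> p = 0 \<and> q = 0" "AR f = {p *s b + q *s c | p q. True}"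
proof -
  interpret module "(*s) :: 3 mpoly \<Rightarrow> 3 mpoly ^ 3 \<Rightarrow> 3 mpoly ^ 3" by (rule module_vec)
  obtain B :: "(3 mpoly ^ 3) set" where B: "card B = 2" "\<forall>\<rho>\<in>B. \<exists>n. \<forall>i. homogeneous n (\<rho> $ i)" "independent B" "span B = AR f"
    using assms unfolding free_curve_def by blast
  obtain b c where bc: "B = {b, c}" "b \<noteq> c" using B(1) by (auto simp: card_2_iff)
  obtain d1 d2 where d: "\<And>i. homogeneous d1 (b $ i)" "\<And>i. homogeneous d2 (c $ i)"
    using B(2) bc(1) by blast
  have ind: "p = 0 \<and> q = 0" if 0: "p *s b + q *s c = 0" for p q
  proof -
    let ?u = "\<lambda>v. if v = b then p else q"
    have sum: "(\<Sum>v\<in>B. ?u v *s v) = 0" using bc 0 by simp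
    have "?u b = 0" "?u c = 0"
      by (rule independentD[OF B(3) _ subset_refl sum]; simp add: bc(1))+
    then show ?thesis using bc(2) by simp
  qed
  have "span B = {p *s b + q *s c | p q. True}"
  proof (intro equalityI subsetI)
    fix a assume "a \<in> span B"
    then obtain p where "a - p *s b \<in> span {c}" unfolding bc(1) by (auto simp: span_insert)
    then obtain q where "a - p *s b = q *s c" by (auto simp: span_singleton)
    then have "a = p *s b + q *s c" by (simp add: algebra_simps)
    then show "a \<in> {p *s b + q *s c | p q. True}" by blast
  next
    fix a assume "a \<in> {p *s b + q *s c | p q. True}"
    then show "a \<in> span B" unfolding bc(1) by (auto intro!: span_add span_scale intro: span_base)
  qed
  then show thesis using that[OF d ind] B(4) by simp
qed

text \<open>The cone over the complement of a point is given by the nonvanishing of some 2 by 2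
  minor, an open condition that implies \<open>v \<noteq> 0\<close>. With it, finite subsets of
  projective space are discrete.\<close>

lemma open_Compl_finite_proj:
  fixes A :: "'n::finite proj set"
  assumes "finite A"
  shows "open (- A)"
proof -
  have "open (- {p})" for p :: "'n proj"
  proof -
    let ?x = "rep_proj p"
    have "{v. v \<noteq> 0 \<and> abs_proj v \<in> - {p}} = (\<Union>i j. {v. v $ i * ?x $ j \<noteq> v $ j * ?x $ i})"
    proof (intro equalityI subsetI)
      fix v assume "v \<in> {v. v \<noteq> 0 \<and> abs_proj v \<in> - {p}}"
      then have v: "v \<noteq> 0" "abs_proj v \<noteq> p" by auto
      obtain i where i: "?x $ i \<noteq> 0"
        using rep_proj_nonzero[of p] by (auto simp: vec_eq_iff simp del: rep_proj_nonzero)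
      have "\<exists>j. v $ j * ?x $ i \<noteq> v $ i * ?x $ j"
      proof (rule ccontr)
        assume "\<nexists>j. v $ j * ?x $ i \<noteq> v $ i * ?x $ j"
        then have "v = (v $ i / ?x $ i) *s ?x" using i by (simp add: vec_eq_iff field_simps)
        then have "abs_proj ?x = abs_proj v" using abs_proj_eq_iff[of ?x v] v(1) by auto
        then show False using v(2) by simp
      qed
      then show "v \<in> (\<Union>i j. {v. v $ i * ?x $ j \<noteq> v $ j * ?x $ i})" by blast
    next
      fix v assume "v \<in> (\<Union>i j. {v. v $ i * ?x $ j \<noteq> v $ j * ?x $ i})"
      then obtain i j where ij: "v $ i * ?x $ j \<noteq> v $ j * ?x $ i" by blast
      then have v: "v \<noteq> 0" by auto
      have "abs_proj v \<noteq> p"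
      proof
        assume "abs_proj v = p"
        then obtain c where "v = c *s ?x" using abs_proj_eq_iff[of ?x v] v by auto
        then show False using ij by simp
      qed
      then show "v \<in> {v. v \<noteq> 0 \<and> abs_proj v \<in> - {p}}" using v by blast
    qed
    moreover have "open (\<Union>i j. {v :: complex ^ 'n. v $ i * ?x $ j \<noteq> v $ j * ?x $ i})"
      by (intro open_UN ballI open_Collect_neq continuous_intros)
    ultimately show ?thesis unfolding open_proj_def by simp
  qed
  then have "open (\<Inter>p\<in>A. - {p})" using assms by (intro open_INT) auto
  moreover have "(\<Inter>p\<in>A. - {p}) = - A" by auto
  ultimately show ?thesis by simp
qed

lemma finite_imp_discrete_proj:
  fixes A :: "'n::finite proj set"
  assumes "finite A"
  shows "discrete A"
proof (rule discreteI)
  fix p assume "p \<in> A"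
  have "open (- (A - {p}))" by (rule open_Compl_finite_proj) (use assms in simp)
  moreover have "- (A - {p}) \<inter> A = {p}" using \<open>p \<in> A\<close> by blast
  ultimately show "p isolated_in A" using \<open>p \<in> A\<close> by (intro isolated_inI)
qed

text \<open>It guarantees that the choice in \<open>local_tjurina\<close> returns a genuine local
  equation.\<close>

lemma local_equation_exists:
  assumes "CARD('n::finite) = CARD('m::finite) + 1"
  shows "\<exists>g :: 'm mpoly. local_equation F (p :: 'n proj) g"
proof -
  obtain i where i: "rep_proj p $ i \<noteq> 0"
    using rep_proj_nonzero[of p] by (auto simp: vec_eq_iff simp del: rep_proj_nonzero)
  let ?v = "inverse (rep_proj p $ i) *s rep_proj p"
  have v: "?v $ i = 1" using i by simp
  then have "?v \<noteq> 0" by auto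
  then have "abs_proj ?v = p" using abs_proj_eq_iff[of "rep_proj p" ?v] by auto
  moreover have "card (UNIV :: 'm set) = card (- {i})"
    using assms by (simp add: Compl_eq_Diff_UNIV card_Diff_singleton)
  then obtain \<sigma> :: "'m \<Rightarrow> 'n" where "bij_betw \<sigma> UNIV (- {i})"
    using finite_same_card_bij[of "UNIV :: 'm set" "- {i}"] by auto
  ultimately show ?thesis
    unfolding local_equation_def using v by blast
qed

definition embed_index :: "3 \<Rightarrow> 4" where
  "embed_index i = (if i = 1 then 1 else if i = 2 then 2 else 3)"

lemma embed_index_simps [simp]: "embed_index 1 = 1" "embed_index 2 = 2" "embed_index 3 = 3"
  by (simp_all add: embed_index_def)

interpretation suspension: new_variable embed_index 4
proof
  have "inj embed_index"
  proof (rule injI)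
    fix i j assume "embed_index i = embed_index j"
    then show "i = j" using exhaust_3[of i] exhaust_3[of j] by auto
  qed
  moreover have "range embed_index = - {4}"
  proof -
    have "range embed_index = {1, 2, 3}" by (simp add: UNIV_3)
    also have "\<dots> = - {4}"
    proof (intro equalityI subsetI)
      fix x :: 4 assume "x \<in> - {4}"
      then show "x \<in> {1, 2, 3}" using exhaust_4[of x] by auto
    qed auto
    finally show ?thesis .
  qed
  ultimately show "bij_betw embed_index UNIV (- {4})" by (simp add: bij_betw_def)
qed

lemma suspension_\<iota>: "suspension.\<iota> f = mp_eval Const (vector [Var 1, Var 2, Var 3]) f"
proof -
  have "(\<chi> i. Var (embed_index i)) = (vector [Var 1, Var 2, Var 3] :: 4 mpoly ^ 3)"
    by (simp add: vec_eq_iff forall_3)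
  then show ?thesis by (simp only: suspension.\<iota>_def)
qed

lemma four_mult_le_square: "4 * a * b \<le> (a + b :: real)\<^sup>2"
  using zero_le_power2[of "a - b"] by (simp add: power2_eq_square algebra_simps)

text \<open>With \<open>M = m - 1\<close>, the products of \<open>Var 4 ^ j\<close> for
  \<open>j < M\<close> with \<open>N\<close> independent forms of degree \<open>3 * M - j\<close>
  give \<open>M * N\<close> forms of degree \<open>3 * M\<close> that are independent modulo the
  Jacobian ideal of \<open>F\<close>.\<close>

lemma suspension_tjurina:
  fixes f :: "3 mpoly" and F :: "4 mpoly"
  assumes f: "homogeneous m f" "m > 0" and free: "free_curve f" and countable: "countable (sing_locus f)"
    and F: "F = suspension.\<iota> f + Var 4 ^ m"
  shows "finite (sing_locus F)" "real (total_tjurina F) \<ge> 3 / 4 * (real m - 1) ^ 3"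
proof -
  obtain b c :: "3 mpoly ^ 3" and d1 d2 where bc: "\<And>i. homogeneous d1 (b $ i)" "\<And>i. homogeneous d2 (c $ i)"
    "\<And>p q. p *s b + q *s c = 0 \<Longrightarrow> p = 0 \<and> q = 0" "AR f = {p *s b + q *s c | p q. True}"
    by (rule free_curve_basis[OF free]) blast
  obtain \<alpha> where \<alpha>: "\<And>x :: complex ^ 3. x \<noteq> 0 \<Longrightarrow> x $ 3 = \<alpha> * x $ 1 + \<alpha>\<^sup>2 * x $ 2 \<Longrightarrow> abs_proj x \<notin> sing_locus f"
    by (rule line_avoiding_countable[OF countable]) blast
  have smooth: "\<exists>i. mp_eval id x (mp_deriv i f) \<noteq> 0" if "x \<noteq> 0" "x $ 3 = \<alpha> * x $ 1 + \<alpha>\<^sup>2 * x $ 2"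
    for x :: "complex ^ 3"
    using \<alpha>[OF that] sing_locus_abs_proj[OF f that(1)] by blast
  interpret fcl: free_curve_line f b c m d1 d2 \<alpha> "\<alpha>\<^sup>2"
  proof
    show "\<exists>i. mp_eval id (vector [1, t, \<alpha> + \<alpha>\<^sup>2 * t]) (mp_deriv i f) \<noteq> 0" for t
      by (rule smooth) (simp_all add: vec_eq_iff forall_3)
    show "\<exists>i. mp_eval id (vector [0, 1, \<alpha>\<^sup>2]) (mp_deriv i f) \<noteq> 0"
      by (rule smooth) (simp_all add: vec_eq_iff forall_3)
  qed (fact f bc)+
  interpret FJ: saturated_jacobian F "suspension.\<iota> (line \<alpha> (\<alpha>\<^sup>2))" m
    by (rule suspension.saturated_jacobian_suspension[OF F f(2) fcl.saturated])
  show "finite (sing_locus F)" by (rule FJ.finite_sing_locus)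
  define M where "M = m - 1"
  have M: "d1 + d2 = M" unfolding M_def by (rule fcl.exponents)
  define N where "N = M\<^sup>2 - d1 * d2"
  have ex: "\<exists>h. (\<forall>t<N. homogeneous (3 * M - j) (h t)) \<and>
      (\<forall>x. (\<Sum>t<N. Const (x t) * h t) \<in> jacobian_ideal f \<longrightarrow> (\<forall>t<N. x t = 0))" if j: "j < M" for j
  proof -
    \<comment> \<open>The degree \<open>3 * M\<close> is chosen so that, for all
      \<open>j < M\<close>, the complementary degree stays in the range from \<open>2 * M\<close> on
      where the Hilbert function of \<open>f\<close> is constant.\<close>
    have deg: "(M - j) + 2 * (d1 + d2) = 3 * M - j" using M j by simp
    obtain T where T: "finite T" "card T + d1 * d2 = (m - 1)\<^sup>2"
      "\<And>t. t \<in> T \<Longrightarrow> homogeneous (3 * M - j) t"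
      "\<And>x. (\<Sum>t\<in>T. Const (x t) * t) \<in> jacobian_ideal f \<Longrightarrow> \<forall>t\<in>T. x t = 0"
      by (rule fcl.complement_of_jacobian[of "M - j"]) (unfold deg, blast)
    have "card T = N" using T(2) by (simp add: N_def M_def)
    then obtain h where h: "bij_betw h {..<N} T"
      using ex_bij_betw_nat_finite[OF T(1)] by (auto simp: atLeast0LessThan)
    have "\<forall>t<N. x t = 0" if mem: "(\<Sum>t<N. Const (x t) * h t) \<in> jacobian_ideal f" for x
    proof -
      let ?y = "\<lambda>u. x (inv_into {..<N} h u)"
      have "(\<Sum>u\<in>T. Const (?y u) * u) = (\<Sum>t<N. Const (?y (h t)) * h t)"
        by (rule sum.reindex_bij_betw[OF h, symmetric])
      also have "\<dots> = (\<Sum>t<N. Const (x t) * h t)"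
        using h by (intro sum.cong refl) (simp add: bij_betw_inv_into_left[OF h])
      finally have "\<forall>u\<in>T. ?y u = 0" using mem by (intro T(4)) (simp only:)
      then have "?y (h t) = 0" if "t < N" for t
        using bij_betwE[OF h] that by blast
      then show ?thesis using bij_betw_inv_into_left[OF h] by simp
    qed
    moreover have "\<forall>t<N. homogeneous (3 * M - j) (h t)"
      using T(3) bij_betwE[OF h] by blast
    ultimately show ?thesis by blast
  qed
  have "\<forall>j. \<exists>h. j < M \<longrightarrow> (\<forall>t<N. homogeneous (3 * M - j) (h t)) \<and>
      (\<forall>x. (\<Sum>t<N. Const (x t) * h t) \<in> jacobian_ideal f \<longrightarrow> (\<forall>t<N. x t = 0))"
    unfolding ex_simps(6) by (intro allI impI ex)
  then have "\<exists>h. \<forall>j. j < M \<longrightarrow> (\<forall>t<N. homogeneous (3 * M - j) (h j t)) \<and>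
      (\<forall>x. (\<Sum>t<N. Const (x t) * h j t) \<in> jacobian_ideal f \<longrightarrow> (\<forall>t<N. x t = 0))"
    unfolding choice_iff .
  then obtain h where h: "\<forall>j. j < M \<longrightarrow> (\<forall>t<N. homogeneous (3 * M - j) (h j t)) \<and>
      (\<forall>x. (\<Sum>t<N. Const (x t) * h j t) \<in> jacobian_ideal f \<longrightarrow> (\<forall>t<N. x t = 0))"
    by (elim exE)
  have hom: "homogeneous (3 * M - j) (h j t)" if "j < M" "t < N" for j t
    using h that by simp
  have ind: "\<forall>t\<in>{..<N}. x t = 0" if "j < M" "(\<Sum>t<N. Const (x t) * h j t) \<in> jacobian_ideal f" for j x
  proof -
    have "(\<Sum>t<N. Const (x t) * h j t) \<in> jacobian_ideal f \<longrightarrow> (\<forall>t<N. x t = 0)"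
      using h[rule_format, OF that(1)] by (elim conjE allE)
    then show ?thesis using that(2) by simp
  qed
  define H where "H e = Var 4 ^ fst e * suspension.\<iota> (h (fst e) (snd e))" for e
  define g where "g p = (SOME g :: 3 mpoly. local_equation F p g)" for p
  have "local_equation F p (g p)" for p
    unfolding g_def by (rule someI_ex[OF local_equation_exists]) simp
  moreover have "homogeneous (3 * M) (H e)" if "e \<in> {..<M} \<times> {..<N}" for e
  proof -
    have "homogeneous (fst e * 1 + (3 * M - fst e)) (H e)"
      unfolding H_def using that
      by (intro homogeneous_mult homogeneous_power homogeneous_Var suspension.homogeneous_\<iota> hom) auto
    moreover have "fst e * 1 + (3 * M - fst e) = 3 * M" using that by auto
    ultimately show ?thesis by (simp only:)
  qed
  moreover have "\<forall>e\<in>{..<M} \<times> {..<N}. x e = 0"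
    if "(\<Sum>e\<in>{..<M} \<times> {..<N}. Const (x e) * H e) \<in> jacobian_ideal F" for x
    unfolding M_def
  proof (rule suspension.suspension_independent[OF F f(2), where B = "{..<N}" and h = h and y = x])
    show "\<forall>t\<in>{..<N}. y t = 0" if "j < m - 1" "(\<Sum>t<N. Const (y t) * h j t) \<in> jacobian_ideal f" for j y
      using that unfolding M_def[symmetric] by (rule ind)
    show "(\<Sum>(j, t)\<in>{..<m - 1} \<times> {..<N}. Const (x (j, t)) * (Var 4 ^ j * suspension.\<iota> (h j t))) \<in> jacobian_ideal F"
      using that by (simp add: H_def M_def case_prod_unfold)
  qed
  ultimately have "card ({..<M} \<times> {..<N}) \<le> (\<Sum>p\<in>sing_locus F. quotient_dim (tjurina_ideal (g p)))"
    by (intro FJ.sum_quotient_dim_ge[where h = H and n = "3 * M"]) auto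
  then have le: "M * N \<le> total_tjurina F"
    unfolding total_tjurina_def local_tjurina_def g_def by simp
  have "real M ^ 2 = (real d1 + real d2)\<^sup>2" using M by (metis of_nat_add)
  \<comment> \<open>The worst case is \<open>d1 = d2\<close>; here the constant 3/4 arises.\<close>
  then have bound: "4 * real d1 * real d2 \<le> real M ^ 2"
    using four_mult_le_square[of "real d1" "real d2"] by simp
  \<comment> \<open>This makes the truncated subtraction in the definition of \<open>N\<close> a
    true one.\<close>
  have "d1 * d2 \<le> M\<^sup>2"
  proof -
    have "0 \<le> real d1 * real d2" by simp
    moreover have "4 * (real d1 * real d2) \<le> real M ^ 2" using bound by (simp only: mult.assoc)
    ultimately have "real d1 * real d2 \<le> real M ^ 2" by linarith
    then have "real (d1 * d2) \<le> real (M\<^sup>2)" by (simp only: of_nat_mult of_nat_power)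
    then show ?thesis by (simp only: of_nat_le_iff)
  qed
  then have "real N = real M ^ 2 - real d1 * real d2"
    by (simp add: N_def of_nat_diff)
  then have "3 / 4 * real M ^ 2 \<le> real N" using bound by simp
  then have "real M * (3 / 4 * real M ^ 2) \<le> real M * real N"
    by (intro mult_left_mono) auto
  also have "\<dots> \<le> real (total_tjurina F)" using le by (simp flip: of_nat_mult)
  also have "real M = real m - 1" using f(2) by (simp add: M_def of_nat_diff)
  finally show "real (total_tjurina F) \<ge> 3 / 4 * (real m - 1) ^ 3"
    by (simp add: power3_eq_cube power2_eq_square)
qed

theorem proposition5p2:
  fixes Q L :: "3 mpoly set" and f :: "3 mpoly" and F :: "4 mpoly" and k d :: nat
  assumes "conic_line_arrangement Q L" and "card Q = k" and "card L = d"
    and "f = \<Prod>Q * \<Prod>L"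
    and "\<forall>p\<in>sing_locus f. (\<exists>r. ordinary_point (Q \<union> L) p r) \<and> quasi_homogeneous_at f p"
    and "free_curve f"
    and "F = mp_eval Const (vector [Var 1, Var 2, Var 3]) f + Var 4 ^ (2 * k + d)"
  shows "discrete (sing_locus F) \<and>
    real (total_tjurina F) \<ge>
      (2 * real k + real d - 1) *
      (3 * real k * (real k - 1) + 3 * real k * real d + 3 * (real d - 1)\<^sup>2 / 4)"
proof -
  have fin: "finite Q" "finite L" and Q: "\<And>q. q \<in> Q \<Longrightarrow> homogeneous 2 q" and L: "\<And>q. q \<in> L \<Longrightarrow> homogeneous 1 q"
    using assms(1) by (auto simp: conic_line_arrangement_def smooth_conic_def proj_line_def)
  have "3 * real k * (real k - 1) + 3 * real k * real d + 3 * (real d - 1)\<^sup>2 / 4 = 3 / 4 * (2 * real k + real d - 1)\<^sup>2"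
    by (simp add: power2_eq_square field_simps)
  then have bound: "(2 * real k + real d - 1) *
      (3 * real k * (real k - 1) + 3 * real k * real d + 3 * (real d - 1)\<^sup>2 / 4)
      = 3 / 4 * (real (2 * k + d) - 1) ^ 3"
    by (simp add: power3_eq_cube power2_eq_square)
  show ?thesis
  proof (cases "2 * k + d = 0")
    \<comment> \<open>The empty arrangement: \<open>f\<close> is the empty product 1 and
      \<open>Var 4\<close> has exponent 0, so \<open>F\<close> is the constant 2. There is no
      singular point, and the bound is \<open>- 3 / 4\<close>.\<close>
    case True
    then have "Q = {}" "L = {}" using assms(2,3) fin by auto
    then have F: "F = 1 + 1"
      using True by (simp add: assms(4,7) mp_eval_simps)
    have "mp_eval id x F = 1 + 1" for x
      unfolding F mp_eval_add[OF ring_morphism_id] ring_morphism_1[OF ring_morphism_mp_eval[OF ring_morphism_id]] ..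
    then have "sing_locus F = {}"
      by (simp add: sing_locus_def zero_locus_def)
    then show ?thesis
      unfolding bound using True by (simp add: total_tjurina_def)
  next
    case False
    have "homogeneous ((\<Sum>q\<in>Q. 2) + (\<Sum>q\<in>L. 1)) f"
      unfolding assms(4) by (intro homogeneous_mult homogeneous_prod Q L)
    then have hom: "homogeneous (2 * k + d) f"
      by (simp add: assms(2,3) mult.commute)
    have countable: "countable (sing_locus f)"
    proof (rule countable_ordinary)
      show "finite (Q \<union> L)" using fin by simp
      show "\<exists>n. homogeneous n g" if "g \<in> Q \<union> L" for g using that Q L by blast
      show "\<forall>p\<in>sing_locus f. \<exists>r. ordinary_point (Q \<union> L) p r" using assms(5) by blast
    qed
    have F: "F = suspension.\<iota> f + Var 4 ^ (2 * k + d)"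
      by (simp only: assms(7) suspension_\<iota>)
    have pos: "2 * k + d > 0" using False by simp
    show ?thesis
      unfolding bound
      using finite_imp_discrete_proj[OF suspension_tjurina(1)[OF hom pos assms(6) countable F]]
        suspension_tjurina(2)[OF hom pos assms(6) countable F] by (rule conjI)
  qed
qed

end
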